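(* Let $A$ be a finitely generated (discrete) abelian group of rank $d$, and let $$G=\Big(\bigoplus_{i=1}^m V_i\Big)\rtimes A$$ be a semidirect product in which each $V_i$ is $A$-invariant and is isomorphic to a finite product of local fields, on which $A$ acts by scalar multiplication (i.e. each element of $A$ acts on each local field factor as multiplication by a nonzero element of that field). Assume that for every pair $i,j\in\{1,\dots,m\}$ (including $i=j$) there exists an element of $A$ acting by strict contractions on both $V_i$ and $V_j$, i.e. acting by multiplication by an element of norm $<1$ on each local field factor of $V_i$ and of $V_j$. Then $G$ is compactly presented; its Dehn function is quadratic if $d\ge 2$, and linear if $d=1$.
   Context: A local field is a non-discrete locally compact normed field (different factors may be different local fields, of any characteristic, archimedean or not). A locally compact group $G$ is compactly presented if for some (equivalently, any) compact symmetric generating set $S$ there is an integer $\ell$ such that the abstract group $G$ has a presentation with generating set $S$ and relators of length $\le \ell$. With $(S,\ell)$ fixed, a relation is a word in the letters of $S$ representing the trivial element of $G$; its area is the least $m$ such that it is, in the free group on $S$, a product of $\le m$ conjugates of relations of length $\le \ell$. The Dehn function is $\delta(n)=\sup\{\mathrm{area}(w) : w \text{ a relation of length}\le n\}$. It is considered up to the equivalence $\approx$, where $u\approx v$ if there are positive constants $a_1,\dots,a_4,b_1,\dots,b_4$ with $a_1u(a_2n)-a_3n-a_4\le v(n)\le b_1u(b_2n)+b_3n+b_4$ for all $n\ge 0$; up to $\approx$ it does not depend on $(S,\ell)$. "Quadratic" means $\delta(n)\approx n^2$ and "linear" means $\delta(n)\approx n$. *)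

theory Defs
  imports "HOL-Analysis.Analysis" "HOL-Algebra.Algebra"
begin

locale normed_field = field K for K :: "('k, 'c) ring_scheme" (structure) +
  fixes N :: "'k \<Rightarrow> real"
  assumes norm_nonneg: "x \<in> carrier K \<Longrightarrow> 0 \<le> N x"
    and norm_eq_zero_iff: "x \<in> carrier K \<Longrightarrow> N x = 0 \<longleftrightarrow> x = \<zero>"
    and norm_mult: "\<lbrakk>x \<in> carrier K; y \<in> carrier K\<rbrakk> \<Longrightarrow> N (x \<otimes> y) = N x * N y"
    and norm_triangle: "\<lbrakk>x \<in> carrier K; y \<in> carrier K\<rbrakk> \<Longrightarrow> N (x \<oplus> y) \<le> N x + N y"

text \<open>The locale \<open>Metric_space\<close> requires symmetry and nonnegativity of the distance also outside
  the carrier, hence the default value 0 there.\<close>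

definition norm_dist :: "('k, 'c) ring_scheme \<Rightarrow> ('k \<Rightarrow> real) \<Rightarrow> 'k \<Rightarrow> 'k \<Rightarrow> real" where
  "norm_dist K N x y = (if x \<in> carrier K \<and> y \<in> carrier K then N (x \<ominus>\<^bsub>K\<^esub> y) else 0)"

definition norm_topology :: "('k, 'c) ring_scheme \<Rightarrow> ('k \<Rightarrow> real) \<Rightarrow> 'k topology" where
  "norm_topology K N = Metric_space.mtopology (carrier K) (norm_dist K N)"

locale local_field = normed_field +
  assumes locally_compact: "locally_compact_space (norm_topology K N)"
    and nondiscrete: "norm_topology K N \<noteq> discrete_topology (carrier K)"

definition finitely_generated :: "('a, 'b) monoid_scheme \<Rightarrow> bool" where
  "finitely_generated A \<longleftrightarrow> (\<exists>S. finite S \<and> S \<subseteq> carrier A \<and> generate A S = carrier A)"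

definition int_independent :: "('a, 'b) monoid_scheme \<Rightarrow> 'a set \<Rightarrow> bool" where
  "int_independent A B \<longleftrightarrow> finite B \<and> B \<subseteq> carrier A \<and>
     (\<forall>c :: 'a \<Rightarrow> int. finprod A (\<lambda>x. x [^]\<^bsub>A\<^esub> c x) B = \<one>\<^bsub>A\<^esub> \<longrightarrow> (\<forall>x\<in>B. c x = 0))"

definition abelian_rank :: "('a, 'b) monoid_scheme \<Rightarrow> nat" where
  "abelian_rank A = Max {card B | B. int_independent A B}"

definition semidirect_product ::
    "('v, 'b) monoid_scheme \<Rightarrow> ('a, 'c) monoid_scheme \<Rightarrow> ('a \<Rightarrow> 'v \<Rightarrow> 'v) \<Rightarrow> ('v \<times> 'a) monoid" where
  "semidirect_product V A \<phi> =
     \<lparr>carrier = carrier V \<times> carrier A,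
      mult = (\<lambda>(v, a) (w, b). (v \<otimes>\<^bsub>V\<^esub> \<phi> a w, a \<otimes>\<^bsub>A\<^esub> b)),
      one = (\<one>\<^bsub>V\<^esub>, \<one>\<^bsub>A\<^esub>)\<rparr>"

text \<open>The \<open>i\<close>-th summand is the additive group of the product of the fields \<open>F i j\<close>
  for \<open>1 \<le> j \<le> k i\<close>, and an element \<open>a\<close> acts on \<open>F i j\<close> as multiplication by \<open>\<rho> i j a\<close>.\<close>

definition summand :: "(nat \<Rightarrow> nat) \<Rightarrow> (nat \<Rightarrow> nat \<Rightarrow> 'k ring) \<Rightarrow> nat \<Rightarrow> (nat \<Rightarrow> 'k) monoid" where
  "summand k F i = product_group {1..k i} (\<lambda>j. add_monoid (F i j))"

definition scalar_action ::
    "nat \<Rightarrow> (nat \<Rightarrow> nat) \<Rightarrow> (nat \<Rightarrow> nat \<Rightarrow> 'k ring) \<Rightarrow> (nat \<Rightarrow> nat \<Rightarrow> 'a \<Rightarrow> 'k)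
      \<Rightarrow> 'a \<Rightarrow> (nat \<Rightarrow> nat \<Rightarrow> 'k) \<Rightarrow> (nat \<Rightarrow> nat \<Rightarrow> 'k)" where
  "scalar_action m k F \<rho> a v = (\<lambda>i\<in>{1..m}. \<lambda>j\<in>{1..k i}. \<rho> i j a \<otimes>\<^bsub>F i j\<^esub> v i j)"

definition scalar_semidirect ::
    "nat \<Rightarrow> (nat \<Rightarrow> nat) \<Rightarrow> (nat \<Rightarrow> nat \<Rightarrow> 'k ring) \<Rightarrow> (nat \<Rightarrow> nat \<Rightarrow> 'a \<Rightarrow> 'k) \<Rightarrow> 'a monoid
      \<Rightarrow> ((nat \<Rightarrow> nat \<Rightarrow> 'k) \<times> 'a) monoid" where
  "scalar_semidirect m k F \<rho> A =
     semidirect_product (product_group {1..m} (summand k F)) A (scalar_action m k F \<rho>)"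

definition scalar_semidirect_topology ::
    "nat \<Rightarrow> (nat \<Rightarrow> nat) \<Rightarrow> (nat \<Rightarrow> nat \<Rightarrow> 'k ring) \<Rightarrow> (nat \<Rightarrow> nat \<Rightarrow> 'k \<Rightarrow> real) \<Rightarrow> 'a monoid
      \<Rightarrow> ((nat \<Rightarrow> nat \<Rightarrow> 'k) \<times> 'a) topology" where
  "scalar_semidirect_topology m k F N A =
     prod_topology
       (product_topology
          (\<lambda>i. product_topology (\<lambda>j. norm_topology (F i j) (N i j)) {1..k i}) {1..m})
       (discrete_topology (carrier A))"

text \<open>A word is a list of letters with exponent \<open>+1\<close> (\<open>True\<close>) or \<open>-1\<close> (\<open>False\<close>). Even if \<open>S\<close> is a
  symmetric subset of a group, the formal inverse of \<open>s\<close> is distinct from the letter given by the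
  inverse of \<open>s\<close> in the group.\<close>

type_synonym 'g word = "('g \<times> bool) list"

definition words :: "'g set \<Rightarrow> 'g word set" where
  "words S = lists (S \<times> UNIV)"

definition word_inv :: "'g word \<Rightarrow> 'g word" where
  "word_inv w = rev (map (\<lambda>(s, b). (s, \<not> b)) w)"

text \<open>Equality in the free group. Cancelling pairs may involve any letter of the ambient type;
  as the free group on a subset embeds, this induces the right equality on words over \<open>S\<close>.\<close>

inductive free_eq :: "'g word \<Rightarrow> 'g word \<Rightarrow> bool" where
  cancel: "free_eq (u @ [(s, b), (s, \<not> b)] @ v) (u @ v)"
| refl: "free_eq w w"
| sym: "free_eq v w \<Longrightarrow> free_eq w v"
| trans: "free_eq u v \<Longrightarrow> free_eq v w \<Longrightarrow> free_eq u w"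

definition letter_eval :: "('g, 'b) monoid_scheme \<Rightarrow> 'g \<times> bool \<Rightarrow> 'g" where
  "letter_eval G l = (if snd l then fst l else inv\<^bsub>G\<^esub> (fst l))"

definition word_eval :: "('g, 'b) monoid_scheme \<Rightarrow> 'g word \<Rightarrow> 'g" where
  "word_eval G w = foldr (\<lambda>l g. letter_eval G l \<otimes>\<^bsub>G\<^esub> g) w \<one>\<^bsub>G\<^esub>"

definition relations :: "('g, 'b) monoid_scheme \<Rightarrow> 'g set \<Rightarrow> 'g word set" where
  "relations G S = {w \<in> words S. word_eval G w = \<one>\<^bsub>G\<^esub>}"

definition product_of_conjugates :: "'g set \<Rightarrow> 'g word set \<Rightarrow> nat \<Rightarrow> 'g word \<Rightarrow> bool" where
  "product_of_conjugates S R m w \<longleftrightarrow>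
     (\<exists>cs. length cs \<le> m \<and> set cs \<subseteq> words S \<times> R \<and>
           free_eq w (concat (map (\<lambda>(u, r). u @ r @ word_inv u) cs)))"

definition presentation :: "('g, 'b) monoid_scheme \<Rightarrow> 'g set \<Rightarrow> 'g word set \<Rightarrow> bool" where
  "presentation G S R \<longleftrightarrow>
     S \<subseteq> carrier G \<and> generate G S = carrier G \<and> R \<subseteq> relations G S \<and>
     (\<forall>w \<in> relations G S. \<exists>m. product_of_conjugates S (R \<union> word_inv ` R) m w)"

definition locally_compact_group :: "('g, 'b) monoid_scheme \<Rightarrow> 'g topology \<Rightarrow> bool" where
  "locally_compact_group G T \<longleftrightarrow>
     group G \<and> topspace T = carrier G \<and>
     continuous_map (prod_topology T T) T (\<lambda>(x, y). x \<otimes>\<^bsub>G\<^esub> y) \<and>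
     continuous_map T T (\<lambda>x. inv\<^bsub>G\<^esub> x) \<and>
     Hausdorff_space T \<and> locally_compact_space T"

definition compact_symmetric_generating ::
    "('g, 'b) monoid_scheme \<Rightarrow> 'g topology \<Rightarrow> 'g set \<Rightarrow> bool" where
  "compact_symmetric_generating G T S \<longleftrightarrow>
     compactin T S \<and> S \<subseteq> carrier G \<and> (\<forall>s\<in>S. inv\<^bsub>G\<^esub> s \<in> S) \<and> generate G S = carrier G"

definition compactly_presented :: "('g, 'b) monoid_scheme \<Rightarrow> 'g topology \<Rightarrow> bool" where
  "compactly_presented G T \<longleftrightarrow>
     locally_compact_group G T \<and>
     (\<exists>S. compact_symmetric_generating G T S \<and>
          (\<exists>l::nat. \<exists>R. presentation G S R \<and> (\<forall>r\<in>R. length r \<le> l)))"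

text \<open>The area is \<open>\<infinity>\<close> if there is no expression as a product of conjugates.\<close>

definition area :: "('g, 'b) monoid_scheme \<Rightarrow> 'g set \<Rightarrow> nat \<Rightarrow> 'g word \<Rightarrow> enat" where
  "area G S l w =
     Inf {enat m | m. product_of_conjugates S {r \<in> relations G S. length r \<le> l} m w}"

text \<open>Defined at real arguments because the equivalence below rescales the argument by arbitrary
  positive constants.\<close>

definition dehn_function :: "('g, 'b) monoid_scheme \<Rightarrow> 'g set \<Rightarrow> nat \<Rightarrow> real \<Rightarrow> ereal" where
  "dehn_function G S l x =
     Sup {ereal_of_enat (area G S l w) | w. w \<in> relations G S \<and> real (length w) \<le> x}"

definition growth_equiv :: "(real \<Rightarrow> ereal) \<Rightarrow> (real \<Rightarrow> ereal) \<Rightarrow> bool" where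
  "growth_equiv u v \<longleftrightarrow>
     (\<exists>a1 a2 a3 a4 b1 b2 b3 b4 :: real.
        a1 > 0 \<and> a2 > 0 \<and> a3 > 0 \<and> a4 > 0 \<and> b1 > 0 \<and> b2 > 0 \<and> b3 > 0 \<and> b4 > 0 \<and>
        (\<forall>n\<ge>0. ereal a1 * u (a2 * n) - ereal (a3 * n) - ereal a4 \<le> v n \<and>
                v n \<le> ereal b1 * u (b2 * n) + ereal (b3 * n) + ereal b4))"

text \<open>The independence of the Dehn function of \<open>(S, l)\<close> holds for \<open>l\<close> large enough depending on
  \<open>S\<close>. It is not enough that the relations of length at most \<open>l\<close> define the group: if \<open>S\<close> is not a
  neighbourhood of the identity, the Dehn function of such a pair may take the value \<open>\<infinity>\<close>.\<close>

definition has_dehn_growth ::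
    "('g, 'b) monoid_scheme \<Rightarrow> 'g topology \<Rightarrow> (real \<Rightarrow> ereal) \<Rightarrow> bool" where
  "has_dehn_growth G T f \<longleftrightarrow>
     (\<forall>S. compact_symmetric_generating G T S \<longrightarrow>
          (\<exists>l0. \<forall>l\<ge>l0. growth_equiv (dehn_function G S l) f))"

definition quadratic_dehn_function :: "('g, 'b) monoid_scheme \<Rightarrow> 'g topology \<Rightarrow> bool" where
  "quadratic_dehn_function G T \<longleftrightarrow> has_dehn_growth G T (\<lambda>n. ereal (n ^ 2))"

definition linear_dehn_function :: "('g, 'b) monoid_scheme \<Rightarrow> 'g topology \<Rightarrow> bool" where
  "linear_dehn_function G T \<longleftrightarrow> has_dehn_growth G T (\<lambda>n. ereal n)"

end

theory Submission
  imports Defs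
begin

text \<open>
  Fillings are computed for lists over a convenient compact generating set \<open>S\<close>, made of a finite subset
  of \<open>A\<close> and unit balls of the \<open>V\<^sub>i\<close>. By the Baire category theorem compact generating sets boundedly
  generate each other, so the resulting bounds hold for all of them.

  In rank one some \<open>t \<in> A\<close> contracts all of \<open>\<Oplus>\<^sub>i V\<^sub>i\<close> by a factor of at least two. For \<open>x\<close> and \<open>y\<close> in the
  unit ball \<open>K\<close> the element \<open>t x y t\<^sup>-\<^sup>1\<close> lies in \<open>K\<close> again, so each peak \<open>t \<kappa> t\<^sup>-\<^sup>1\<close> of a word over \<open>K\<close> and
  \<open>t\<close> collapses to a word over \<open>K\<close> of half the length. The costs form a geometric series.

  In general each \<open>V\<^sub>i\<close> has its own contraction \<open>\<tau>\<^sub>i\<close>. A word of length about \<open>2 ^ k\<close> is brought into the normal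
  form \<open>\<Prod>\<^sub>i \<tau>\<^sub>i\<^sup>-\<^sup>e y\<^sub>i \<tau>\<^sub>i\<^sup>e\<close> times a word in \<open>A\<close>, where \<open>e\<close> is proportional to \<open>2 ^ k\<close>. Two normal forms are
  merged at a cost of order \<open>4 ^ k\<close>: factors from \<open>V\<^sub>i\<close> and \<open>V\<^sub>j\<close> are interchanged with the help of a
  contraction common to \<open>V\<^sub>i\<close> and \<open>V\<^sub>j\<close>, and words in \<open>A\<close> have quadratic area. Bisecting the word then gives a
  quadratic bound, because the \<open>2 ^ j\<close> pieces of length \<open>n / 2 ^ j\<close> cost \<open>2 ^ j (n / 2 ^ j)\<^sup>2\<close>.

  The quadratic lower bound in rank at least two comes from the signed area of the path traced by a relation
  in a rank two quotient of \<open>A\<close>: relators of bounded length contribute boundedly, whereas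
  \<open>[a\<^sup>n, b\<^sup>n]\<close> contributes \<open>n\<^sup>2\<close>.
\<close>

section \<open>Rewriting of words\<close>

text \<open>Areas are counted on lists of group elements, where any two words of length at most
  \<open>l\<close> with equal value may be exchanged. This suits uncountable generating sets: the
  many relations inside a ball have bounded length, and no relators have to be listed. Formal
  inverse letters appear only when these counts are turned into areas. In higher rank the
  contractions of pairs need not come from one element, so no single conjugation halves all vectors.
  Expansion is therefore recorded in exponents: a letter of \<open>T\<close> stretches norms by at
  most a fixed factor, which \<open>M\<close> powers of a contraction undo. Conjugation by a word of
  length n then raises an exponent by \<open>M\<close> times n, and adding two vectors raises it by
  one. Exponents stay proportional to word length although the vectors may grow exponentially. In
  rank one a contraction of everything exists because, on a logarithmic scale, all norms are
  governed by one element; but its powers need not exhaust A, so a representative from a finite set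
  is carried along.\<close>

definition list_prod :: "('g, 'b) monoid_scheme \<Rightarrow> 'g list \<Rightarrow> 'g" where
  "list_prod G w = foldr (\<lambda>x y. x \<otimes>\<^bsub>G\<^esub> y) w \<one>\<^bsub>G\<^esub>"

definition list_inv :: "('g, 'b) monoid_scheme \<Rightarrow> 'g list \<Rightarrow> 'g list" where
  "list_inv G w = rev (map (\<lambda>x. inv\<^bsub>G\<^esub> x) w)"

text \<open>In effect the relators are all relations of length at most 2 \<open>l\<close>: a step
  exchanges two subwords of length at most \<open>l\<close> with the same value. The number
  \<open>c\<close> is an upper bound and not a count, because \<open>rewr_refl\<close> holds for
  every \<open>c\<close>.\<close>

inductive rewr ::
    "('g, 'b) monoid_scheme \<Rightarrow> 'g set \<Rightarrow> nat \<Rightarrow> nat \<Rightarrow> 'g list \<Rightarrow> 'g list \<Rightarrow> bool"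
  for G S l where
  rewr_refl: "w \<in> lists S \<Longrightarrow> rewr G S l c w w"
| rewr_step: "\<lbrakk>rewr G S l c u (a @ r @ b); r' \<in> lists S; length r \<le> l; length r' \<le> l;
    list_prod G r = list_prod G r'\<rbrakk> \<Longrightarrow> rewr G S l (Suc c) u (a @ r' @ b)"

declare rewr_refl [simp]

lemma list_prod_Nil [simp]: "list_prod G [] = \<one>\<^bsub>G\<^esub>"
  and list_prod_Cons [simp]: "list_prod G (x # w) = x \<otimes>\<^bsub>G\<^esub> list_prod G w"
  by (simp_all add: list_prod_def)

lemma list_inv_Nil [simp]: "list_inv G [] = []"
  and list_inv_Cons: "list_inv G (x # w) = list_inv G w @ [inv\<^bsub>G\<^esub> x]"
  and list_inv_append: "list_inv G (v @ w) = list_inv G w @ list_inv G v"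
  and length_list_inv [simp]: "length (list_inv G w) = length w"
  and list_inv_replicate: "list_inv G (replicate n x) = replicate n (inv\<^bsub>G\<^esub> x)"
  by (simp_all add: list_inv_def)

lemma replicate_in_lists [simp]: "x \<in> S \<Longrightarrow> replicate n x \<in> lists S"
  by (induction n) auto

lemma list_inv_in_lists:
  assumes "w \<in> lists S" "\<And>s. s \<in> S \<Longrightarrow> inv\<^bsub>G\<^esub> s \<in> S"
  shows "list_inv G w \<in> lists S"
  using assms by (auto simp: list_inv_def)

context monoid
begin

lemma list_prod_closed [simp, intro]: "w \<in> lists (carrier G) \<Longrightarrow> list_prod G w \<in> carrier G"
  by (induction w) auto

lemma list_prod_append:
  "\<lbrakk>v \<in> lists (carrier G); w \<in> lists (carrier G)\<rbrakk> \<Longrightarrow>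
    list_prod G (v @ w) = list_prod G v \<otimes> list_prod G w"
  by (induction v) (auto simp: m_assoc)

lemma list_prod_replicate: "x \<in> carrier G \<Longrightarrow> list_prod G (replicate n x) = x [^] n"
  by (induction n) (simp_all add: nat_pow_comm[of x 1, simplified])

end

lemma (in group) list_prod_list_inv:
  "w \<in> lists (carrier G) \<Longrightarrow> list_prod G (list_inv G w) = inv (list_prod G w)"
proof (induction w)
  case (Cons x w)
  then have "list_inv G w \<in> lists (carrier G)" by (auto simp: list_inv_def)
  with Cons show ?case by (auto simp: list_inv_Cons list_prod_append inv_mult_group)
qed simp

lemma rewr_in_lists:
  "rewr G S l c u v \<Longrightarrow> u \<in> lists S \<and> v \<in> lists S"
  by (induction rule: rewr.induct) auto

lemma rewr_mono:
  assumes "rewr G S l c u v" "c \<le> c'"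
  shows "rewr G S l c' u v"
  using assms
proof (induction arbitrary: c' rule: rewr.induct)
  case (rewr_step c u a r b r')
  then obtain c'' where "c' = Suc c''" "c \<le> c''" by (cases c') auto
  with rewr_step show ?case by (auto intro: rewr.intros)
qed (auto intro: rewr.intros)

lemma rewr_mono_length:
  "rewr G S l c u v \<Longrightarrow> l \<le> l' \<Longrightarrow> rewr G S l' c u v"
  by (induction rule: rewr.induct) (auto intro: rewr.intros)

lemma rewr_trans:
  "\<lbrakk>rewr G S l c' v w; rewr G S l c u v\<rbrakk> \<Longrightarrow> rewr G S l (c + c') u w"
proof (induction rule: rewr.induct)
  case (rewr_refl w c')
  then show ?case by (auto intro: rewr_mono)
next
  case (rewr_step c v a r b r')
  then show ?case by (auto intro: rewr.rewr_step)
qed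

lemma rewr_trans' [trans]:
  "\<lbrakk>rewr G S l c u v; rewr G S l c' v w\<rbrakk> \<Longrightarrow> rewr G S l (c + c') u w"
  by (rule rewr_trans)

lemma rewr_congr:
  assumes "rewr G S l c u v" "a \<in> lists S" "b \<in> lists S"
  shows "rewr G S l c (a @ u @ b) (a @ v @ b)"
  using assms
proof (induction rule: rewr.induct)
  case (rewr_step c u a' r b' r')
  then have "rewr G S l c (a @ u @ b) ((a @ a') @ r @ (b' @ b))" by simp
  from rewr.rewr_step[OF this] rewr_step show ?case by simp
qed (auto intro: rewr.intros)

lemma rewr_congr_left: "\<lbrakk>rewr G S l c u v; a \<in> lists S\<rbrakk> \<Longrightarrow> rewr G S l c (a @ u) (a @ v)"
  using rewr_congr[of G S l c u v a "[]"] by simp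

lemma rewr_congr_right: "\<lbrakk>rewr G S l c u v; b \<in> lists S\<rbrakk> \<Longrightarrow> rewr G S l c (u @ b) (v @ b)"
  using rewr_congr[of G S l c u v "[]" b] by simp

lemma rewr_append:
  assumes "rewr G S l c u v" "rewr G S l c' u' v'"
  shows "rewr G S l (c + c') (u @ u') (v @ v')"
  using rewr_trans'[OF rewr_congr_right[OF assms(1)] rewr_congr_left[OF assms(2)]]
    assms rewr_in_lists by blast

lemma rewr_base:
  assumes "r \<in> lists S" "r' \<in> lists S" "length r \<le> l" "length r' \<le> l" "list_prod G r = list_prod G r'"
  shows "rewr G S l 1 r r'"
  using rewr.rewr_step[OF rewr_refl, of "[]" r "[]" S r' l G 0] assms by auto

lemma rewr_sym: "rewr G S l c u v \<Longrightarrow> rewr G S l c v u"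
proof (induction rule: rewr.induct)
  case (rewr_step c u a r b r')
  then have in_lists: "a \<in> lists S" "b \<in> lists S" "r \<in> lists S"
    using rewr_in_lists[OF rewr_step(1)] by auto
  with rewr_step have "rewr G S l 1 r' r" by (intro rewr_base) auto
  from rewr_trans'[OF rewr_congr[OF this in_lists(1,2)] rewr_step.IH] show ?case by simp
qed (auto intro: rewr.intros)

lemma rewr_list_prod:
  assumes "rewr G S l c u v" "group G" "S \<subseteq> carrier G"
  shows "list_prod G u = list_prod G v"
  using assms
proof (induction rule: rewr.induct)
  case (rewr_step c u a r b r')
  interpret group G by fact
  have "a \<in> lists S" "b \<in> lists S" "r \<in> lists S"
    using rewr_in_lists[OF rewr_step(1)] by auto
  then have "a \<in> lists (carrier G)" "b \<in> lists (carrier G)" "r \<in> lists (carrier G)"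
      "r' \<in> lists (carrier G)"
    using rewr_step.prems rewr_step.hyps lists_mono[of S "carrier G"] by blast+
  with rewr_step show ?case by (simp add: list_prod_append)
qed simp

lemma rewr_cancel:
  fixes G (structure)
  assumes "group G" "S \<subseteq> carrier G" "\<And>s. s \<in> S \<Longrightarrow> inv\<^bsub>G\<^esub> s \<in> S" "2 \<le> l" "w \<in> lists S"
  shows "rewr G S l (length w) (w @ list_inv G w) []"
    and "rewr G S l (length w) (list_inv G w @ w) []"
proof -
  interpret group G by fact
  have "rewr G S l (length w) (w @ list_inv G w) [] \<and>
        rewr G S l (length w) (list_inv G w @ w) []"
    using assms(5)
  proof (induction w)
    case Nil
    show ?case by (auto intro: rewr_refl)
  next
    case (Cons x w)
    then have x: "x \<in> S" "inv x \<in> S" "x \<in> carrier G" using assms by auto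
    have w: "w \<in> lists S" "list_inv G w \<in> lists S"
      using Cons assms(3) list_inv_in_lists[of w S G] by auto
    have c: "rewr G S l 1 [x, inv x] []" "rewr G S l 1 [inv x, x] []"
      using x assms(4) by (intro rewr_base; simp)+
    have "rewr G S l (length w) ([x] @ (w @ list_inv G w) @ [inv x]) ([x] @ [] @ [inv x])"
      using Cons x w by (intro rewr_congr) auto
    also have "rewr G S l 1 ([x] @ [] @ [inv x]) []" using c by simp
    finally have 1: "rewr G S l (length (x # w)) ((x # w) @ list_inv G (x # w)) []"
      by (simp add: list_inv_Cons)
    have "rewr G S l 1 (list_inv G w @ [inv x, x] @ w) (list_inv G w @ [] @ w)"
      using c w by (intro rewr_congr) auto
    also have "rewr G S l (length w) (list_inv G w @ [] @ w) []" using Cons by simp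
    finally have 2: "rewr G S l (length (x # w)) (list_inv G (x # w) @ (x # w)) []"
      by (simp add: list_inv_Cons)
    show ?case using 1 2 by simp
  qed
  then show "rewr G S l (length w) (w @ list_inv G w) []"
    and "rewr G S l (length w) (list_inv G w @ w) []" by auto
qed

text \<open>Equal values stay equal under a homomorphism, so each step maps to a step between words
  of the same lengths. This carries fillings found in the abelian group to the semidirect
  product.\<close>

lemma rewr_hom:
  assumes "rewr A T l c u v" "group A" "group G" "h \<in> hom A G" "T \<subseteq> carrier A" "h ` T \<subseteq> S"
  shows "rewr G S l c (map h u) (map h v)"
  using assms(1)
proof (induction rule: rewr.induct)
  case (rewr_refl w c)
  then show ?case using assms(6) by (intro rewr.rewr_refl) (auto simp: image_subset_iff)
next
  case (rewr_step c u a r b r')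
  interpret A: group A by fact
  interpret G: group G by fact
  have prod: "list_prod G (map h w) = h (list_prod A w)" if "w \<in> lists T" for w
    using that
  proof (induction w)
    case Nil
    show ?case using assms(2,3,4) by (simp add: hom_one)
  next
    case (Cons x w)
    then have "list_prod A w \<in> carrier A" "x \<in> carrier A"
      using assms(5) by (auto intro!: A.list_prod_closed)
    with Cons assms(4) show ?case by (simp add: hom_mult)
  qed
  have "r \<in> lists T" using rewr_in_lists[OF rewr_step(1)] by auto
  then have "list_prod G (map h r) = list_prod G (map h r')" using rewr_step by (simp add: prod)
  moreover have "map h r' \<in> lists S" using rewr_step(2) assms(6) by (auto simp: image_subset_iff)
  ultimately show ?case
    using rewr.rewr_step[of G S l c "map h u" "map h a" "map h r" "map h b" "map h r'"]
      rewr_step by simp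
qed

text \<open>Moving an element of \<open>P\<close> from left to right through a word rewrites the word over \<open>D\<close>, one
  relation per letter, as in the Reidemeister-Schreier process.\<close>

lemma rewr_absorb:
  fixes G (structure)
  assumes "group G" "S \<subseteq> carrier G" "P \<subseteq> S" "D \<subseteq> S" "c + 2 \<le> l"
    and absorb: "\<And>p s. \<lbrakk>p \<in> P; s \<in> S\<rbrakk> \<Longrightarrow>
      \<exists>\<beta> p'. \<beta> \<in> lists D \<and> length \<beta> \<le> c \<and> p' \<in> P \<and> p \<otimes>\<^bsub>G\<^esub> s = list_prod G \<beta> \<otimes>\<^bsub>G\<^esub> p'"
    and "w \<in> lists S" "p \<in> P"
  shows "\<exists>\<beta> p'. \<beta> \<in> lists D \<and> length \<beta> \<le> c * length w \<and> p' \<in> P \<and>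
    rewr G S l (length w) (p # w) (\<beta> @ [p'])"
  using assms(7,8)
proof (induction w arbitrary: p)
  case Nil
  then show ?case using assms(3) by (intro exI[of _ "[]"] exI[of _ p]) (auto intro!: rewr_refl)
next
  case (Cons s w)
  interpret group G by fact
  have s: "s \<in> S" and w: "w \<in> lists S" using Cons by auto
  obtain \<beta> q where \<beta>: "\<beta> \<in> lists D" "length \<beta> \<le> c" "q \<in> P" "p \<otimes> s = list_prod G \<beta> \<otimes> q"
    using absorb[OF \<open>p \<in> P\<close> s] by auto
  obtain \<beta>' q' where \<beta>': "\<beta>' \<in> lists D" "length \<beta>' \<le> c * length w" "q' \<in> P"
    "rewr G S l (length w) (q # w) (\<beta>' @ [q'])"
    using Cons.IH[OF \<open>q \<in> P\<close>] by auto
  have \<beta>S: "\<beta> \<in> lists S" using \<beta>(1) assms(4) by auto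
  have in_carrier: "\<beta> \<in> lists (carrier G)" "p \<in> carrier G" "s \<in> carrier G" "q \<in> carrier G"
    using \<beta>S \<beta> s \<open>p \<in> P\<close> assms(2,3) by auto
  have "rewr G S l 1 [p, s] (\<beta> @ [q])"
    using \<beta> \<beta>S s \<open>p \<in> P\<close> assms(3,5) in_carrier by (intro rewr_base) (auto simp: list_prod_append)
  then have "rewr G S l 1 ([p, s] @ w) ((\<beta> @ [q]) @ w)" using w by (rule rewr_congr_right)
  also have "rewr G S l (length w) ((\<beta> @ [q]) @ w) (\<beta> @ \<beta>' @ [q'])"
    using rewr_congr_left[OF \<beta>'(4) \<beta>S] by simp
  finally have "rewr G S l (length (s # w)) (p # s # w) ((\<beta> @ \<beta>') @ [q'])" by simp
  then show ?case using \<beta> \<beta>' by (intro exI[of _ "\<beta> @ \<beta>'"] exI[of _ q']) auto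
qed

section \<open>Linear fillings\<close>

text \<open>\<open>K\<close> stands for a unit ball and \<open>t\<close> for an element contracting
  by a factor of at least two, so that the contracted sum of two ball elements returns to the ball.
  Keeping \<open>t\<close> and \<open>inv t\<close> outside \<open>K\<close> and distinct from each
  other turns the letter count \<open>height\<close> into an exponent sum that vanishes on
  \<open>K\<close>.\<close>

locale halving_element = group G for G (structure) +
  fixes K :: "'a set" and t :: 'a and S :: "'a set" and l :: nat
  assumes S: "S \<subseteq> carrier G" "\<And>s. s \<in> S \<Longrightarrow> inv s \<in> S"
    and K_subset: "K \<subseteq> S" and one_in_K: "\<one> \<in> K"
    and t: "t \<in> S" "t \<notin> K" "inv t \<notin> K" "t \<noteq> inv t"
    and halving: "\<And>x y. \<lbrakk>x \<in> K; y \<in> K\<rbrakk> \<Longrightarrow> t \<otimes> (x \<otimes> y) \<otimes> inv t \<in> K"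
    and l: "3 \<le> l"
begin

definition height :: "'a list \<Rightarrow> int" where
  "height w = (\<Sum>x\<leftarrow>w. if x = t then 1 else if x = inv t then -1 else 0)"

lemma height_simps [simp]: "height [] = 0"
  "height (x # w) = (if x = t then 1 else if x = inv t then -1 else 0) + height w"
  "height (v @ w) = height v + height w"
  by (simp_all add: height_def)

lemma height_lists_K: "w \<in> lists K \<Longrightarrow> height w = 0"
  using t by (induction w) auto

lemma height_bound: "\<bar>height w\<bar> \<le> int (length w)"
  by (induction w) auto

lemma height_replicate: "height (replicate n t) = int n" "height (replicate n (inv t)) = - int n"
  using t by (induction n) auto

lemma K_carrier: "x \<in> K \<Longrightarrow> x \<in> carrier G" and t_carrier: "t \<in> carrier G"
  using K_subset t S by auto

text \<open>The letter \<open>t\<close> travels to the right and merges two letters of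
  \<open>K\<close> at each relation \<open>t x y = z t\<close>, until it meets \<open>inv t\<close>.
  A single letter left over is paired with \<open>\<one>\<close>, which gives the rounding
  up.\<close>

lemma collapse_peak:
  "\<kappa> \<in> lists K \<Longrightarrow> \<exists>\<kappa>'. \<kappa>' \<in> lists K \<and> length \<kappa>' \<le> (length \<kappa> + 1) div 2 \<and>
     rewr G S l (length \<kappa> div 2 + 1) ([t] @ \<kappa> @ [inv t]) \<kappa>'"
proof (induction \<kappa> rule: induct_list012)
  case 1
  have "rewr G S l 1 [t, inv t] []" using t S l by (intro rewr_base) auto
  then show ?case by (intro exI[of _ "[]"]) auto
next
  case (2 x)
  then have x: "x \<in> K" by simp
  then have y: "t \<otimes> (x \<otimes> \<one>) \<otimes> inv t \<in> K" using halving one_in_K by blast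
  have "rewr G S l 1 [t, x, inv t] [t \<otimes> (x \<otimes> \<one>) \<otimes> inv t]"
    using t S l x y K_subset K_carrier[of x] t_carrier by (intro rewr_base) (auto simp: m_assoc)
  then show ?case using y by (intro exI[of _ "[t \<otimes> (x \<otimes> \<one>) \<otimes> inv t]"]) auto
next
  case (3 x y \<kappa>)
  then obtain \<kappa>' where \<kappa>': "\<kappa>' \<in> lists K" "length \<kappa>' \<le> (length \<kappa> + 1) div 2"
    "rewr G S l (length \<kappa> div 2 + 1) ([t] @ \<kappa> @ [inv t]) \<kappa>'"
    by auto
  let ?z = "t \<otimes> (x \<otimes> y) \<otimes> inv t"
  have xy: "x \<in> K" "y \<in> K" "\<kappa> \<in> lists S" using 3 K_subset by auto
  then have z: "?z \<in> K" using halving by blast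
  have "rewr G S l 1 [t, x, y] [?z, t]"
    using t S l xy z K_subset K_carrier t_carrier by (intro rewr_base) (auto simp: m_assoc)
  then have "rewr G S l 1 ([t, x, y] @ (\<kappa> @ [inv t])) ([?z, t] @ (\<kappa> @ [inv t]))"
    using xy t S by (intro rewr_congr_right) auto
  also have "rewr G S l (length \<kappa> div 2 + 1) ([?z, t] @ (\<kappa> @ [inv t])) (?z # \<kappa>')"
    using rewr_congr_left[OF \<kappa>'(3), of "[?z]"] z K_subset by auto
  finally show ?case using \<kappa>' z by (intro exI[of _ "?z # \<kappa>'"]) auto
qed

text \<open>The leftmost \<open>inv t\<close> is preceded by some \<open>t\<close>, as otherwise a
  prefix would have negative height. The last such \<open>t\<close> and this \<open>inv t\<close>
  enclose a word over \<open>K\<close>, and this innermost peak is collapsed. Prefixes keep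
  nonnegative height because the peak has height zero.\<close>

lemma collapse_nonneg:
  assumes "v \<in> lists (K \<union> {t, inv t})" "\<And>p q. v = p @ q \<Longrightarrow> 0 \<le> height p" "height v = 0"
  shows "\<exists>\<kappa> c. \<kappa> \<in> lists K \<and> length \<kappa> + c \<le> length v \<and> rewr G S l c v \<kappa>"
  using assms
proof (induction "length v" arbitrary: v rule: less_induct)
  case less
  have vS: "v \<in> lists S" using less.prems(1) K_subset t S by auto
  show ?case
  proof (cases "inv t \<in> set v")
    case False
    \<comment> \<open>Without \<open>inv t\<close> the height counts the letters \<open>t\<close>,
      so height zero leaves letters of \<open>K\<close> only.\<close>
    then have "t \<notin> set v \<or> height v > 0" 
    proof -
      have "height w \<ge> 0 \<and> (t \<in> set w \<longrightarrow> height w > 0)" if "inv t \<notin> set w" for w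
        using that by (induction w) auto
      with False show ?thesis by blast
    qed
    with less.prems False have "v \<in> lists K" by auto
    then show ?thesis using vS by (intro exI[of _ v] exI[of _ 0]) auto
  next
    case True
    then obtain a b where ab: "v = a @ inv t # b" "inv t \<notin> set a"
      by (meson split_list_first)
    have "t \<in> set a"
    proof (rule ccontr)
      assume "t \<notin> set a"
      then have "height a = 0" using ab(2) by (induction a) auto
      moreover have "height (a @ [inv t]) \<ge> 0" using less.prems(2)[of "a @ [inv t]" b] ab by simp
      ultimately show False using t by simp
    qed
    then obtain a1 \<kappa> where a: "a = a1 @ t # \<kappa>" "t \<notin> set \<kappa>" by (meson split_list_last)
    have \<kappa>: "\<kappa> \<in> lists K" and a1: "a1 \<in> lists (K \<union> {t, inv t})" and b: "b \<in> lists (K \<union> {t, inv t})"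
      using less.prems(1) a ab by auto
    have a1S: "a1 \<in> lists S" and bS: "b \<in> lists S" using vS a ab by auto
    obtain \<kappa>' where \<kappa>': "\<kappa>' \<in> lists K" "length \<kappa>' \<le> (length \<kappa> + 1) div 2"
      "rewr G S l (length \<kappa> div 2 + 1) ([t] @ \<kappa> @ [inv t]) \<kappa>'"
      using collapse_peak[OF \<kappa>] by auto
    let ?v = "a1 @ \<kappa>' @ b"
    \<comment> \<open>The collapsed word and the number of relations add up to at most
      \<open>length \<kappa> + 1\<close>, one less than the length of the peak. So length plus
      accumulated cost never exceeds the initial length.\<close>
    have len: "length ?v + (length \<kappa> div 2 + 1) < length v" using \<kappa>'(2) by (simp add: a ab)
    have nonneg: "0 \<le> height p" if pq: "?v = p @ q" for p q
    proof -
      consider q' where "a1 = p @ q'" | p' where "p = a1 @ p'" "\<kappa>' @ b = p' @ q"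
        using iffD1[OF append_eq_append_conv2 pq] by auto
      then show ?thesis
      proof cases
        case 1
        then show ?thesis using less.prems(2)[of p] ab a by simp
      next
        case (2 p')
        have h1: "height a1 \<ge> 0" using less.prems(2)[of a1] ab a by simp
        consider q' where "\<kappa>' = p' @ q'" | b' where "p' = \<kappa>' @ b'" "b = b' @ q"
          using 2 by (auto simp: append_eq_append_conv2)
        then show ?thesis
        proof cases
          case 1
          then have "p' \<in> lists K" using \<kappa>'(1) by simp
          then show ?thesis using h1 2 height_lists_K by simp
        next
          case (2 b')
          have "height (a1 @ t # \<kappa> @ inv t # b') \<ge> 0"
            using less.prems(2)[of "a1 @ t # \<kappa> @ inv t # b'" q] ab a 2 by simp
          then show ?thesis using 2 \<open>p = a1 @ p'\<close> height_lists_K[OF \<kappa>] height_lists_K[OF \<kappa>'(1)] t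
            by simp
        qed
      qed
    qed
    have "height ?v = 0"
      using less.prems(3) height_lists_K[OF \<kappa>] height_lists_K[OF \<kappa>'(1)] t by (simp add: ab a)
    moreover have "?v \<in> lists (K \<union> {t, inv t})" using a1 b \<kappa>'(1) by auto
    ultimately obtain \<mu> c where \<mu>: "\<mu> \<in> lists K" "length \<mu> + c \<le> length ?v" "rewr G S l c ?v \<mu>"
      using less.hyps[of ?v] len nonneg by (metis add_lessD1)
    have "rewr G S l (length \<kappa> div 2 + 1) v ?v"
      using rewr_congr[OF \<kappa>'(3) a1S bS] by (simp add: ab a)
    then have "rewr G S l ((length \<kappa> div 2 + 1) + c) v \<mu>" using \<mu>(3) by (rule rewr_trans')
    then show ?thesis using \<mu> len by (intro exI[of _ \<mu>] exI[of _ "(length \<kappa> div 2 + 1) + c"]) auto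
  qed
qed

text \<open>The word is conjugated by \<open>t\<close>, collapsed to half its length and filled
  recursively; its value stays trivial under conjugation. The cost obeys f(n) <= f((n + 1) / 2) + n
  / 2 + 4, which 10 n satisfies for n at least two. A single letter is treated apart, since halving
  does not shorten it.\<close>

lemma fill_lists_K:
  assumes "\<kappa> \<in> lists K" "list_prod G \<kappa> = \<one>"
  shows "rewr G S l (10 * length \<kappa>) \<kappa> []"
  using assms
proof (induction "length \<kappa>" arbitrary: \<kappa> rule: less_induct)
  case less
  have \<kappa>S: "\<kappa> \<in> lists S" using less K_subset by auto
  then have \<kappa>c: "\<kappa> \<in> lists (carrier G)" using S by auto
  consider "\<kappa> = []" | x where "\<kappa> = [x]" | "length \<kappa> \<ge> 2"
    by (cases \<kappa> rule: remdups_adj.cases) auto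
  then show ?case
  proof cases
    case 1
    then show ?thesis by simp
  next
    case (2 x)
    have "rewr G S l 1 [x] []" using 2 less \<kappa>S l by (intro rewr_base) auto
    then show ?thesis using 2 rewr_mono[of G S l 1 "[x]" "[]" 10] by simp
  next
    case 3
    obtain \<kappa>' where \<kappa>': "\<kappa>' \<in> lists K" "length \<kappa>' \<le> (length \<kappa> + 1) div 2"
      "rewr G S l (length \<kappa> div 2 + 1) ([t] @ \<kappa> @ [inv t]) \<kappa>'"
      using collapse_peak[OF less(2)] by auto
    have "list_prod G \<kappa>' = list_prod G ([t] @ \<kappa> @ [inv t])"
      using rewr_list_prod[OF \<kappa>'(3)] S is_group by auto
    also have "\<dots> = \<one>" using \<kappa>c less(3) t_carrier by (simp add: list_prod_append)
    finally have "rewr G S l (10 * length \<kappa>') \<kappa>' []"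
      using less.hyps[of \<kappa>'] \<kappa>' 3 by auto
    then have 4: "rewr G S l (10 * length \<kappa>') ([inv t] @ \<kappa>' @ [t]) ([inv t] @ [] @ [t])"
      using t S by (intro rewr_congr) auto
    have c: "rewr G S l 1 [inv t, t] []" using t S l t_carrier by (intro rewr_base) auto
    then have c': "rewr G S l 1 [] [inv t, t]" by (rule rewr_sym)
    have "rewr G S l 1 \<kappa> ([inv t, t] @ \<kappa>)" using rewr_congr_right[OF c' \<kappa>S] by simp
    also have "rewr G S l 1 ([inv t, t] @ \<kappa>) (([inv t, t] @ \<kappa>) @ [inv t, t])"
      using rewr_congr_left[OF c', of "[inv t, t] @ \<kappa>"] t S \<kappa>S by simp
    also have "rewr G S l (length \<kappa> div 2 + 1) (([inv t, t] @ \<kappa>) @ [inv t, t]) ([inv t] @ \<kappa>' @ [t])"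
      using rewr_congr[OF \<kappa>'(3), of "[inv t]" "[t]"] t S by simp
    also note 4
    also have "rewr G S l 1 ([inv t] @ [] @ [t]) []" using c by simp
    finally show ?thesis using \<kappa>'(2) 3 by (elim rewr_mono) simp
  qed
qed

text \<open>Conjugation by the n-th power of \<open>t\<close>, with n the length of
  \<open>w\<close>, lifts every prefix to nonnegative height, so the word collapses to one over
  \<open>K\<close>. Its length and the cost of the collapse are together at most 3 n. Ten relations
  per remaining letter and three insertions or cancellations of the powers of \<open>t\<close> stay
  within 36 n.\<close>

lemma fill_height_zero:
  assumes w: "w \<in> lists (K \<union> {t, inv t})" "list_prod G w = \<one>" "height w = 0"
  shows "rewr G S l (36 * length w) w []"
proof -
  define n where "n = length w"
  define T where "T = replicate n t"
  define T' where "T' = replicate n (inv t)"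
  have T: "T \<in> lists S" "T' \<in> lists S" "T \<in> lists (K \<union> {t, inv t})" "T' \<in> lists (K \<union> {t, inv t})"
    using t S by (auto simp: T_def T'_def)
  have wS: "w \<in> lists S" using w K_subset t S by auto
  have carr: "w \<in> lists (carrier G)" "T \<in> lists (carrier G)" "T' \<in> lists (carrier G)"
    using wS T S by auto
  have inv_T: "list_inv G T = T'" by (simp add: T_def T'_def list_inv_replicate)
  then have "rewr G S l n (T' @ T) []"
    using rewr_cancel(2)[OF is_group S(1) S(2) _ T(1)] l by (simp add: T_def)
  note c = this and c' = rewr_sym[OF this]
  \<comment> \<open>Inside \<open>w\<close> the height is at least n minus the number of letters
    read, and in the final power of \<open>inv t\<close> it descends from n to 0.\<close>
  have "0 \<le> height p" if "T @ w @ T' = p @ q" for p q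
  proof -
    have T_part: "height x = int (length x)" if "T = x @ y" for x y
      using that t unfolding T_def
      by (metis append_eq_conv_conj height_replicate(1) length_replicate take_replicate)
    have T'_part: "height x = - int (length x)" if "T' = x @ y" for x y
      using that t unfolding T'_def
      by (metis append_eq_conv_conj height_replicate(2) length_replicate take_replicate)
    consider q' where "T = p @ q'" | p' where "p = T @ p'" "w @ T' = p' @ q"
      using \<open>T @ w @ T' = p @ q\<close> by (auto simp: append_eq_append_conv2)
    then show ?thesis
    proof cases
      case 1
      then show ?thesis using T_part by simp
    next
      case (2 p')
      have hT: "height T = int n" by (simp add: T_def height_replicate)
      consider q' where "w = p' @ q'" | p'' where "p' = w @ p''" "T' = p'' @ q"
        using 2 by (auto simp: append_eq_append_conv2)
      then show ?thesis
      proof cases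
        case 1
        then have "length p' \<le> n" by (simp add: n_def)
        then show ?thesis using 2(1) hT height_bound[of p'] by simp
      next
        case (2 p'')
        then have "length p'' \<le> n" unfolding T'_def by (metis le_add1 length_append length_replicate)
        then show ?thesis using 2 \<open>p = T @ p'\<close> hT w(3) T'_part by simp
      qed
    qed
  qed
  moreover have "height (T @ w @ T') = 0" by (simp add: T_def T'_def height_replicate w)
  ultimately obtain \<kappa> c where \<kappa>: "\<kappa> \<in> lists K" "length \<kappa> + c \<le> length (T @ w @ T')"
    "rewr G S l c (T @ w @ T') \<kappa>"
    using collapse_nonneg[of "T @ w @ T'"] T(3,4) w(1) by auto
  have len: "length \<kappa> + c \<le> 3 * n" using \<kappa>(2) by (simp add: T_def T'_def n_def)
  have "list_prod G T \<otimes> list_prod G T' = \<one>"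
    using list_prod_list_inv[OF carr(2)] carr by (simp add: inv_T)
  then have "list_prod G \<kappa> = \<one>"
    using rewr_list_prod[OF \<kappa>(3) is_group S(1)] w carr by (simp add: list_prod_append)
  then have \<kappa>_fill: "rewr G S l (10 * length \<kappa>) \<kappa> []" using fill_lists_K \<kappa>(1) by blast
  have "rewr G S l n w ((T' @ T) @ w)" using rewr_congr_right[OF c' wS] by simp
  also have "rewr G S l n ((T' @ T) @ w) (((T' @ T) @ w) @ T' @ T)"
    using rewr_congr_left[OF c', of "(T' @ T) @ w"] T wS by simp
  also have "rewr G S l c (((T' @ T) @ w) @ T' @ T) (T' @ \<kappa> @ T)"
    using rewr_congr[OF \<kappa>(3) T(2,1)] by simp
  also have "rewr G S l (10 * length \<kappa>) (T' @ \<kappa> @ T) (T' @ [] @ T)"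
    using rewr_congr[OF \<kappa>_fill T(2,1)] by simp
  also have "rewr G S l n (T' @ [] @ T) []" using c by simp
  finally show ?thesis using len by (elim rewr_mono) (simp add: n_def)
qed

text \<open>Everything outside the subgroup generated by \<open>K\<close> and \<open>t\<close> is
  collected in one letter of \<open>P\<close>, which \<open>rewr_absorb\<close> moves to the right
  end. As the whole word is trivial, \<open>stable\<close> can trade this last letter for a bounded
  word. What remains is a relation over \<open>K\<close> and \<open>t\<close>, which
  \<open>height\<close> makes balanced.\<close>

theorem linear_filling:
  assumes P: "P \<subseteq> S" "\<one> \<in> P" and c: "c + 2 \<le> l"
    and absorb: "\<And>p s. \<lbrakk>p \<in> P; s \<in> S\<rbrakk> \<Longrightarrow>
      \<exists>\<beta> p'. \<beta> \<in> lists (K \<union> {t, inv t}) \<and> length \<beta> \<le> c \<and> p' \<in> P \<and> p \<otimes> s = list_prod G \<beta> \<otimes> p'"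
    and height: "\<And>w. \<lbrakk>w \<in> lists (K \<union> {t, inv t}); list_prod G w = \<one>\<rbrakk> \<Longrightarrow> height w = 0"
    and stable: "\<And>p \<beta>. \<lbrakk>p \<in> P; \<beta> \<in> lists (K \<union> {t, inv t}); list_prod G \<beta> \<otimes> p = \<one>\<rbrakk> \<Longrightarrow>
      \<exists>\<gamma>. \<gamma> \<in> lists (K \<union> {t, inv t}) \<and> length \<gamma> \<le> c \<and> list_prod G \<gamma> = p"
    and w: "w \<in> lists S" "list_prod G w = \<one>"
  shows "rewr G S l ((36 * c + 2) * (length w + 1)) w []"
proof -
  let ?D = "K \<union> {t, inv t}"
  have D: "?D \<subseteq> S" using K_subset t S by auto
  obtain \<beta> p where \<beta>: "\<beta> \<in> lists ?D" "length \<beta> \<le> c * length w" "p \<in> P"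
    "rewr G S l (length w) (\<one> # w) (\<beta> @ [p])"
    using rewr_absorb[OF is_group S(1) P(1) D c absorb w(1) P(2)] by auto
  have \<beta>S: "\<beta> \<in> lists S" using \<beta> D by auto
  then have carr: "\<beta> \<in> lists (carrier G)" "p \<in> carrier G" "w \<in> lists (carrier G)"
    using \<beta> P S w by auto
  have "list_prod G \<beta> \<otimes> p = \<one>"
    using rewr_list_prod[OF \<beta>(4) is_group S(1)] w carr by (simp add: list_prod_append)
  then obtain \<gamma> where \<gamma>: "\<gamma> \<in> lists ?D" "length \<gamma> \<le> c" "list_prod G \<gamma> = p"
    using stable \<beta> by blast
  have \<gamma>S: "\<gamma> \<in> lists S" using \<gamma> D by auto
  then have \<gamma>c: "\<gamma> \<in> lists (carrier G)" using S by auto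
  have prod: "list_prod G (\<beta> @ \<gamma>) = \<one>"
    using \<open>list_prod G \<beta> \<otimes> p = \<one>\<close> \<gamma>(3) carr \<gamma>c by (simp add: list_prod_append)
  have "rewr G S l 1 [] [\<one>]" using P l by (intro rewr_base) auto
  from rewr_congr_right[OF this w(1)] have "rewr G S l 1 w (\<one> # w)" by simp
  also note \<beta>(4)
  also have "rewr G S l 1 (\<beta> @ [p]) (\<beta> @ \<gamma>)"
    using \<beta>S \<gamma>S \<gamma> c \<beta>(3) P carr by (intro rewr_congr_left rewr_base) auto
  also have "rewr G S l (36 * length (\<beta> @ \<gamma>)) (\<beta> @ \<gamma>) []"
    using \<beta>(1) \<gamma>(1) prod by (intro fill_height_zero height) simp_all
  finally have "rewr G S l (1 + length w + 1 + 36 * length (\<beta> @ \<gamma>)) w []" .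
  moreover have "1 + length w + 1 + 36 * length (\<beta> @ \<gamma>) \<le> (36 * c + 2) * (length w + 1)"
    using \<beta>(2) \<gamma>(2) by (simp add: algebra_simps)
  ultimately show ?thesis by (rule rewr_mono)
qed

end

section \<open>Quadratic fillings\<close>

text \<open>The second condition says that \<open>M\<close> powers of \<open>t\<close> outweigh any
  one letter \<open>a\<close> of \<open>T\<close>, however far \<open>a\<close> stretches
  \<open>B\<close>. The same \<open>M\<close> serves all letters.\<close>

definition contracting_on ::
    "('g, 'b) monoid_scheme \<Rightarrow> 'g set \<Rightarrow> nat \<Rightarrow> 'g set \<Rightarrow> 'g \<Rightarrow> bool" where
  "contracting_on G T M B t \<longleftrightarrow> t \<in> T \<and> (\<forall>x\<in>B. t \<otimes>\<^bsub>G\<^esub> x \<otimes>\<^bsub>G\<^esub> inv\<^bsub>G\<^esub> t \<in> B) \<and>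
    (\<forall>a\<in>T. \<forall>x\<in>B. (t [^]\<^bsub>G\<^esub> M \<otimes>\<^bsub>G\<^esub> a) \<otimes>\<^bsub>G\<^esub> x \<otimes>\<^bsub>G\<^esub> inv\<^bsub>G\<^esub> (t [^]\<^bsub>G\<^esub> M \<otimes>\<^bsub>G\<^esub> a) \<in> B)"

text \<open>\<open>B i\<close> plays the unit ball of V_i, \<open>H\<close> the copy of A, and
  \<open>Q\<close> the constant of quadratic area in A. Common contractions are assumed for two
  indices at a time, while each \<open>\<tau> i\<close> also halves. The number
  \<open>2 * M + 3\<close> is the length of the longest relation of the argument outside
  \<open>fill\<close>: an element of \<open>B i\<close> conjugated by \<open>M\<close> powers of a
  contraction and one letter.\<close>

locale contracting_family = group G for G (structure) +
  fixes S T H :: "'a set" and I :: "'i list" and B :: "'i \<Rightarrow> 'a set" and \<tau> :: "'i \<Rightarrow> 'a"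
    and M l Q :: nat
  assumes S: "S \<subseteq> carrier G" "\<And>s. s \<in> S \<Longrightarrow> inv s \<in> S" "S \<subseteq> T \<union> (\<Union>i\<in>set I. B i)"
    and T: "T \<subseteq> S" "T \<subseteq> H" "\<And>s. s \<in> T \<Longrightarrow> inv s \<in> T"
    and H: "subgroup H G" "\<And>x y. \<lbrakk>x \<in> H; y \<in> H\<rbrakk> \<Longrightarrow> x \<otimes> y = y \<otimes> x"
    and I: "distinct I"
    and B: "\<And>i. i \<in> set I \<Longrightarrow> B i \<subseteq> S" "\<And>i. i \<in> set I \<Longrightarrow> \<one> \<in> B i"
    and l: "2 * M + 3 \<le> l"
    and fill: "\<And>u v n. \<lbrakk>u \<in> lists T; v \<in> lists T; length u \<le> n; length v \<le> n;
      list_prod G u = list_prod G v\<rbrakk> \<Longrightarrow> rewr G S l (Q * (n + 1)\<^sup>2) u v"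
    and commute: "\<And>i j x y. \<lbrakk>i \<in> set I; j \<in> set I; x \<in> B i; y \<in> B j\<rbrakk> \<Longrightarrow> x \<otimes> y = y \<otimes> x"
    and pair: "\<And>i j. \<lbrakk>i \<in> set I; j \<in> set I\<rbrakk> \<Longrightarrow>
      \<exists>t. contracting_on G T M (B i) t \<and> contracting_on G T M (B j) t"
    and \<tau>: "\<And>i. i \<in> set I \<Longrightarrow> contracting_on G T M (B i) (\<tau> i)"
      "\<And>i x y. \<lbrakk>i \<in> set I; x \<in> B i; y \<in> B i\<rbrakk> \<Longrightarrow> \<tau> i \<otimes> (x \<otimes> y) \<otimes> inv (\<tau> i) \<in> B i"
begin

abbreviation contracts :: "'i \<Rightarrow> 'a \<Rightarrow> bool" where
  "contracts i t \<equiv> contracting_on G T M (B i) t"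

text \<open>The scale \<open>n\<close> is kept apart from the constant, so that finitely many moves
  at one scale merely add their constants.\<close>

definition qrewr :: "nat \<Rightarrow> nat \<Rightarrow> 'a list \<Rightarrow> 'a list \<Rightarrow> bool" where
  "qrewr c n u v \<longleftrightarrow> rewr G S l (c * n\<^sup>2) u v"

text \<open>As \<open>t\<close> contracts, conjugation by its inverse expands: with 2 e + 1 letters
  such a word can reach vectors of size exponential in \<open>e\<close>.\<close>

definition conj_word :: "'a \<Rightarrow> nat \<Rightarrow> 'a \<Rightarrow> 'a list" where
  "conj_word t e y = replicate e (inv t) @ [y] @ replicate e t"

definition conj_words :: "nat \<Rightarrow> ('i \<Rightarrow> 'a) \<Rightarrow> 'i list \<Rightarrow> 'a list" where
  "conj_words e y J = concat (map (\<lambda>i. conj_word (\<tau> i) e (y i)) J)"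

lemma qrewr_trans [trans]: "\<lbrakk>qrewr c n u v; qrewr c' n v w\<rbrakk> \<Longrightarrow> qrewr (c + c') n u w"
  unfolding qrewr_def using rewr_trans' by (metis add_mult_distrib)

lemma qrewr_mono: "\<lbrakk>qrewr c n u v; c \<le> c'\<rbrakk> \<Longrightarrow> qrewr c' n u v"
  unfolding qrewr_def by (rule rewr_mono) auto

lemma qrewr_sym: "qrewr c n u v \<Longrightarrow> qrewr c n v u"
  unfolding qrewr_def by (rule rewr_sym)

lemma qrewr_congr: "\<lbrakk>qrewr c n u v; a \<in> lists S; b \<in> lists S\<rbrakk> \<Longrightarrow> qrewr c n (a @ u @ b) (a @ v @ b)"
  unfolding qrewr_def by (rule rewr_congr)

lemma qrewr_congr_left: "\<lbrakk>qrewr c n u v; a \<in> lists S\<rbrakk> \<Longrightarrow> qrewr c n (a @ u) (a @ v)"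
  unfolding qrewr_def by (rule rewr_congr_left)

lemma qrewr_congr_right: "\<lbrakk>qrewr c n u v; b \<in> lists S\<rbrakk> \<Longrightarrow> qrewr c n (u @ b) (v @ b)"
  unfolding qrewr_def by (rule rewr_congr_right)

lemma qrewr_append: "\<lbrakk>qrewr c n u v; qrewr c' n u' v'\<rbrakk> \<Longrightarrow> qrewr (c + c') n (u @ u') (v @ v')"
  unfolding qrewr_def add_mult_distrib by (rule rewr_append)

lemma qrewr_in_lists: "qrewr c n u v \<Longrightarrow> u \<in> lists S" "qrewr c n u v \<Longrightarrow> v \<in> lists S"
  unfolding qrewr_def using rewr_in_lists by blast+

lemma qrewr_linear: "\<lbrakk>rewr G S l k u v; k \<le> c * n\<rbrakk> \<Longrightarrow> qrewr c n u v"
proof -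
  assume "rewr G S l k u v" "k \<le> c * n"
  moreover have "c * n \<le> c * n\<^sup>2" by (simp add: power2_eq_square)
  ultimately show ?thesis unfolding qrewr_def by (meson le_trans rewr_mono)
qed

lemma fill_scaled:
  assumes "u \<in> lists T" "v \<in> lists T" "length u \<le> p * n" "length v \<le> p * n" "1 \<le> n"
    "list_prod G u = list_prod G v"
  shows "qrewr (Q * (p + 1)\<^sup>2) n u v"
proof -
  have "rewr G S l (Q * (p * n + 1)\<^sup>2) u v" using assms by (intro fill)
  moreover have "p * n + 1 \<le> (p + 1) * n" using assms by simp
  then have "(p * n + 1)\<^sup>2 \<le> ((p + 1) * n)\<^sup>2" by (rule power_mono) simp
  then have "Q * (p * n + 1)\<^sup>2 \<le> Q * (p + 1)\<^sup>2 * n\<^sup>2"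
    by (simp only: power_mult_distrib mult.assoc mult_le_mono2)
  ultimately show ?thesis unfolding qrewr_def by (rule rewr_mono)
qed

lemma lists_T: "w \<in> lists T \<Longrightarrow> w \<in> lists S" "w \<in> lists T \<Longrightarrow> w \<in> lists (carrier G)"
  "w \<in> lists T \<Longrightarrow> list_inv G w \<in> lists T"
  using T S list_inv_in_lists[of w T G] by (auto 0 4)

lemma lists_S: "w \<in> lists S \<Longrightarrow> w \<in> lists (carrier G)"
  using S by auto

lemma list_prod_in_H: "w \<in> lists T \<Longrightarrow> list_prod G w \<in> H"
  using H(1) T(2) by (induction w) (auto intro: subgroup.one_closed subgroup.m_closed)

lemma contracts_T: "contracts i t \<Longrightarrow> t \<in> T" "contracts i t \<Longrightarrow> t \<in> S" "contracts i t \<Longrightarrow> inv t \<in> S"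
    "contracts i t \<Longrightarrow> inv t \<in> T" "contracts i t \<Longrightarrow> t \<in> carrier G"
  using T S by (auto simp: contracting_on_def)

lemma in_B: "\<lbrakk>i \<in> set I; x \<in> B i\<rbrakk> \<Longrightarrow> x \<in> S" "\<lbrakk>i \<in> set I; x \<in> B i\<rbrakk> \<Longrightarrow> x \<in> carrier G"
  using B S by auto

lemma cancel:
  assumes "w \<in> lists S" "length w \<le> c * n"
  shows "qrewr c n (w @ list_inv G w) []" "qrewr c n (list_inv G w @ w) []"
  using rewr_cancel[OF is_group S(1,2) _ assms(1), of l] l qrewr_linear[OF _ assms(2)] by auto

lemma cancel_powers:
  assumes "t \<in> S" "e \<le> c * n"
  shows "qrewr c n (replicate e t @ replicate e (inv t)) []"
    "qrewr c n (replicate e (inv t) @ replicate e t) []"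
  using cancel[of "replicate e t" c n] assms by (auto simp: list_inv_replicate)

section \<open>Conjugates of ball elements by powers of contractions\<close>

lemma conj_word_in_lists:
  assumes "t \<in> S" "y \<in> S"
  shows "conj_word t e y \<in> lists S"
  using assms S(2)[OF assms(1)] by (auto simp: conj_word_def)

text \<open>Interleaving the letters of \<open>u\<close> with powers of \<open>t\<close> keeps all intermediate conjugates in
  \<open>B i\<close>.\<close>

lemma push_interleaved:
  assumes i: "i \<in> set I" and t: "contracts i t" and "u \<in> lists T" and x: "x \<in> B i"
  defines "\<sigma> \<equiv> \<lambda>u. concat (map (\<lambda>a. replicate M t @ [a]) u)"
  shows "\<exists>y\<in>B i. rewr G S l (length u) (\<sigma> u @ [x] @ list_inv G (\<sigma> u)) [y]"
  using assms(3)
proof (induction u)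
  case Nil
  then show ?case using x in_B[OF i x] by (intro bexI[of _ x]) (simp_all add: \<sigma>_def)
next
  case (Cons a u)
  then have a: "a \<in> T" by simp
  obtain y where y: "y \<in> B i" "rewr G S l (length u) (\<sigma> u @ [x] @ list_inv G (\<sigma> u)) [y]"
    using Cons by auto
  let ?g = "replicate M t @ [a]"
  have g: "?g \<in> lists T" using a contracts_T[OF t] by auto
  note g' = lists_T(1)[OF g] lists_T(1)[OF lists_T(3)[OF g]]
    lists_T(2)[OF g] lists_T(2)[OF lists_T(3)[OF g]]
  have prod_g: "list_prod G ?g = t [^] M \<otimes> a"
    using contracts_T[OF t] a T S by (subst list_prod_append) (auto simp: list_prod_replicate)
  let ?y = "(t [^] M \<otimes> a) \<otimes> y \<otimes> inv (t [^] M \<otimes> a)"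
  have y': "?y \<in> B i" using t a y by (auto simp: contracting_on_def)
  have "rewr G S l (length u) (?g @ (\<sigma> u @ [x] @ list_inv G (\<sigma> u)) @ list_inv G ?g) (?g @ [y] @ list_inv G ?g)"
    by (rule rewr_congr[OF y(2) g'(1,2)])
  also have "rewr G S l 1 (?g @ [y] @ list_inv G ?g) [?y]"
  proof (rule rewr_base)
    show "?g @ [y] @ list_inv G ?g \<in> lists S" using g' in_B[OF i y(1)] by simp
    show "list_prod G (?g @ [y] @ list_inv G ?g) = list_prod G [?y]"
    proof -
      have "list_prod G (?g @ ([y] @ list_inv G ?g)) = list_prod G ?g \<otimes> (y \<otimes> inv (list_prod G ?g))"
        using list_prod_append[OF g'(3), of "[y] @ list_inv G ?g"] g' in_B[OF i y(1)]
          list_prod_list_inv[OF g'(3)] by (simp del: append_assoc)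
      also have "\<dots> = list_prod G [?y]"
        unfolding prod_g using in_B[OF i y(1)] contracts_T[OF t] a T S by (auto simp: m_assoc)
      finally show ?thesis .
    qed
  qed (use l y' in_B[OF i y'] in auto)
  finally have "rewr G S l (length (a # u)) (\<sigma> (a # u) @ [x] @ list_inv G (\<sigma> (a # u))) [?y]"
    by (simp add: \<sigma>_def list_inv_append list_inv_Cons)
  then show ?case using y' by blast
qed

lemma push_powers:
  assumes i: "i \<in> set I" and t: "contracts i t" and x: "x \<in> B i"
  shows "\<exists>y\<in>B i. rewr G S l f (replicate f t @ [x] @ replicate f (inv t)) [y]"
proof (induction f)
  case 0
  then show ?case using x in_B[OF i x] by (intro bexI[of _ x]) simp_all
next
  case (Suc f)
  then obtain y where y: "y \<in> B i" "rewr G S l f (replicate f t @ [x] @ replicate f (inv t)) [y]" by auto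
  let ?y = "t \<otimes> y \<otimes> inv t"
  have y': "?y \<in> B i" using t y by (auto simp: contracting_on_def)
  have "rewr G S l f ([t] @ (replicate f t @ [x] @ replicate f (inv t)) @ [inv t]) ([t] @ [y] @ [inv t])"
    using contracts_T[OF t] by (intro rewr_congr[OF y(2)]) auto
  also have "rewr G S l 1 ([t] @ [y] @ [inv t]) [?y]"
    using contracts_T[OF t] in_B[OF i y(1)] in_B[OF i y'] l by (intro rewr_base) (auto simp: m_assoc)
  finally show ?case using y' by (auto simp: replicate_append_same intro!: bexI[of _ ?y])
qed

text \<open>The word \<open>u\<close> might expand \<open>x\<close> out of \<open>B i\<close> on the
  way. In the abelian group \<open>H\<close> it equals a word of length O(n): first the power -e of
  \<open>t\<close>, then its power \<open>f\<close>, then the interleaved word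
  \<open>\<sigma> u\<close>. So \<open>fill\<close> replaces \<open>u\<close> on the left of
  \<open>x\<close> and, inverted, its inverse on the right. Then \<open>x\<close> passes through
  \<open>\<sigma> u\<close> and the power \<open>f\<close> one relation at a time, always inside
  \<open>B i\<close>, and only the outer powers of \<open>t\<close> survive.\<close>

lemma conj_to_contracted:
  assumes i: "i \<in> set I" and t: "contracts i t" and x: "x \<in> B i" and u: "u \<in> lists T"
    and "1 \<le> n" "length u \<le> p * n" "e \<le> q * n" "M * length u \<le> e"
  shows "\<exists>y\<in>B i. qrewr (2 * (Q * (p + 2 * q + 1)\<^sup>2) + p + q) n (u @ [x] @ list_inv G u) (conj_word t e y)"
proof -
  define \<sigma> where "\<sigma> = (\<lambda>u. concat (map (\<lambda>a. replicate M t @ [a]) u))"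
  \<comment> \<open>Interleaving uses \<open>M * length u\<close> letters \<open>t\<close>;
    \<open>f\<close> supplies the rest up to \<open>e\<close>, so that all of them cancel against
    the leading powers of \<open>inv t\<close>.\<close>
  define f where "f = e - M * length u"
  let ?c = "Q * (p + 2 * q + 1)\<^sup>2"
  note tT = contracts_T[OF t]
  have \<sigma>T: "\<sigma> w \<in> lists T" if "w \<in> lists T" for w using that tT by (auto simp: \<sigma>_def)
  have len_\<sigma>: "length (\<sigma> w) = (M + 1) * length w" for w by (induction w) (auto simp: \<sigma>_def)
  have tH: "t \<in> H" using tT T by auto
  have pow_H: "t [^] (k::nat) \<in> H" for k
    using tH H(1) by (induction k) (auto intro: subgroup.one_closed subgroup.m_closed)
  have prod_\<sigma>: "list_prod G (\<sigma> w) = t [^] (M * length w) \<otimes> list_prod G w" if "w \<in> lists T" for w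
    using that
  proof (induction w)
    case Nil
    then show ?case by (simp add: \<sigma>_def)
  next
    case (Cons a w)
    then have a: "a \<in> carrier G" "a \<in> H" and w: "w \<in> lists T" using T S by auto
    note wc = lists_T(2)[OF w] lists_T(2)[OF \<sigma>T[OF w]]
    have "list_prod G (\<sigma> (a # w)) = list_prod G (replicate M t @ ([a] @ \<sigma> w))" by (simp add: \<sigma>_def)
    also have "\<dots> = t [^] M \<otimes> (a \<otimes> (t [^] (M * length w) \<otimes> list_prod G w))"
      using a wc tT Cons by (subst list_prod_append) (auto simp: list_prod_replicate)
    also have "a \<otimes> (t [^] (M * length w) \<otimes> list_prod G w) = t [^] (M * length w) \<otimes> (a \<otimes> list_prod G w)"
      using a wc tT H(2)[OF a(2) pow_H[of "M * length w"]] by (simp flip: m_assoc)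
    also have "t [^] M \<otimes> (t [^] (M * length w) \<otimes> (a \<otimes> list_prod G w)) =
        (t [^] M \<otimes> t [^] (M * length w)) \<otimes> (a \<otimes> list_prod G w)"
      using a wc tT by (simp add: m_assoc)
    also have "t [^] M \<otimes> t [^] (M * length w) = t [^] (M * length (a # w))"
      using tT by (simp add: nat_pow_mult)
    finally show ?case by simp
  qed
  let ?v = "replicate e (inv t) @ replicate f t @ \<sigma> u"
  have vT: "?v \<in> lists T" using tT \<sigma>T[OF u] by auto
  have len_v: "length ?v \<le> (p + 2 * q) * n"
  proof -
    have "length ?v = 2 * e + length u" using assms(8) by (simp add: len_\<sigma> f_def)
    then show ?thesis using assms(6,7) by (simp add: algebra_simps)
  qed
  have prod_v: "list_prod G u = list_prod G ?v"
  proof -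
    note uc = lists_T(2)[OF u] lists_T(2)[OF \<sigma>T[OF u]]
    have "list_prod G ?v = inv t [^] e \<otimes> (t [^] f \<otimes> (t [^] (M * length u) \<otimes> list_prod G u))"
      using uc tT by (simp add: list_prod_append list_prod_replicate prod_\<sigma>[OF u])
    also have "\<dots> = inv t [^] e \<otimes> (t [^] e \<otimes> list_prod G u)"
      using uc tT assms(8) by (simp add: f_def nat_pow_mult flip: m_assoc)
    also have "\<dots> = list_prod G u"
      using uc tT by (simp add: nat_pow_inv flip: m_assoc)
    finally show ?thesis by simp
  qed
  have len_u: "length u \<le> (p + 2 * q) * n" using assms(6) by (simp add: algebra_simps)
  have fill1: "qrewr ?c n u ?v"
    using fill_scaled[OF u vT len_u len_v \<open>1 \<le> n\<close> prod_v] .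
  have "list_prod G (list_inv G u) = list_prod G (list_inv G ?v)"
    using prod_v list_prod_list_inv[OF lists_T(2)[OF u]] list_prod_list_inv[OF lists_T(2)[OF vT]] by simp
  then have fill2: "qrewr ?c n (list_inv G u) (list_inv G ?v)"
    using fill_scaled[OF lists_T(3)[OF u] lists_T(3)[OF vT]] len_u len_v \<open>1 \<le> n\<close> by simp
  obtain y where y: "y \<in> B i" "rewr G S l (length u) (\<sigma> u @ [x] @ list_inv G (\<sigma> u)) [y]"
    using push_interleaved[OF i t u x] unfolding \<sigma>_def by blast
  obtain z where z: "z \<in> B i" "rewr G S l f (replicate f t @ [y] @ replicate f (inv t)) [z]"
    using push_powers[OF i t y(1)] by blast
  have inv_v: "list_inv G ?v = list_inv G (\<sigma> u) @ replicate f (inv t) @ replicate e t"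
    using tT by (simp add: list_inv_append list_inv_replicate)
  have "qrewr ?c n (u @ ([x] @ list_inv G u)) (?v @ ([x] @ list_inv G u))"
    using in_B[OF i x] lists_T(1)[OF lists_T(3)[OF u]] by (intro qrewr_congr_right[OF fill1]) simp
  also have "qrewr ?c n (?v @ ([x] @ list_inv G u)) ((?v @ [x]) @ list_inv G ?v)"
    using qrewr_congr_left[OF fill2, of "?v @ [x]"] in_B[OF i x] lists_T(1)[OF vT] by simp
  also have "qrewr p n ((?v @ [x]) @ list_inv G ?v)
      ((replicate e (inv t) @ replicate f t) @ [y] @ (replicate f (inv t) @ replicate e t))"
  proof -
    have "qrewr p n (\<sigma> u @ [x] @ list_inv G (\<sigma> u)) [y]" using y assms(6) by (intro qrewr_linear)
    from qrewr_congr[OF this, of "replicate e (inv t) @ replicate f t" "replicate f (inv t) @ replicate e t"]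
    show ?thesis using tT by (simp add: inv_v)
  qed
  also have "qrewr q n ((replicate e (inv t) @ replicate f t) @ [y] @ (replicate f (inv t) @ replicate e t))
      (conj_word t e z)"
  proof -
    have "qrewr q n (replicate f t @ [y] @ replicate f (inv t)) [z]"
      using z assms(7) by (intro qrewr_linear[of f]) (auto simp: f_def)
    from qrewr_congr[OF this, of "replicate e (inv t)" "replicate e t"]
    show ?thesis using tT by (simp add: conj_word_def)
  qed
  finally have "qrewr (2 * ?c + p + q) n (u @ [x] @ list_inv G u) (conj_word t e z)"
    by (elim qrewr_mono) simp
  then show ?thesis using z by blast
qed

text \<open>The constant found in \<open>conj_to_contracted\<close>: two fillings of words of length
  at most (p + 2 q) n, followed by linear passages.\<close>

definition cost :: "nat \<Rightarrow> nat \<Rightarrow> nat" where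
  "cost p q = 2 * (Q * (p + 2 * q + 1)\<^sup>2) + p + q"

lemma \<tau>_mem: assumes "i \<in> set I"
  shows "\<tau> i \<in> T" "\<tau> i \<in> S" "inv (\<tau> i) \<in> S" "inv (\<tau> i) \<in> T" "\<tau> i \<in> carrier G"
  using contracts_T[OF \<tau>(1)[OF assms]] by auto

text \<open>Normal forms are multiplied at equal exponents, so exponents have to be raised to a
  common value. The additional powers are inserted innermost, by \<open>conj_to_contracted\<close>
  with empty \<open>u\<close>.\<close>

lemma conj_word_raise:
  assumes i: "i \<in> set I" and x: "x \<in> B i" and "e \<le> e'" "e' \<le> q * n" "1 \<le> n"
  shows "\<exists>y\<in>B i. qrewr (cost 0 q) n (conj_word (\<tau> i) e x) (conj_word (\<tau> i) e' y)"
proof -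
  let ?t = "\<tau> i"
  have "\<exists>y\<in>B i. qrewr (cost 0 q) n ([] @ [x] @ list_inv G []) (conj_word ?t (e' - e) y)"
    unfolding cost_def using assms \<tau>(1)[OF i] by (intro conj_to_contracted) auto
  then obtain y where y: "y \<in> B i" "qrewr (cost 0 q) n [x] (conj_word ?t (e' - e) y)" by auto
  have "qrewr (cost 0 q) n (conj_word ?t e x)
      (replicate e (inv ?t) @ conj_word ?t (e' - e) y @ replicate e ?t)"
    unfolding conj_word_def[of _ e] using \<tau>_mem[OF i] by (intro qrewr_congr y) auto
  also have "replicate e (inv ?t) @ conj_word ?t (e' - e) y @ replicate e ?t = conj_word ?t e' y"
    using replicate_add[of e "e' - e" "inv ?t"] replicate_add[of "e' - e" e ?t] \<open>e \<le> e'\<close>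
    by (simp add: conj_word_def)
  finally show ?thesis using y by blast
qed

text \<open>Conjugates by powers of the different elements \<open>\<tau> i\<close> and
  \<open>\<tau> j\<close> cannot be interchanged directly. Both are rewritten as conjugates by the
  same power of a common contraction \<open>t\<close>; the inner powers cancel, the two ball
  elements commute by one relation, and the same moves are made in reverse.\<close>

lemma conj_word_swap:
  assumes i: "i \<in> set I" and j: "j \<in> set I" and x: "x \<in> B i" and y: "y \<in> B j"
    and e: "e \<le> p * n" and n: "1 \<le> n"
  shows "qrewr (4 * cost p (M * p) + 2 * (M * p) + 1) n
    (conj_word (\<tau> i) e x @ conj_word (\<tau> j) e y) (conj_word (\<tau> j) e y @ conj_word (\<tau> i) e x)"
proof -
  obtain t where t: "contracts i t" "contracts j t" using pair[OF i j] by blast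
  note tT = contracts_T[OF t(1)]
  \<comment> \<open>The conjugating power of \<open>\<tau>\<close> has length \<open>e\<close>, and
    \<open>conj_to_contracted\<close> asks for an exponent of at least \<open>M\<close> times
    that.\<close>
  let ?e = "M * e"
  let ?L = "replicate ?e (inv t)" and ?R = "replicate ?e t"
  have e': "?e \<le> (M * p) * n" using e by (metis mult.assoc mult_le_mono2)
  have conv: "\<exists>z\<in>B k. qrewr (cost p (M * p)) n (conj_word (\<tau> k) e w) (conj_word t ?e z)"
    if k: "k \<in> set I" "w \<in> B k" "contracts k t" for k w
  proof -
    have "\<exists>z\<in>B k. qrewr (cost p (M * p)) n
        (replicate e (inv (\<tau> k)) @ [w] @ list_inv G (replicate e (inv (\<tau> k)))) (conj_word t ?e z)"
      unfolding cost_def using \<tau>_mem[OF k(1)] e n e' k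
      by (intro conj_to_contracted) (auto simp: mult.assoc)
    then show ?thesis using \<tau>_mem[OF k(1)] by (simp add: conj_word_def list_inv_replicate)
  qed
  obtain x' where x': "x' \<in> B i" "qrewr (cost p (M * p)) n (conj_word (\<tau> i) e x) (conj_word t ?e x')"
    using conv[OF i x t(1)] by blast
  obtain y' where y': "y' \<in> B j" "qrewr (cost p (M * p)) n (conj_word (\<tau> j) e y) (conj_word t ?e y')"
    using conv[OF j y t(2)] by blast
  have merge: "qrewr (M * p) n (conj_word t ?e a @ conj_word t ?e b) (?L @ [a, b] @ ?R)"
    if "a \<in> S" "b \<in> S" for a b
  proof -
    have "qrewr (M * p) n ((?L @ [a]) @ (?R @ ?L) @ ([b] @ ?R)) ((?L @ [a]) @ [] @ ([b] @ ?R))"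
      using that tT e' by (intro qrewr_congr cancel_powers) auto
    then show ?thesis by (simp add: conj_word_def)
  qed
  have S': "x' \<in> S" "y' \<in> S" using x' y' in_B i j by auto
  have "qrewr (cost p (M * p) + cost p (M * p)) n (conj_word (\<tau> i) e x @ conj_word (\<tau> j) e y)
      (conj_word t ?e x' @ conj_word t ?e y')"
    using x' y' by (intro qrewr_append)
  also have "qrewr (M * p) n (conj_word t ?e x' @ conj_word t ?e y') (?L @ [x', y'] @ ?R)"
    using S' by (intro merge)
  also have "qrewr 1 n (?L @ [x', y'] @ ?R) (?L @ [y', x'] @ ?R)"
  proof -
    have "rewr G S l 1 [x', y'] [y', x']"
      using S' l commute[OF i j x'(1) y'(1)] in_B i j x' y' by (intro rewr_base) auto
    then show ?thesis using n tT by (intro qrewr_congr) (auto intro: qrewr_linear)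
  qed
  also have "qrewr (M * p) n (?L @ [y', x'] @ ?R) (conj_word t ?e y' @ conj_word t ?e x')"
    using S' by (intro qrewr_sym[OF merge])
  also have "qrewr (cost p (M * p) + cost p (M * p)) n (conj_word t ?e y' @ conj_word t ?e x')
      (conj_word (\<tau> j) e y @ conj_word (\<tau> i) e x)"
    using qrewr_append[OF qrewr_sym[OF y'(2)] qrewr_sym[OF x'(2)]] .
  finally show ?thesis by (elim qrewr_mono) simp
qed

text \<open>The product of two ball elements may leave the ball, but one more conjugation by
  \<open>\<tau> i\<close> brings it back. This costs one in the exponent.\<close>

lemma conj_word_merge:
  assumes i: "i \<in> set I" and x: "x \<in> B i" and y: "y \<in> B i"
    and e: "e \<le> p * n" and n: "1 \<le> n"
  shows "\<exists>z\<in>B i. qrewr (p + 1) n (conj_word (\<tau> i) e x @ conj_word (\<tau> i) e y) (conj_word (\<tau> i) (e + 1) z)"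
proof -
  let ?t = "\<tau> i"
  let ?L = "replicate e (inv ?t)" and ?R = "replicate e ?t"
  let ?z = "?t \<otimes> (x \<otimes> y) \<otimes> inv ?t"
  have z: "?z \<in> B i" using \<tau>(2)[OF i x y] .
  note mem = \<tau>_mem[OF i] in_B[OF i x] in_B[OF i y] in_B[OF i z]
  have "qrewr p n ((?L @ [x]) @ (?R @ ?L) @ ([y] @ ?R)) ((?L @ [x]) @ [] @ ([y] @ ?R))"
    using mem e by (intro qrewr_congr cancel_powers) auto
  also have "(?L @ [x]) @ [] @ ([y] @ ?R) = ?L @ [x, y] @ ?R" by simp
  also have "qrewr 1 n (?L @ [x, y] @ ?R) (?L @ [inv ?t, ?z, ?t] @ ?R)"
  proof -
    have "inv ?t \<otimes> (?z \<otimes> ?t) = x \<otimes> y" 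
    proof -
      have "?z \<otimes> ?t = ?t \<otimes> (x \<otimes> y)" using mem by (simp add: m_assoc)
      moreover have "inv ?t \<otimes> (?t \<otimes> (x \<otimes> y)) = (inv ?t \<otimes> ?t) \<otimes> (x \<otimes> y)"
        using mem by (simp only: m_assoc m_closed inv_closed)
      ultimately show ?thesis using mem by simp
    qed
    then have "rewr G S l 1 [x, y] [inv ?t, ?z, ?t]" using mem l by (intro rewr_base) auto
    then show ?thesis using n mem by (intro qrewr_congr) (auto intro: qrewr_linear)
  qed
  also have "?L @ [inv ?t, ?z, ?t] @ ?R = conj_word ?t (e + 1) ?z"
    by (simp add: conj_word_def replicate_append_same flip: append_Cons)
  finally show ?thesis using z by (auto simp: conj_word_def)
qed

text \<open>The powers of \<open>\<tau> i\<close> and the word \<open>u\<close> lie over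
  \<open>T\<close>, hence commute at quadratic cost. This brings \<open>u\<close> next to
  \<open>x\<close>, where \<open>conj_to_contracted\<close> turns it into
  \<open>M * length u\<close> further powers of \<open>\<tau> i\<close>.\<close>

lemma conj_word_conj:
  assumes i: "i \<in> set I" and x: "x \<in> B i" and u: "u \<in> lists T"
    and e: "e \<le> q * n" and len: "length u \<le> p * n" and n: "1 \<le> n"
  shows "\<exists>z\<in>B i. qrewr (2 * (Q * (p + q + 1)\<^sup>2) + cost p (M * p)) n
    (u @ conj_word (\<tau> i) e x @ list_inv G u) (conj_word (\<tau> i) (e + M * length u) z)"
proof -
  let ?t = "\<tau> i" and ?c = "Q * (p + q + 1)\<^sup>2" and ?u = "list_inv G u"
  let ?L = "replicate e (inv ?t)" and ?R = "replicate e ?t"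
  note mem = \<tau>_mem[OF i] in_B[OF i x] lists_T[OF u] lists_T(1,2)[OF lists_T(3)[OF u]]
  have "\<exists>y\<in>B i. qrewr (cost p (M * p)) n (u @ [x] @ ?u) (conj_word ?t (M * length u) y)"
    unfolding cost_def using i x u n len \<tau>(1)[OF i] mult_le_mono2[OF len, of M]
    by (intro conj_to_contracted) (auto simp: mult.assoc)
  then obtain y where y: "y \<in> B i" "qrewr (cost p (M * p)) n (u @ [x] @ ?u) (conj_word ?t (M * length u) y)"
    by blast
  have LT: "?L \<in> lists T" "?R \<in> lists T" using mem by auto
  have HL: "list_prod G ?L \<in> H" "list_prod G ?R \<in> H" "list_prod G u \<in> H" "list_prod G ?u \<in> H"
    using list_prod_in_H LT u mem by blast+
  have len': "length (u @ ?L) \<le> (p + q) * n" using len e by (simp add: algebra_simps)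
  have f1: "qrewr ?c n (u @ ?L) (?L @ u)"
    using LT u len' n H(2)[OF HL(3,1)] mem lists_T(2)[OF LT(1)]
    by (intro fill_scaled) (auto simp: list_prod_append add.commute)
  have f2: "qrewr ?c n (?R @ ?u) (?u @ ?R)"
    using LT u len' n H(2)[OF HL(2,4)] mem lists_T(2)[OF LT(2)]
    by (intro fill_scaled) (auto simp: list_prod_append add.commute)
  have "qrewr ?c n ((u @ ?L) @ ([x] @ ?R @ ?u)) ((?L @ u) @ ([x] @ ?R @ ?u))"
    using mem by (intro qrewr_congr_right f1) auto
  also have "(?L @ u) @ ([x] @ ?R @ ?u) = (?L @ u @ [x]) @ (?R @ ?u)" by simp
  also have "qrewr ?c n ((?L @ u @ [x]) @ (?R @ ?u)) ((?L @ u @ [x]) @ (?u @ ?R))"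
    using mem by (intro qrewr_congr_left f2) auto
  also have "(?L @ u @ [x]) @ (?u @ ?R) = ?L @ (u @ [x] @ ?u) @ ?R" by simp
  also have "qrewr (cost p (M * p)) n (?L @ (u @ [x] @ ?u) @ ?R) (?L @ conj_word ?t (M * length u) y @ ?R)"
    using mem by (intro qrewr_congr y) auto
  also have "?L @ conj_word ?t (M * length u) y @ ?R = conj_word ?t (e + M * length u) y"
    using replicate_add[of "M * length u" e ?t]
    by (simp add: conj_word_def replicate_add[of e "M * length u" "inv ?t"] add.commute)
  finally have "qrewr (2 * ?c + cost p (M * p)) n (u @ conj_word ?t e x @ ?u) (conj_word ?t (e + M * length u) y)"
    by (simp add: conj_word_def mult_2)
  then show ?thesis using y by blast
qed

section \<open>Products with one conjugate for each summand\<close>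

lemma conj_words_simps [simp]: "conj_words e y [] = []"
  "conj_words e y (i # J) = conj_word (\<tau> i) e (y i) @ conj_words e y J"
  "conj_words e y (J @ J') = conj_words e y J @ conj_words e y J'"
  by (simp_all add: conj_words_def)

lemma conj_words_in_lists:
  "\<lbrakk>set J \<subseteq> set I; \<And>i. i \<in> set J \<Longrightarrow> y i \<in> B i\<rbrakk> \<Longrightarrow> conj_words e y J \<in> lists S"
proof (induction J)
  case (Cons i J)
  then have "conj_word (\<tau> i) e (y i) \<in> lists S" using \<tau>_mem[of i] in_B[of i "y i"]
    by (intro conj_word_in_lists) auto
  with Cons show ?case by simp
qed simp

lemma conj_words_raise:
  assumes J: "set J \<subseteq> set I" "\<And>i. i \<in> set J \<Longrightarrow> y i \<in> B i" and e: "e \<le> e'" "e' \<le> q * n" "1 \<le> n"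
  shows "\<exists>z. (\<forall>i\<in>set J. z i \<in> B i) \<and>
    qrewr (length J * cost 0 q) n (conj_words e y J) (conj_words e' z J)"
proof -
  have "\<forall>i\<in>set J. \<exists>z. z \<in> B i \<and> qrewr (cost 0 q) n (conj_word (\<tau> i) e (y i)) (conj_word (\<tau> i) e' z)"
    using conj_word_raise[OF _ _ e] J by blast
  from bchoice[OF this] obtain z where z: "\<And>i. i \<in> set J \<Longrightarrow> z i \<in> B i"
    "\<And>i. i \<in> set J \<Longrightarrow> qrewr (cost 0 q) n (conj_word (\<tau> i) e (y i)) (conj_word (\<tau> i) e' (z i))"
    by blast
  have "qrewr (length J' * cost 0 q) n (conj_words e y J') (conj_words e' z J')" if "set J' \<subseteq> set J" for J'
    using that
  proof (induction J')
    case (Cons i J')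
    then have "qrewr (cost 0 q + length J' * cost 0 q) n (conj_words e y (i # J')) (conj_words e' z (i # J'))"
      unfolding conj_words_simps using z by (intro qrewr_append) auto
    then show ?case by simp
  qed (simp add: qrewr_def)
  then show ?thesis using z by blast
qed

text \<open>The inverse of \<open>u\<close> followed by \<open>u\<close> is inserted behind each
  factor, so that each factor is conjugated separately. All of them end with the same
  exponent.\<close>

lemma conj_words_pass:
  assumes J: "set J \<subseteq> set I" "\<And>i. i \<in> set J \<Longrightarrow> y i \<in> B i" and u: "u \<in> lists T" "length u \<le> p * n"
    and e: "e \<le> q * n" "1 \<le> n"
  defines "c \<equiv> 2 * (Q * (p + q + 1)\<^sup>2) + cost p (M * p)"
  shows "\<exists>z. (\<forall>i\<in>set J. z i \<in> B i) \<and>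
    qrewr (length J * (p + c)) n (u @ conj_words e y J) (conj_words (e + M * length u) z J @ u)"
proof -
  let ?e = "e + M * length u" and ?u = "list_inv G u"
  note uS = lists_T(1)[OF u(1)] lists_T(1)[OF lists_T(3)[OF u(1)]]
  have "\<forall>i\<in>set J. \<exists>z. z \<in> B i \<and> qrewr c n (u @ conj_word (\<tau> i) e (y i) @ ?u) (conj_word (\<tau> i) ?e z)"
    unfolding c_def using conj_word_conj[OF _ _ u(1) e(1) u(2) e(2)] J by blast
  from bchoice[OF this] obtain z where z: "\<And>i. i \<in> set J \<Longrightarrow> z i \<in> B i"
    "\<And>i. i \<in> set J \<Longrightarrow> qrewr c n (u @ conj_word (\<tau> i) e (y i) @ ?u) (conj_word (\<tau> i) ?e (z i))"
    by blast
  have "qrewr (length J' * (p + c)) n (u @ conj_words e y J') (conj_words ?e z J' @ u)"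
    if "set J' \<subseteq> set J" for J'
    using that
  proof (induction J')
    case Nil
    then show ?case using uS by (simp add: qrewr_def)
  next
    case (Cons i J')
    let ?X = "conj_word (\<tau> i) e (y i)" and ?Z = "conj_word (\<tau> i) ?e (z i)"
    have i: "i \<in> set J" "i \<in> set I" using Cons J by auto
    have XS: "?X \<in> lists S" "?Z \<in> lists S"
      using i \<tau>_mem(2)[OF i(2)] in_B(1)[OF i(2)] J(2) z(1) by (intro conj_word_in_lists; simp)+
    have JS: "conj_words e y J' \<in> lists S"
      using J Cons.prems by (intro conj_words_in_lists) auto
    have "qrewr p n ((u @ ?X) @ [] @ conj_words e y J') ((u @ ?X) @ (?u @ u) @ conj_words e y J')"
      using uS XS JS u by (intro qrewr_congr qrewr_sym[OF cancel(2)]) auto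
    also have "(u @ ?X) @ (?u @ u) @ conj_words e y J' = (u @ ?X @ ?u) @ (u @ conj_words e y J')" by simp
    also have "qrewr (c + length J' * (p + c)) n ((u @ ?X @ ?u) @ (u @ conj_words e y J'))
        (?Z @ (conj_words ?e z J' @ u))"
      using z(2)[OF i(1)] Cons by (intro qrewr_append) auto
    finally show ?case by (simp add: add.assoc)
  qed
  then show ?thesis using z by blast
qed

lemma conj_words_swap:
  assumes J: "set J \<subseteq> set I" "\<And>i. i \<in> set J \<Longrightarrow> y i \<in> B i" and i: "i \<in> set I" "x \<in> B i"
    and e: "e \<le> p * n" "1 \<le> n"
  defines "c \<equiv> 4 * cost p (M * p) + 2 * (M * p) + 1"
  shows "qrewr (length J * c) n (conj_words e y J @ conj_word (\<tau> i) e x) (conj_word (\<tau> i) e x @ conj_words e y J)"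
  using J
proof (induction J)
  let ?X = "conj_word (\<tau> i) e x"
  have XS: "?X \<in> lists S" using \<tau>_mem(2)[OF i(1)] in_B[OF i] by (intro conj_word_in_lists)
  {
    case Nil
    then show ?case using XS by (simp add: qrewr_def)
  next
    case (Cons j J)
    let ?Y = "conj_word (\<tau> j) e (y j)"
    have j: "j \<in> set I" "y j \<in> B j" using Cons by auto
    have YS: "?Y \<in> lists S" using \<tau>_mem(2)[OF j(1)] in_B[OF j] by (intro conj_word_in_lists)
    have JS: "conj_words e y J \<in> lists S" using Cons by (intro conj_words_in_lists) auto
    have "qrewr (length J * c) n (?Y @ (conj_words e y J @ ?X)) (?Y @ (?X @ conj_words e y J))"
      using Cons YS by (intro qrewr_congr_left) auto
    also have "?Y @ (?X @ conj_words e y J) = (?Y @ ?X) @ conj_words e y J" by simp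
    also have "qrewr c n ((?Y @ ?X) @ conj_words e y J) ((?X @ ?Y) @ conj_words e y J)"
      unfolding c_def using conj_word_swap[OF j(1) i(1) j(2) i(2) e] JS by (intro qrewr_congr_right) auto
    finally show ?case by (simp add: add.commute)
  }
qed

text \<open>The first factor of the second word moves left past the remaining factors of the first
  word and merges with its partner. The bound \<open>r\<close> on the length of \<open>J\<close>
  stays fixed during the induction, so that the constant \<open>c\<close> does not change with
  \<open>J\<close>.\<close>

lemma conj_words_merge:
  assumes J: "set J \<subseteq> set I" "distinct J" "\<And>i. i \<in> set J \<Longrightarrow> y i \<in> B i" "\<And>i. i \<in> set J \<Longrightarrow> z i \<in> B i"
    and e: "e \<le> p * n" "1 \<le> n" and r: "length J \<le> r"
  defines "c \<equiv> r * (4 * cost p (M * p) + 2 * (M * p) + 1) + (p + 1)"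
  shows "\<exists>w. (\<forall>i\<in>set J. w i \<in> B i) \<and>
    qrewr (length J * c) n (conj_words e y J @ conj_words e z J) (conj_words (e + 1) w J)"
  using J r
proof (induction J)
  case Nil
  then show ?case by (simp add: qrewr_def)
next
  case (Cons i J)
  have "\<exists>w. (\<forall>i\<in>set J. w i \<in> B i) \<and>
      qrewr (length J * c) n (conj_words e y J @ conj_words e z J) (conj_words (e + 1) w J)"
    using Cons.prems by (intro Cons.IH) auto
  then obtain w where w: "\<forall>j\<in>set J. w j \<in> B j"
    "qrewr (length J * c) n (conj_words e y J @ conj_words e z J) (conj_words (e + 1) w J)"
    by blast
  have i: "i \<in> set I" "y i \<in> B i" "z i \<in> B i" using Cons by auto
  let ?Y = "conj_word (\<tau> i) e (y i)" and ?Z = "conj_word (\<tau> i) e (z i)"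
  obtain x where x: "x \<in> B i" "qrewr (p + 1) n (?Y @ ?Z) (conj_word (\<tau> i) (e + 1) x)"
    using conj_word_merge[OF i e] by blast
  have YS: "?Y \<in> lists S" using \<tau>_mem(2)[OF i(1)] in_B[OF i(1,2)] by (intro conj_word_in_lists)
  have JS: "conj_words e z J \<in> lists S" using Cons by (intro conj_words_in_lists) auto
  let ?d = "4 * cost p (M * p) + 2 * (M * p) + 1"
  have "conj_words (e + 1) (w(i := x)) J' = conj_words (e + 1) w J'" if "i \<notin> set J'" for J'
    using that by (induction J') auto
  then have upd: "conj_words (e + 1) (w(i := x)) (i # J) = conj_word (\<tau> i) (e + 1) x @ conj_words (e + 1) w J"
    using Cons by simp
  have "qrewr (length J * ?d) n (?Y @ (conj_words e y J @ ?Z) @ conj_words e z J)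
      (?Y @ (?Z @ conj_words e y J) @ conj_words e z J)"
    using conj_words_swap[of J y i "z i" e p n] Cons i e YS JS by (intro qrewr_congr) auto
  also have "?Y @ (?Z @ conj_words e y J) @ conj_words e z J =
      (?Y @ ?Z) @ (conj_words e y J @ conj_words e z J)" by simp
  also have "qrewr ((p + 1) + length J * c) n ((?Y @ ?Z) @ (conj_words e y J @ conj_words e z J))
      (conj_word (\<tau> i) (e + 1) x @ conj_words (e + 1) w J)"
    using x w by (intro qrewr_append) auto
  finally have "qrewr (length J * ?d + ((p + 1) + length J * c)) n
      (conj_words e y (i # J) @ conj_words e z (i # J)) (conj_words (e + 1) (w(i := x)) (i # J))"
    by (simp only: upd) simp
  moreover have "length J * ?d \<le> r * ?d" using Cons by (intro mult_le_mono1) simp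
  then have "length J * ?d + ((p + 1) + length J * c) \<le> length (i # J) * c" by (simp add: c_def)
  ultimately have "qrewr (length (i # J) * c) n
      (conj_words e y (i # J) @ conj_words e z (i # J)) (conj_words (e + 1) (w(i := x)) (i # J))"
    by (rule qrewr_mono)
  moreover have "\<forall>j\<in>set (i # J). (w(i := x)) j \<in> B j" using x w by simp
  ultimately show ?case by blast
qed

lemma conj_words_trivial:
  assumes "set J \<subseteq> set I" "\<And>i. i \<in> set J \<Longrightarrow> y i = \<one>"
  shows "rewr G S l (length J * (e + 1)) (conj_words e y J) []"
  using assms
proof (induction J)
  case (Cons i J)
  then have i: "i \<in> set I" by auto
  note mem = \<tau>_mem[OF i]
  have "rewr G S l 1 [\<one>] []" using B[OF i] l by (intro rewr_base) auto
  then have "rewr G S l 1 (replicate e (inv (\<tau> i)) @ [\<one>] @ replicate e (\<tau> i))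
      (replicate e (inv (\<tau> i)) @ [] @ replicate e (\<tau> i))"
    using mem by (intro rewr_congr) auto
  also have "rewr G S l e (replicate e (inv (\<tau> i)) @ [] @ replicate e (\<tau> i)) []"
    using rewr_cancel(2)[OF is_group S(1,2), of l "replicate e (\<tau> i)"] mem l
    by (simp add: list_inv_replicate)
  finally have "rewr G S l (1 + e) (conj_word (\<tau> i) e (y i)) []" using Cons by (simp add: conj_word_def)
  from rewr_append[OF this Cons.IH] Cons.prems show ?case by (simp add: algebra_simps)
qed simp

section \<open>Normal forms and bisection of words\<close>

definition multiplication_cost :: "nat \<Rightarrow> bool" where
  "multiplication_cost D \<longleftrightarrow> (\<forall>n y y' u u'. 1 \<le> n \<longrightarrow> (\<forall>i\<in>set I. y i \<in> B i) \<longrightarrow>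
     (\<forall>i\<in>set I. y' i \<in> B i) \<longrightarrow> u \<in> lists T \<longrightarrow> u' \<in> lists T \<longrightarrow> length u \<le> n \<longrightarrow>
     (\<exists>w. (\<forall>i\<in>set I. w i \<in> B i) \<and>
       qrewr D n ((conj_words ((M + 1) * n) y I @ u) @ (conj_words ((M + 1) * n) y' I @ u'))
         (conj_words ((M + 1) * (2 * n)) w I @ (u @ u'))))"

text \<open>At scale n the exponent is (M + 1) n and the first word in A has length at most n.
  Passing that word through the second normal form adds at most M n and merging adds one, which fits
  into the exponent 2 (M + 1) n of scale 2 n. The summand 1 in M + 1 makes room for the
  merging.\<close>

lemma multiplication_cost_exists: "\<exists>D. multiplication_cost D"
proof -
  define q where "q = 2 * (M + 1)"
  define r where "r = length I"
  define c1 where "c1 = r * (1 + (2 * (Q * (1 + q + 1)\<^sup>2) + cost 1 (M * 1)))"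
  define c2 where "c2 = r * cost 0 q"
  define c3 where "c3 = r * (r * (4 * cost q (M * q) + 2 * (M * q) + 1) + (q + 1))"
  show ?thesis unfolding multiplication_cost_def
  proof (intro exI[of _ "c1 + c2 + c2 + c3"] allI impI)
    fix n :: nat and y y' u u'
    assume n: "1 \<le> n" and y: "\<forall>i\<in>set I. y i \<in> B i" and y': "\<forall>i\<in>set I. y' i \<in> B i"
      and u: "u \<in> lists T" and u': "u' \<in> lists T" and len: "length u \<le> n"
    let ?e = "(M + 1) * n"
    \<comment> \<open>One below the exponent of scale 2 n, because merging two factors adds
      one.\<close>
    let ?f = "2 * (M + 1) * n - 1"
    note uS = lists_T(1)[OF u] lists_T(1)[OF u']
    have "?e \<le> q * n" by (simp add: q_def)
    then obtain z where z: "\<forall>i\<in>set I. z i \<in> B i"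
      "qrewr c1 n (u @ conj_words ?e y' I) (conj_words (?e + M * length u) z I @ u)"
      using conj_words_pass[of I y' u 1 n ?e q] y' u len n unfolding c1_def r_def by auto
    have "M * length u \<le> M * n" using len by (rule mult_le_mono2)
    moreover have "?f = ?e + M * n + (n - 1)" using n by (simp add: algebra_simps)
    ultimately have "?e + M * length u \<le> ?f" "?e \<le> ?f" by linarith+
    moreover have "?f \<le> q * n" by (simp add: q_def)
    ultimately have f: "?e + M * length u \<le> ?f" "?e \<le> ?f" "?f \<le> q * n" .
    obtain z' where z': "\<forall>i\<in>set I. z' i \<in> B i"
      "qrewr c2 n (conj_words (?e + M * length u) z I) (conj_words ?f z' I)"
      using conj_words_raise[OF _ _ f(1,3) n, of I z] z(1) unfolding c2_def r_def by auto
    obtain x where x: "\<forall>i\<in>set I. x i \<in> B i" "qrewr c2 n (conj_words ?e y I) (conj_words ?f x I)"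
      using conj_words_raise[OF _ _ f(2,3) n, of I y] y unfolding c2_def r_def by auto
    obtain w where w: "\<forall>i\<in>set I. w i \<in> B i"
      "qrewr c3 n (conj_words ?f x I @ conj_words ?f z' I) (conj_words (?f + 1) w I)"
      using conj_words_merge[OF _ I _ _ f(3) n, of x z' r] x z' unfolding c3_def r_def by auto
    have CS: "conj_words ?e y I \<in> lists S" using y by (intro conj_words_in_lists) auto
    have "qrewr c1 n (conj_words ?e y I @ (u @ conj_words ?e y' I) @ u')
        (conj_words ?e y I @ (conj_words (?e + M * length u) z I @ u) @ u')"
      by (rule qrewr_congr[OF z(2) CS uS(2)])
    also have "qrewr c2 n (conj_words ?e y I @ (conj_words (?e + M * length u) z I @ u) @ u')
        (conj_words ?e y I @ conj_words ?f z' I @ (u @ u'))"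
      using qrewr_congr[OF z'(2) CS, of "u @ u'"] uS by simp
    also have "qrewr c2 n (conj_words ?e y I @ conj_words ?f z' I @ (u @ u'))
        (conj_words ?f x I @ conj_words ?f z' I @ (u @ u'))"
      using qrewr_in_lists(2)[OF z'(2)] uS by (intro qrewr_congr_right x) auto
    also have "qrewr c3 n (conj_words ?f x I @ conj_words ?f z' I @ (u @ u'))
        (conj_words (?f + 1) w I @ (u @ u'))"
      using qrewr_congr_right[OF w(2), of "u @ u'"] uS by simp
    also have "?f + 1 = (M + 1) * (2 * n)" using n by (simp add: algebra_simps)
    finally show "\<exists>w. (\<forall>i\<in>set I. w i \<in> B i) \<and>
       qrewr (c1 + c2 + c2 + c3) n ((conj_words ?e y I @ u) @ (conj_words ?e y' I @ u'))
         (conj_words ((M + 1) * (2 * n)) w I @ (u @ u'))"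
      using w by auto
  qed
qed

definition normal_form_cost :: "nat \<Rightarrow> bool" where
  "normal_form_cost D \<longleftrightarrow> (\<forall>k w. w \<in> lists S \<longrightarrow> length w \<le> 2 ^ k \<longrightarrow>
     (\<exists>y u. (\<forall>i\<in>set I. y i \<in> B i) \<and> u \<in> lists T \<and> length u \<le> 2 ^ k \<and>
        rewr G S l (D * 4 ^ k) w (conj_words ((M + 1) * 2 ^ k) y I @ u)))"

text \<open>Multiplying the normal forms of two halves gives the recurrence c(k + 1) <= 2 c(k) + D0
  4 ^ k for the cost. As multiples of 4 ^ k quadruple, \<open>D = D0 + E\<close> satisfies it, where
  \<open>E\<close> bounds the cost of a single letter. A letter of \<open>T\<close> becomes the part
  in A; any other letter occupies one factor, and the remaining factors are trivial.\<close>

lemma normal_form_cost_exists: "\<exists>D. normal_form_cost D"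
proof -
  obtain D0 where "multiplication_cost D0" using multiplication_cost_exists by blast
  note D0 = this[unfolded multiplication_cost_def, rule_format]
  define E where "E = length I * (M + 2) + cost 0 (M + 1)"
  have base: "\<exists>y u. (\<forall>i\<in>set I. y i \<in> B i) \<and> u \<in> lists T \<and> length u \<le> 1 \<and>
      rewr G S l E w (conj_words (M + 1) y I @ u)" if w: "w \<in> lists S" "length w \<le> 1" for w
  proof (cases "w \<in> lists T")
    case True
    have "rewr G S l (length I * (M + 2)) [] (conj_words (M + 1) (\<lambda>_. \<one>) I)"
      by (rule rewr_sym) (use conj_words_trivial[of I "\<lambda>_. \<one>" "M + 1"] in simp)
    from rewr_congr_right[OF this w(1)]
    have "rewr G S l (length I * (M + 2)) w (conj_words (M + 1) (\<lambda>_. \<one>) I @ w)" by simp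
    then have "rewr G S l E w (conj_words (M + 1) (\<lambda>_. \<one>) I @ w)"
      by (rule rewr_mono) (simp add: E_def)
    then show ?thesis using True w B(2) by (intro exI[of _ "\<lambda>_. \<one>"] exI[of _ w]) simp
  next
    case False
    then obtain x where x: "w = [x]" "x \<notin> T"
      using w(2) by (cases w) auto
    have "x \<in> T \<union> (\<Union>i\<in>set I. B i)" using w(1) x(1) by (intro subsetD[OF S(3)]) simp
    then obtain i where i: "i \<in> set I" "x \<in> B i" using x(2) by blast
    obtain J J' where IJ: "I = J @ i # J'" using i(1) by (meson split_list)
    have notin: "i \<notin> set J" "i \<notin> set J'" using IJ I by auto
    obtain z where z: "z \<in> B i" "qrewr (cost 0 (M + 1)) 1 (conj_word (\<tau> i) 0 x) (conj_word (\<tau> i) (M + 1) z)"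
      using conj_word_raise[OF i, of 0 "M + 1" "M + 1" 1] by auto
    let ?y = "(\<lambda>_. \<one>)(i := z)"
    have triv: "rewr G S l (length J0 * (M + 2)) [] (conj_words (M + 1) ?y J0)"
      if "set J0 \<subseteq> set I" "i \<notin> set J0" for J0
    proof (rule rewr_sym)
      have "rewr G S l (length J0 * (M + 1 + 1)) (conj_words (M + 1) ?y J0) []"
        using that by (intro conj_words_trivial) auto
      then show "rewr G S l (length J0 * (M + 2)) (conj_words (M + 1) ?y J0) []" by simp
    qed
    have "rewr G S l (length J * (M + 2) + (cost 0 (M + 1) + length J' * (M + 2)))
        ([] @ [x] @ []) (conj_words (M + 1) ?y J @ conj_word (\<tau> i) (M + 1) z @ conj_words (M + 1) ?y J')"
      using z(2) notin IJ
      by (intro rewr_append triv) (auto simp: qrewr_def conj_word_def)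
    moreover have "conj_words (M + 1) ?y J @ conj_word (\<tau> i) (M + 1) z @ conj_words (M + 1) ?y J'
        = conj_words (M + 1) ?y I" by (simp add: IJ)
    ultimately have "rewr G S l (length J * (M + 2) + (cost 0 (M + 1) + length J' * (M + 2)))
        w (conj_words (M + 1) ?y I @ [])" using x by simp
    then have "rewr G S l E w (conj_words (M + 1) ?y I @ [])"
      by (rule rewr_mono) (simp add: E_def IJ algebra_simps)
    then show ?thesis using z B(2) by (intro exI[of _ ?y] exI[of _ "[]"]) auto
  qed
  define D where "D = D0 + E"
  have "\<exists>y u. (\<forall>i\<in>set I. y i \<in> B i) \<and> u \<in> lists T \<and> length u \<le> 2 ^ k \<and>
        rewr G S l (D * 4 ^ k) w (conj_words ((M + 1) * 2 ^ k) y I @ u)"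
    if "w \<in> lists S" "length w \<le> 2 ^ k" for k w
    using that
  proof (induction k arbitrary: w)
    case 0
    then have "length w \<le> 1" by simp
    with 0 obtain y u where yu: "\<forall>i\<in>set I. y i \<in> B i" "u \<in> lists T" "length u \<le> 1"
        "rewr G S l E w (conj_words (M + 1) y I @ u)"
      using base by blast
    from yu(4) have "rewr G S l (D * 4 ^ 0) w (conj_words ((M + 1) * 2 ^ 0) y I @ u)"
      unfolding power_0 mult_1_right by (rule rewr_mono) (simp add: D_def)
    moreover have "length u \<le> 2 ^ 0" using yu(3) by simp
    ultimately show ?case using yu(1,2) by blast
  next
    case (Suc k)
    let ?n = "2 ^ k :: nat"
    define w1 where "w1 = take ?n w"
    define w2 where "w2 = drop ?n w"
    have w: "w = w1 @ w2" by (simp add: w1_def w2_def)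
    have lists: "w1 \<in> lists S" "w2 \<in> lists S" using Suc.prems(1) w by auto
    have len: "length w1 \<le> ?n" "length w2 \<le> ?n" using Suc.prems(2) by (auto simp: w1_def w2_def)
    obtain y1 u1 where nf1: "\<forall>i\<in>set I. y1 i \<in> B i" "u1 \<in> lists T" "length u1 \<le> ?n"
      "rewr G S l (D * 4 ^ k) w1 (conj_words ((M + 1) * ?n) y1 I @ u1)"
      using Suc.IH[OF lists(1) len(1)] by blast
    obtain y2 u2 where nf2: "\<forall>i\<in>set I. y2 i \<in> B i" "u2 \<in> lists T" "length u2 \<le> ?n"
      "rewr G S l (D * 4 ^ k) w2 (conj_words ((M + 1) * ?n) y2 I @ u2)"
      using Suc.IH[OF lists(2) len(2)] by blast
    obtain x where x: "\<forall>i\<in>set I. x i \<in> B i"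
      "qrewr D0 ?n ((conj_words ((M + 1) * ?n) y1 I @ u1) @ (conj_words ((M + 1) * ?n) y2 I @ u2))
         (conj_words ((M + 1) * (2 * ?n)) x I @ (u1 @ u2))"
      using D0[OF _ nf1(1)[rule_format] nf2(1)[rule_format] nf1(2) nf2(2) nf1(3)] by auto
    have "rewr G S l (D * 4 ^ k + D * 4 ^ k) w
        ((conj_words ((M + 1) * ?n) y1 I @ u1) @ (conj_words ((M + 1) * ?n) y2 I @ u2))"
      unfolding w by (rule rewr_append[OF nf1(4) nf2(4)])
    also note x(2)[unfolded qrewr_def]
    finally have "rewr G S l (D * 4 ^ k + D * 4 ^ k + D0 * ?n\<^sup>2) w
        (conj_words ((M + 1) * 2 ^ Suc k) x I @ (u1 @ u2))" unfolding power_Suc .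
    moreover have "D * 4 ^ k + D * 4 ^ k + D0 * ?n\<^sup>2 \<le> D * 4 ^ Suc k"
    proof -
      have sq: "?n\<^sup>2 = 4 ^ k" by (simp add: power2_eq_square power_mult_distrib[symmetric])
      have "D0 * 4 ^ k \<le> D * 4 ^ k" by (intro mult_le_mono1) (simp add: D_def)
      moreover have "D * 4 ^ Suc k = 4 * (D * 4 ^ k)" by (simp only: power_Suc mult.left_commute)
      ultimately show ?thesis unfolding sq by linarith
    qed
    ultimately have "rewr G S l (D * 4 ^ Suc k) w (conj_words ((M + 1) * 2 ^ Suc k) x I @ (u1 @ u2))"
      by (rule rewr_mono)
    moreover have "u1 @ u2 \<in> lists T" "length (u1 @ u2) \<le> 2 ^ Suc k" using nf1 nf2 by simp_all
    ultimately show ?case using x(1) by blast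
  qed
  then show ?thesis unfolding normal_form_cost_def by blast
qed

text \<open>The layers of the conjugation are peeled off from inside, each of them injective and
  preserving \<open>V\<close>. This allows the conclusion from a trivial factor of a normal form to
  a trivial ball element.\<close>

lemma conj_word_mem:
  assumes V: "\<And>a x. \<lbrakk>a \<in> T; x \<in> V\<rbrakk> \<Longrightarrow> a \<otimes> x \<otimes> inv a \<in> V"
    and t: "t \<in> T" and x: "x \<in> V" "x \<in> carrier G"
  shows "list_prod G (conj_word t e x) \<in> V \<and> (list_prod G (conj_word t e x) = \<one> \<longrightarrow> x = \<one>)"
  using x
proof (induction e arbitrary: x)
  case 0
  then show ?case by (simp add: conj_word_def)
next
  case (Suc e)
  have tc: "t \<in> carrier G" "inv t \<in> T" using t T S by auto
  let ?x = "inv t \<otimes> x \<otimes> t"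
  have x': "?x \<in> V" "?x \<in> carrier G" using V[OF tc(2) Suc.prems(1)] tc Suc.prems by auto
  have R: "replicate e (inv t) \<in> lists (carrier G)" "replicate e t \<in> lists (carrier G)" using tc by auto
  have "conj_word t (Suc e) x = replicate e (inv t) @ [inv t, x, t] @ replicate e t"
    by (simp add: conj_word_def replicate_app_Cons_same)
  then have eq: "list_prod G (conj_word t (Suc e) x) = list_prod G (conj_word t e ?x)"
    using R tc Suc.prems(2) by (simp add: conj_word_def list_prod_append m_assoc)
  have "x = \<one>" if "?x = \<one>"
  proof -
    have "t \<otimes> ?x \<otimes> inv t = (t \<otimes> inv t) \<otimes> x \<otimes> (t \<otimes> inv t)"
      using tc Suc.prems(2) by (simp only: m_assoc m_closed inv_closed)
    then have "t \<otimes> ?x \<otimes> inv t = x" using tc Suc.prems(2) by simp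
    then show ?thesis unfolding that using tc by simp
  qed
  then show ?case using Suc.IH[OF x'] unfolding eq by blast
qed

text \<open>If the word is trivial, \<open>indep\<close> makes every factor of its normal form and
  the part in A trivial. The factors cancel at a cost linear in the exponent, and the part in A is
  filled by \<open>fill\<close>.\<close>

theorem quadratic_filling:
  fixes V :: "'i \<Rightarrow> 'a set"
  assumes V: "\<And>i. i \<in> set I \<Longrightarrow> B i \<subseteq> V i"
      "\<And>i a x. \<lbrakk>i \<in> set I; a \<in> T; x \<in> V i\<rbrakk> \<Longrightarrow> a \<otimes> x \<otimes> inv a \<in> V i"
    and indep: "\<And>z a. \<lbrakk>\<And>i. i \<in> set I \<Longrightarrow> z i \<in> V i; a \<in> H; list_prod G (map z I) \<otimes> a = \<one>\<rbrakk> \<Longrightarrow>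
      a = \<one> \<and> (\<forall>i\<in>set I. z i = \<one>)"
  shows "\<exists>C. \<forall>w\<in>lists S. list_prod G w = \<one> \<longrightarrow> rewr G S l (C * (length w + 1)\<^sup>2) w []"
proof -
  obtain D where "normal_form_cost D" using normal_form_cost_exists by blast
  note D = this[unfolded normal_form_cost_def, rule_format]
  define C where "C = D + length I * (M + 2) + 4 * Q"
  have "rewr G S l (C * 4 ^ k) w []" if w: "w \<in> lists S" "list_prod G w = \<one>" "length w \<le> 2 ^ k" for w k
  proof -
    let ?e = "(M + 1) * 2 ^ k"
    obtain y u where nf: "\<forall>i\<in>set I. y i \<in> B i" "u \<in> lists T" "length u \<le> 2 ^ k"
      "rewr G S l (D * 4 ^ k) w (conj_words ?e y I @ u)"
      using D[OF w(1,3)] by blast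
    define z where "z = (\<lambda>i. list_prod G (conj_word (\<tau> i) ?e (y i)))"
    have y: "y i \<in> V i" "y i \<in> carrier G" if "i \<in> set I" for i using nf(1) V(1) in_B that by auto
    have z: "z i \<in> V i" "z i = \<one> \<Longrightarrow> y i = \<one>" if "i \<in> set I" for i
      using conj_word_mem[OF V(2)[OF that] \<tau>_mem(1)[OF that] y[OF that], of ?e] by (simp_all add: z_def)
    have "list_prod G (conj_words ?e y J) = list_prod G (map z J)" if "set J \<subseteq> set I" for J
      using that
    proof (induction J)
      case (Cons i J)
      then have i: "i \<in> set I" by auto
      have "conj_word (\<tau> i) ?e (y i) \<in> lists (carrier G)" "conj_words ?e y J \<in> lists (carrier G)"
        using Cons nf(1) \<tau>_mem(2)[OF i] in_B[OF i]
        by (intro lists_S conj_word_in_lists conj_words_in_lists; auto)+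
      then show ?case using Cons by (simp add: list_prod_append z_def)
    qed simp
    then have prod: "list_prod G (conj_words ?e y I) = list_prod G (map z I)" by simp
    have cS: "conj_words ?e y I \<in> lists S" using nf(1) by (intro conj_words_in_lists) auto
    have "list_prod G (map z I) \<otimes> list_prod G u = \<one>"
      using rewr_list_prod[OF nf(4) is_group S(1)] w(2) lists_S[OF cS] lists_T(2)[OF nf(2)] prod
      by (simp add: list_prod_append)
    from indep[OF z(1) list_prod_in_H[OF nf(2)] this]
    have u1: "list_prod G u = \<one>" and y1: "\<And>i. i \<in> set I \<Longrightarrow> y i = \<one>" using z(2) by auto
    have uS: "u \<in> lists S" using lists_T nf(2) by blast
    have "rewr G S l (length I * (?e + 1)) (conj_words ?e y I) []"
      using y1 by (intro conj_words_trivial) auto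
    from rewr_congr_right[OF this uS]
    have "rewr G S l (length I * (?e + 1)) (conj_words ?e y I @ u) u" by simp
    also have "rewr G S l (Q * (2 ^ k + 1)\<^sup>2) u []"
      using nf u1 by (intro fill) auto
    finally have "rewr G S l (length I * (?e + 1) + Q * (2 ^ k + 1)\<^sup>2) (conj_words ?e y I @ u) []" .
    with nf(4) have "rewr G S l (D * 4 ^ k + (length I * (?e + 1) + Q * (2 ^ k + 1)\<^sup>2)) w []"
      by (rule rewr_trans')
    moreover have "D * 4 ^ k + (length I * (?e + 1) + Q * (2 ^ k + 1)\<^sup>2) \<le> C * 4 ^ k"
    proof -
      have four: "(4::nat) ^ k = (2 ^ k)\<^sup>2" by (simp add: power2_eq_square power_mult_distrib[symmetric])
      have "?e + 1 \<le> (M + 2) * 2 ^ k" by (simp add: algebra_simps)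
      also have "\<dots> \<le> (M + 2) * 4 ^ k" by (intro mult_le_mono2 power_mono) auto
      finally have 1: "length I * (?e + 1) \<le> length I * (M + 2) * 4 ^ k"
        using mult_le_mono2[of "?e + 1" "(M + 2) * 4 ^ k" "length I"] by (simp only: mult.assoc)
      have "(2 ^ k + 1)\<^sup>2 \<le> (2 * 2 ^ k :: nat)\<^sup>2" by (intro power_mono) auto
      also have "\<dots> = 4 * 4 ^ k" unfolding four power_mult_distrib by (simp only: power2_eq_square)
      finally have "Q * (2 ^ k + 1)\<^sup>2 \<le> Q * (4 * 4 ^ k)" by (rule mult_le_mono2)
      then have "Q * (2 ^ k + 1)\<^sup>2 \<le> 4 * Q * 4 ^ k" by (simp only: mult_ac)
      with 1 show ?thesis unfolding C_def add_mult_distrib by linarith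
    qed
    ultimately show ?thesis by (rule rewr_mono)
  qed
  note fills = this
  have "rewr G S l ((4 * C) * (length w + 1)\<^sup>2) w []" if w: "w \<in> lists S" "list_prod G w = \<one>" for w
  proof -
    \<comment> \<open>Rounding \<open>length w + 1\<close> up to a power of two at most doubles it,
      which costs a factor four.\<close>
    have "\<exists>j. 2 ^ j \<le> length w + 1 \<and> length w + 1 < 2 ^ (j + 1)"
      by (rule ex_power_ivl1) simp_all
    then obtain j where j: "2 ^ j \<le> length w + 1" "length w + 1 < 2 ^ (j + 1)"
      by blast
    then have k: "length w \<le> 2 ^ Suc j" by simp
    have "(4::nat) ^ Suc j = (2 * 2 ^ j)\<^sup>2"
      by (simp add: power2_eq_square power_mult_distrib[symmetric])
    also have "\<dots> \<le> (2 * (length w + 1))\<^sup>2" using j(1) by (intro power_mono mult_le_mono2) simp_all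
    also have "\<dots> = 4 * (length w + 1)\<^sup>2" by (simp only: power_mult_distrib) simp
    finally have "C * 4 ^ Suc j \<le> C * (4 * (length w + 1)\<^sup>2)" by (rule mult_le_mono2)
    also have "\<dots> = (4 * C) * (length w + 1)\<^sup>2" by (simp only: mult_ac)
    finally have "C * 4 ^ Suc j \<le> (4 * C) * (length w + 1)\<^sup>2" .
    with fills[OF w k] show ?thesis by (rule rewr_mono)
  qed
  then show ?thesis by blast
qed

end

section \<open>Free group words and area\<close>

lemma free_eq_congr: "free_eq u v \<Longrightarrow> free_eq (a @ u @ b) (a @ v @ b)"
proof (induction rule: free_eq.induct)
  case (cancel u s c v)
  show ?case using free_eq.cancel[of "a @ u" s c "v @ b"] by simp
qed (auto intro: free_eq.intros)

lemma free_eq_append: "\<lbrakk>free_eq u u'; free_eq v v'\<rbrakk> \<Longrightarrow> free_eq (u @ v) (u' @ v')"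
  using free_eq_congr[of u u' "[]" v] free_eq_congr[of v v' u' "[]"] free_eq.trans by fastforce

lemma word_inv_append [simp]: "word_inv (u @ v) = word_inv v @ word_inv u"
  and word_inv_Nil [simp]: "word_inv [] = []"
  and length_word_inv [simp]: "length (word_inv u) = length u"
  by (simp_all add: word_inv_def)

lemma word_inv_Cons: "word_inv (x # w) = word_inv w @ [(fst x, \<not> snd x)]"
  by (cases x) (simp add: word_inv_def)

lemma word_inv_words [simp]: "w \<in> words S \<Longrightarrow> word_inv w \<in> words S"
  by (auto simp: word_inv_def words_def)

lemma free_eq_cancel: "free_eq (u @ w @ word_inv w @ v) (u @ v)"
proof (induction w arbitrary: u v)
  case Nil
  show ?case by (simp add: free_eq.refl)
next
  case (Cons x w)
  obtain s b where x: "x = (s, b)" by (cases x)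
  have "free_eq ((u @ [x]) @ w @ word_inv w @ ([(s, \<not> b)] @ v)) ((u @ [x]) @ [(s, \<not> b)] @ v)"
    by (rule Cons.IH)
  moreover have "free_eq ((u @ [x]) @ [(s, \<not> b)] @ v) (u @ v)"
    using free_eq.cancel[of u s b v] by (simp add: x)
  ultimately show ?case using free_eq.trans by (fastforce simp: word_inv_Cons x)
qed

lemma word_inv_inv [simp]: "word_inv (word_inv w) = w"
  by (induction w) (auto simp: word_inv_Cons)

lemma free_eq_cancel': "free_eq (u @ word_inv w @ w @ v) (u @ v)"
  using free_eq_cancel[of u "word_inv w" v] by simp

lemma product_of_conjugates_append:
  assumes "product_of_conjugates S R m u" "product_of_conjugates S R n v"
  shows "product_of_conjugates S R (m + n) (u @ v)"
proof -
  obtain cs ds where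
    "length cs \<le> m" "set cs \<subseteq> words S \<times> R" "free_eq u (concat (map (\<lambda>(u, r). u @ r @ word_inv u) cs))"
    "length ds \<le> n" "set ds \<subseteq> words S \<times> R" "free_eq v (concat (map (\<lambda>(u, r). u @ r @ word_inv u) ds))"
    using assms unfolding product_of_conjugates_def by blast
  then show ?thesis unfolding product_of_conjugates_def
    by (intro exI[of _ "cs @ ds"]) (auto intro: free_eq_append)
qed

lemma product_of_conjugates_free_eq:
  "\<lbrakk>free_eq w w'; product_of_conjugates S R m w'\<rbrakk> \<Longrightarrow> product_of_conjugates S R m w"
  unfolding product_of_conjugates_def using free_eq.trans by blast

lemma product_of_conjugates_mono:
  "\<lbrakk>product_of_conjugates S R m w; m \<le> n; R \<subseteq> R'\<rbrakk> \<Longrightarrow> product_of_conjugates S R' n w"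
  unfolding product_of_conjugates_def by (meson Sigma_mono le_trans order_refl subset_trans)

lemma product_of_conjugates_Nil: "product_of_conjugates S R m []"
  unfolding product_of_conjugates_def by (intro exI[of _ "[]"]) (auto intro: free_eq.refl)

lemma product_of_conjugates_conj:
  assumes "product_of_conjugates S R m w" "a \<in> words S"
  shows "product_of_conjugates S R m (a @ w @ word_inv a)"
proof -
  obtain cs where cs: "length cs \<le> m" "set cs \<subseteq> words S \<times> R"
    "free_eq w (concat (map (\<lambda>(u, r). u @ r @ word_inv u) cs))"
    using assms unfolding product_of_conjugates_def by blast
  let ?ds = "map (\<lambda>(u, r). (a @ u, r)) cs"
  have "free_eq (a @ concat (map (\<lambda>(u, r). u @ r @ word_inv u) cs) @ word_inv a)
      (concat (map (\<lambda>(u, r). u @ r @ word_inv u) ?ds))"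
  proof (induction cs)
    case Nil
    show ?case using free_eq_cancel[of "[]" a "[]"] by simp
  next
    case (Cons c cs)
    obtain u r where c: "c = (u, r)" by (cases c)
    let ?x = "concat (map (\<lambda>(u, r). u @ r @ word_inv u) cs)"
    have "free_eq ((a @ u @ r @ word_inv u) @ (?x @ word_inv a))
        ((a @ u @ r @ word_inv u) @ word_inv a @ a @ (?x @ word_inv a))"
      by (rule free_eq.sym[OF free_eq_cancel'])
    moreover have "free_eq ((a @ u @ r @ word_inv u @ word_inv a) @ (a @ ?x @ word_inv a))
        ((a @ u @ r @ word_inv u @ word_inv a) @
          concat (map (\<lambda>(u, r). u @ r @ word_inv u) (map (\<lambda>(u, r). (a @ u, r)) cs)))"
      using Cons.IH by (intro free_eq_append free_eq.refl)
    ultimately show ?case using free_eq.trans by (fastforce simp: c)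
  qed
  moreover have "free_eq (a @ w @ word_inv a) (a @ concat (map (\<lambda>(u, r). u @ r @ word_inv u) cs) @ word_inv a)"
    using cs(3) by (rule free_eq_congr)
  ultimately have "free_eq (a @ w @ word_inv a) (concat (map (\<lambda>(u, r). u @ r @ word_inv u) ?ds))"
    using free_eq.trans by blast
  moreover have "set ?ds \<subseteq> words S \<times> R" 
    using cs(2) assms(2) by (fastforce simp: words_def)
  ultimately show ?thesis unfolding product_of_conjugates_def
    using cs(1) by (intro exI[of _ ?ds]) simp
qed

text \<open>The counterpart of \<open>rewr\<close> for formal words: the area of the quotient of
  \<open>u\<close> and \<open>v\<close> with respect to the relators \<open>R\<close>.\<close>

definition word_area_le :: "'g set \<Rightarrow> 'g word set \<Rightarrow> nat \<Rightarrow> 'g word \<Rightarrow> 'g word \<Rightarrow> bool" where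
  "word_area_le S R c u v \<longleftrightarrow> product_of_conjugates S R c (u @ word_inv v)"

lemma word_area_le_refl: "word_area_le S R c u u"
  unfolding word_area_le_def
  using product_of_conjugates_free_eq[of "u @ word_inv u" "[]"] free_eq_cancel[of "[]" u "[]"]
    product_of_conjugates_Nil by (metis append_Nil append_Nil2)

lemma word_area_le_trans:
  assumes "word_area_le S R c u v" "word_area_le S R c' v w"
  shows "word_area_le S R (c + c') u w"
proof -
  have "product_of_conjugates S R (c + c') ((u @ word_inv v) @ (v @ word_inv w))"
    using assms unfolding word_area_le_def by (rule product_of_conjugates_append)
  moreover have "free_eq (u @ word_inv w) ((u @ word_inv v) @ (v @ word_inv w))"
    using free_eq.sym[OF free_eq_cancel'[of u v "word_inv w"]] by simp
  ultimately show ?thesis unfolding word_area_le_def using product_of_conjugates_free_eq by blast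
qed

text \<open>In the quotient the common suffix cancels freely, while the common prefix joins the
  conjugators and therefore has to be a word over \<open>S\<close>.\<close>

lemma word_area_le_congr:
  assumes "word_area_le S R c u v" "a \<in> words S"
  shows "word_area_le S R c (a @ u @ b) (a @ v @ b)"
proof -
  have "product_of_conjugates S R c (a @ (u @ word_inv v) @ word_inv a)"
    using assms unfolding word_area_le_def by (intro product_of_conjugates_conj)
  moreover have "free_eq ((a @ u @ b) @ word_inv (a @ v @ b)) (a @ (u @ word_inv v) @ word_inv a)"
    using free_eq_cancel[of "a @ u" b "word_inv v @ word_inv a"] by simp
  ultimately show ?thesis unfolding word_area_le_def using product_of_conjugates_free_eq by blast
qed

lemma word_area_le_base:
  assumes "u @ word_inv v \<in> R"
  shows "word_area_le S R 1 u v"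
  unfolding word_area_le_def product_of_conjugates_def
  using assms by (intro exI[of _ "[([], u @ word_inv v)]"]) (auto simp: words_def intro: free_eq.refl)

section \<open>Evaluation of words and change of generators\<close>

context group
begin

lemma word_eval_Nil [simp]: "word_eval G [] = \<one>"
  and word_eval_Cons [simp]: "word_eval G (x # w) = letter_eval G x \<otimes> word_eval G w"
  by (simp_all add: word_eval_def)

lemma letter_eval_closed: "fst x \<in> carrier G \<Longrightarrow> letter_eval G x \<in> carrier G"
  by (simp add: letter_eval_def)

lemma word_eval_closed: "\<lbrakk>w \<in> words S; S \<subseteq> carrier G\<rbrakk> \<Longrightarrow> word_eval G w \<in> carrier G"
  by (induction w) (auto simp: words_def intro!: m_closed letter_eval_closed)

lemma word_eval_append:
  assumes "u \<in> words S" "v \<in> words S" "S \<subseteq> carrier G"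
  shows "word_eval G (u @ v) = word_eval G u \<otimes> word_eval G v"
  using assms(1)
proof (induction u)
  case Nil
  then show ?case using word_eval_closed[OF assms(2,3)] by simp
next
  case (Cons x u)
  then have "u \<in> words S" "fst x \<in> carrier G" using assms(3) by (auto simp: words_def)
  with Cons show ?case
    using word_eval_closed[OF _ assms(3)] letter_eval_closed[of x] assms(2) by (simp add: m_assoc)
qed

lemma word_eval_word_inv:
  assumes "u \<in> words S" "S \<subseteq> carrier G"
  shows "word_eval G (word_inv u) = inv (word_eval G u)"
  using assms(1)
proof (induction u)
  case (Cons x u)
  then have x: "u \<in> words S" "fst x \<in> S" "fst x \<in> carrier G" using assms(2) by (auto simp: words_def)
  then have "[(fst x, \<not> snd x)] \<in> words S" by (simp add: words_def)
  moreover have "letter_eval G (fst x, \<not> snd x) = inv (letter_eval G x)"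
    using x by (simp add: letter_eval_def)
  ultimately show ?case
    using Cons x word_eval_closed[OF x(1) assms(2)] letter_eval_closed[of x]
    by (simp add: word_inv_Cons word_eval_append[OF _ _ assms(2)] inv_mult_group)
qed simp

lemma word_eval_map_pos: "word_eval G (map (\<lambda>s. (s, True)) w) = list_prod G w"
  by (induction w) (auto simp: letter_eval_def)

text \<open>One length bound serves all of \<open>S'\<close>, which for infinite sets is stronger
  than generation. In both directions it makes the two word lengths comparable.\<close>

definition boundedly_generates :: "'a set \<Rightarrow> 'a set \<Rightarrow> bool" where
  "boundedly_generates S S' \<longleftrightarrow>
     (\<exists>L. \<forall>s\<in>S'. \<exists>w\<in>lists S. length w \<le> L \<and> list_prod G w = s)"

definition polynomially_filled :: "nat \<Rightarrow> 'a set \<Rightarrow> bool" where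
  "polynomially_filled p S \<longleftrightarrow>
     (\<exists>l C. \<forall>w\<in>lists S. list_prod G w = \<one> \<longrightarrow> rewr G S l (C * (length w + 1) ^ p) w [])"

lemma substitute_words:
  assumes S: "S \<subseteq> carrier G"
    and \<sigma>: "\<And>s. s \<in> S0 \<Longrightarrow> \<sigma> s \<in> words S" "\<And>s. s \<in> S0 \<Longrightarrow> length (\<sigma> s) \<le> L"
      "\<And>s. s \<in> S0 \<Longrightarrow> word_eval G (\<sigma> s) = s"
    and "w \<in> lists S0"
  shows "concat (map \<sigma> w) \<in> words S" "length (concat (map \<sigma> w)) \<le> L * length w"
    "word_eval G (concat (map \<sigma> w)) = list_prod G w"
proof -
  let ?\<Sigma> = "\<lambda>w. concat (map \<sigma> w)"
  have "?\<Sigma> w \<in> words S \<and> length (?\<Sigma> w) \<le> L * length w \<and> word_eval G (?\<Sigma> w) = list_prod G w"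
    using assms(5)
  proof (induction w)
    case (Cons s w)
    then have s: "s \<in> S0" and IH: "?\<Sigma> w \<in> words S" "length (?\<Sigma> w) \<le> L * length w"
      "word_eval G (?\<Sigma> w) = list_prod G w" by auto
    have "word_eval G (\<sigma> s @ ?\<Sigma> w) = s \<otimes> list_prod G w"
      using word_eval_append[OF \<sigma>(1)[OF s] IH(1) S] \<sigma>(3)[OF s] IH(3) by simp
    moreover have "\<sigma> s @ ?\<Sigma> w \<in> words S" using \<sigma>(1)[OF s] IH(1) by (simp add: words_def)
    ultimately show ?case using \<sigma>(2)[OF s] IH(2) by simp
  qed (simp add: words_def)
  then show "?\<Sigma> w \<in> words S" "length (?\<Sigma> w) \<le> L * length w" "word_eval G (?\<Sigma> w) = list_prod G w"
    by auto
qed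

text \<open>Substituting words for letters turns the exchange of \<open>r\<close> for
  \<open>r'\<close> into one relator, the image of \<open>r\<close> followed by the formal inverse
  of the image of \<open>r'\<close>. Its length is at most 2 L l.\<close>

lemma rewr_imp_word_area_le:
  assumes S: "S \<subseteq> carrier G" "S0 \<subseteq> carrier G"
    and \<sigma>: "\<And>s. s \<in> S0 \<Longrightarrow> \<sigma> s \<in> words S" "\<And>s. s \<in> S0 \<Longrightarrow> length (\<sigma> s) \<le> L"
      "\<And>s. s \<in> S0 \<Longrightarrow> word_eval G (\<sigma> s) = s"
    and "rewr G S0 l c u v" and l': "2 * L * l \<le> l'"
  shows "word_area_le S {r \<in> relations G S. length r \<le> l'} c (concat (map \<sigma> u)) (concat (map \<sigma> v))"
  using assms(6)
proof (induction rule: rewr.induct)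
  case (rewr_refl w c)
  show ?case by (rule word_area_le_refl)
next
  case (rewr_step c u a r b r')
  let ?R = "{r \<in> relations G S. length r \<le> l'}"
  let ?\<Sigma> = "\<lambda>w. concat (map \<sigma> w)"
  have in_lists: "a \<in> lists S0" "r \<in> lists S0" "r' \<in> lists S0"
    using rewr_in_lists[OF rewr_step(1)] rewr_step by auto
  have \<Sigma>: "?\<Sigma> w \<in> words S" "length (?\<Sigma> w) \<le> L * length w" "word_eval G (?\<Sigma> w) = list_prod G w"
    if "w \<in> lists S0" for w
    using substitute_words[of S S0 \<sigma> L w] S(1) \<sigma> that by blast+
  note \<Sigma>r = \<Sigma>[OF in_lists(2)] and \<Sigma>r' = \<Sigma>[OF in_lists(3)]
  have "?\<Sigma> r @ word_inv (?\<Sigma> r') \<in> words S" using \<Sigma>r(1) word_inv_words[OF \<Sigma>r'(1)] by (simp add: words_def)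
  moreover have "word_eval G (?\<Sigma> r @ word_inv (?\<Sigma> r')) = \<one>"
    using \<Sigma>r \<Sigma>r' rewr_step(5) word_eval_closed[OF \<Sigma>r'(1) S(1)]
    by (simp add: word_eval_append[OF _ _ S(1)] word_eval_word_inv[OF _ S(1)])
  moreover have "length (?\<Sigma> r @ word_inv (?\<Sigma> r')) \<le> l'"
  proof -
    have "L * length r \<le> L * l" "L * length r' \<le> L * l"
      using rewr_step by (auto intro!: mult_le_mono2)
    then have "length (?\<Sigma> r) + length (?\<Sigma> r') \<le> 2 * (L * l)"
      using \<Sigma>r(2) \<Sigma>r'(2) by linarith
    then show ?thesis using l' by (simp add: mult.assoc)
  qed
  ultimately have "word_area_le S ?R 1 (?\<Sigma> r) (?\<Sigma> r')"
    by (intro word_area_le_base) (simp add: relations_def)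
  then have "word_area_le S ?R 1 (?\<Sigma> a @ ?\<Sigma> r @ ?\<Sigma> b) (?\<Sigma> a @ ?\<Sigma> r' @ ?\<Sigma> b)"
    using \<Sigma>(1)[OF in_lists(1)] by (rule word_area_le_congr)
  from word_area_le_trans[OF rewr_step.IH[simplified] this] show ?case by simp
qed

text \<open>As in a Tietze transformation, a relation over \<open>S\<close> is translated to
  \<open>S0\<close>, filled there, and the filling is translated back. Translating there and back
  changes each letter by one short relator. Formal inverse letters are covered too, since by
  symmetry their values lie in \<open>S\<close>.\<close>

theorem area_bound_transfer:
  assumes S: "S \<subseteq> carrier G" "\<And>s. s \<in> S \<Longrightarrow> inv s \<in> S" and S0: "S0 \<subseteq> carrier G"
    and gen: "boundedly_generates S S0" "boundedly_generates S0 S"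
    and filled: "polynomially_filled p S0" and p: "1 \<le> p"
  shows "\<exists>l0 C. \<forall>l\<ge>l0. \<forall>w\<in>relations G S.
    product_of_conjugates S {r \<in> relations G S. length r \<le> l} (C * (length w + 1) ^ p) w"
proof -
  obtain L where L: "\<forall>s\<in>S0. \<exists>w\<in>lists S. length w \<le> L \<and> list_prod G w = s"
    using gen(1) unfolding boundedly_generates_def by blast
  then have "\<forall>s\<in>S0. \<exists>w. w \<in> lists S \<and> length w \<le> L \<and> list_prod G w = s" by blast
  from bchoice[OF this] obtain \<sigma>0 where \<sigma>0:
    "\<And>s. s \<in> S0 \<Longrightarrow> \<sigma>0 s \<in> lists S \<and> length (\<sigma>0 s) \<le> L \<and> list_prod G (\<sigma>0 s) = s" by blast
  define \<sigma> where "\<sigma> = (\<lambda>s. map (\<lambda>s. (s, True)) (\<sigma>0 s))"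
  have \<sigma>: "\<sigma> s \<in> words S" "length (\<sigma> s) \<le> L" "word_eval G (\<sigma> s) = s" if "s \<in> S0" for s
    using \<sigma>0[OF that] by (auto simp: \<sigma>_def words_def word_eval_map_pos)
  obtain L' where L': "\<forall>s\<in>S. \<exists>w\<in>lists S0. length w \<le> L' \<and> list_prod G w = s"
    using gen(2) unfolding boundedly_generates_def by blast
  then have "\<forall>s\<in>S. \<exists>w. w \<in> lists S0 \<and> length w \<le> L' \<and> list_prod G w = s" by blast
  from bchoice[OF this] obtain \<pi> where \<pi>:
    "\<And>s. s \<in> S \<Longrightarrow> \<pi> s \<in> lists S0 \<and> length (\<pi> s) \<le> L' \<and> list_prod G (\<pi> s) = s" by blast
  obtain l1 C where C: "\<And>w. \<lbrakk>w \<in> lists S0; list_prod G w = \<one>\<rbrakk> \<Longrightarrow> rewr G S0 l1 (C * (length w + 1) ^ p) w []"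
    using filled unfolding polynomially_filled_def by blast
  define u where "u = (\<lambda>w. concat (map (\<lambda>x. \<pi> (letter_eval G x)) w))"
  let ?\<Sigma> = "\<lambda>w. concat (map \<sigma> w)"
  \<comment> \<open>The first bound admits the images of relators over \<open>S0\<close>, the second
    the relators comparing a letter with its double translation.\<close>
  define l0 where "l0 = max (2 * L * l1) (1 + L * L')"
  have letter: "letter_eval G x \<in> S" if "fst x \<in> S" for x
    using that S(2) by (simp add: letter_eval_def)
  have u: "u w \<in> lists S0" "length (u w) \<le> L' * length w" "list_prod G (u w) = word_eval G w"
    if "w \<in> words S" for w
  proof -
    have "u w \<in> lists S0 \<and> length (u w) \<le> L' * length w \<and> list_prod G (u w) = word_eval G w"
      using that
    proof (induction w)
      case (Cons x w)
      then have w: "w \<in> words S" and x: "fst x \<in> S" by (auto simp: words_def)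
      note \<pi>x = \<pi>[OF letter[OF x]]
      have carr: "\<pi> (letter_eval G x) \<in> lists (carrier G)" "u w \<in> lists (carrier G)"
        using \<pi>x Cons.IH[OF w] S0 lists_mono[OF S0] by blast+
      have "u (x # w) = \<pi> (letter_eval G x) @ u w" by (simp add: u_def)
      then show ?case using Cons.IH[OF w] \<pi>x list_prod_append[OF carr] by simp
    qed (simp add: u_def)
    then show "u w \<in> lists S0" "length (u w) \<le> L' * length w" "list_prod G (u w) = word_eval G w" by auto
  qed
  have \<Sigma>: "?\<Sigma> w \<in> words S" "length (?\<Sigma> w) \<le> L * length w" "word_eval G (?\<Sigma> w) = list_prod G w"
    if "w \<in> lists S0" for w
    using substitute_words[of S S0 \<sigma> L w] S(1) \<sigma> that by blast+
  have "product_of_conjugates S {r \<in> relations G S. length r \<le> l}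
      ((1 + C * (L' + 1) ^ p) * (length w + 1) ^ p) w" if l: "l \<ge> l0" and w: "w \<in> relations G S" for l w
  proof -
    let ?R = "{r \<in> relations G S. length r \<le> l}"
    have wS: "w \<in> words S" and w1: "word_eval G w = \<one>" using w by (auto simp: relations_def)
    have expand: "word_area_le S ?R (length w) w (?\<Sigma> (u w))" if "w \<in> words S" for w
      using that
    proof (induction w)
      case Nil
      show ?case by (simp add: u_def word_area_le_refl)
    next
      case (Cons x w)
      then have w: "w \<in> words S" and x: "fst x \<in> S" "[x] \<in> words S" by (auto simp: words_def)
      let ?y = "?\<Sigma> (\<pi> (letter_eval G x))"
      note \<pi>x = \<pi>[OF letter[OF x(1)]]
      have y: "?y \<in> words S" "length ?y \<le> L * length (\<pi> (letter_eval G x))"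
        "word_eval G ?y = letter_eval G x"
        using \<Sigma>[of "\<pi> (letter_eval G x)"] \<pi>x by auto
      have xc: "letter_eval G x \<in> carrier G" using x(1) S(1) by (auto intro!: letter_eval_closed)
      have "[x] @ word_inv ?y \<in> words S" using x y(1) word_inv_words[of ?y S] by (simp add: words_def)
      moreover have "word_eval G ([x] @ word_inv ?y) = \<one>"
        using x(2) y xc by (simp only: word_eval_append[OF x(2) word_inv_words[OF y(1)] S(1)]
          word_eval_word_inv[OF y(1) S(1)]) simp
      moreover have "length ([x] @ word_inv ?y) \<le> l"
      proof -
        have "L * length (\<pi> (letter_eval G x)) \<le> L * L'" using \<pi>x by simp
        then have "length ?y \<le> L * L'" using y(2) by linarith
        then show ?thesis using l by (simp add: l0_def)
      qed
      ultimately have "word_area_le S ?R 1 [x] ?y"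
        by (intro word_area_le_base) (simp add: relations_def)
      from word_area_le_congr[OF this, of "[]" w] have 1: "word_area_le S ?R 1 ([x] @ w) (?y @ w)"
        by (simp add: words_def)
      have 2: "word_area_le S ?R (length w) (?y @ w) (?y @ ?\<Sigma> (u w))"
        using word_area_le_congr[OF Cons.IH[OF w] y(1), of "[]"] by simp
      from word_area_le_trans[OF 1 2] show ?case by (simp add: u_def)
    qed
    have "rewr G S0 l1 (C * (length (u w) + 1) ^ p) (u w) []"
      using C u[OF wS] w1 by auto
    then have "rewr G S0 l1 (C * (L' * length w + 1) ^ p) (u w) []"
      by (rule rewr_mono) (use u(2)[OF wS] in \<open>intro mult_le_mono2 power_mono; simp\<close>)
    from rewr_imp_word_area_le[OF S(1) S0 \<sigma> this, of l]
    have "word_area_le S ?R (C * (L' * length w + 1) ^ p) (?\<Sigma> (u w)) []" using l by (simp add: l0_def)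
    from word_area_le_trans[OF expand[OF wS] this]
    have "product_of_conjugates S ?R (length w + C * (L' * length w + 1) ^ p) w"
      by (simp add: word_area_le_def)
    moreover have "length w + C * (L' * length w + 1) ^ p \<le> (1 + C * (L' + 1) ^ p) * (length w + 1) ^ p"
    proof -
      have "length w \<le> (length w + 1) ^ p"
        using self_le_power[of "length w + 1" p] p by simp
      moreover have "(L' * length w + 1) ^ p \<le> ((L' + 1) * (length w + 1)) ^ p"
        by (intro power_mono) auto
      then have "C * (L' * length w + 1) ^ p \<le> C * ((L' + 1) ^ p * (length w + 1) ^ p)"
        by (simp only: power_mult_distrib mult_le_mono2)
      ultimately show ?thesis by (simp only: add_mult_distrib mult_1 mult.assoc add_mono)
    qed
    ultimately show ?thesis by (elim product_of_conjugates_mono) auto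
  qed
  then show ?thesis by blast
qed

end

section \<open>Signed area\<close>

lemma words_append: "u @ v \<in> words S \<longleftrightarrow> u \<in> words S \<and> v \<in> words S"
  by (simp add: words_def)

definition letter_val :: "('g \<Rightarrow> int) \<Rightarrow> 'g \<times> bool \<Rightarrow> int" where
  "letter_val f x = (if snd x then f (fst x) else - f (fst x))"

definition letter_sum :: "('g \<Rightarrow> int) \<Rightarrow> 'g word \<Rightarrow> int" where
  "letter_sum f w = (\<Sum>x\<leftarrow>w. letter_val f x)"

text \<open>The word traces a path in the plane via \<open>(f, g)\<close>; this is twice its signed area, that is, up
  to normalisation the central coordinate of its image in the Heisenberg group.\<close>

fun signed_area :: "('g \<Rightarrow> int) \<Rightarrow> ('g \<Rightarrow> int) \<Rightarrow> 'g word \<Rightarrow> int" where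
  "signed_area f g [] = 0"
| "signed_area f g (x # w) =
     letter_val f x * letter_sum g w - letter_val g x * letter_sum f w + signed_area f g w"

lemma letter_sum_simps [simp]: "letter_sum f [] = 0"
  "letter_sum f (x # w) = letter_val f x + letter_sum f w"
  "letter_sum f (v @ w) = letter_sum f v + letter_sum f w"
  by (simp_all add: letter_sum_def)

lemma signed_area_append: "signed_area f g (v @ w) = signed_area f g v + signed_area f g w +
    letter_sum f v * letter_sum g w - letter_sum g v * letter_sum f w"
  by (induction v) (auto simp: algebra_simps)

lemma letter_sum_power [simp]: "letter_sum f (concat (replicate n w)) = int n * letter_sum f w"
  by (induction n) (auto simp: algebra_simps)

lemma letter_sum_word_inv [simp]: "letter_sum f (word_inv w) = - letter_sum f w"
  by (induction w) (auto simp: word_inv_Cons letter_val_def)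

text \<open>A cancelling pair has letter sums zero and encloses no area. So the signed area is a
  function on the free group.\<close>

lemma free_eq_signed_area: "free_eq v w \<Longrightarrow> signed_area f g v = signed_area f g w"
  by (induction rule: free_eq.induct) (auto simp: signed_area_append letter_val_def algebra_simps)

lemma signed_area_word_inv: "signed_area f g (word_inv w) = - signed_area f g w"
proof -
  have "free_eq (w @ word_inv w) []" using free_eq_cancel[of "[]" w "[]"] by simp
  from free_eq_signed_area[OF this, of f g] show ?thesis by (simp add: signed_area_append)
qed

text \<open>The area of a closed path does not depend on the base point: the cross terms of
  \<open>u\<close> with its inverse cancel, those with \<open>r\<close> vanish.\<close>

lemma signed_area_conjugate:
  assumes "letter_sum f r = 0" "letter_sum g r = 0"
  shows "signed_area f g (u @ r @ word_inv u) = signed_area f g r"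
  using assms by (simp add: signed_area_append signed_area_word_inv)

lemma signed_area_commutator:
  "signed_area f g (u @ v @ word_inv u @ word_inv v) =
     2 * (letter_sum f u * letter_sum g v - letter_sum g u * letter_sum f v)"
  by (simp add: signed_area_append signed_area_word_inv algebra_simps)

lemma signed_area_bound:
  assumes "w \<in> words S" "\<And>s. s \<in> S \<Longrightarrow> \<bar>f s\<bar> \<le> c" "\<And>s. s \<in> S \<Longrightarrow> \<bar>g s\<bar> \<le> c" "0 \<le> c"
  shows "\<bar>signed_area f g w\<bar> \<le> c\<^sup>2 * (int (length w))\<^sup>2"
proof -
  have "\<bar>letter_sum f w\<bar> \<le> c * int (length w) \<and> \<bar>letter_sum g w\<bar> \<le> c * int (length w) \<and>
    \<bar>signed_area f g w\<bar> \<le> c\<^sup>2 * (int (length w))\<^sup>2"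
    using assms(1)
  proof (induction w)
    case (Cons x w)
    let ?n = "int (length w)" and ?f = "letter_val f x" and ?g = "letter_val g x"
    have IH: "\<bar>letter_sum f w\<bar> \<le> c * ?n" "\<bar>letter_sum g w\<bar> \<le> c * ?n"
      "\<bar>signed_area f g w\<bar> \<le> c\<^sup>2 * ?n\<^sup>2" using Cons by (auto simp: words_def)
    have "fst x \<in> S" using Cons by (auto simp: words_def)
    then have x: "\<bar>?f\<bar> \<le> c" "\<bar>?g\<bar> \<le> c" using assms(2,3) by (auto simp: letter_val_def)
    have "\<bar>?f * letter_sum g w\<bar> \<le> c * (c * ?n)" "\<bar>?g * letter_sum f w\<bar> \<le> c * (c * ?n)"
      using mult_mono[OF x(1) IH(2) assms(4) abs_ge_zero] mult_mono[OF x(2) IH(1) assms(4) abs_ge_zero]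
      unfolding abs_mult .
    moreover have "c * (c * ?n) + c * (c * ?n) + c\<^sup>2 * ?n\<^sup>2 \<le> c\<^sup>2 * (int (length (x # w)))\<^sup>2"
      by (simp add: power2_eq_square algebra_simps)
    ultimately have area: "\<bar>signed_area f g (x # w)\<bar> \<le> c\<^sup>2 * (int (length (x # w)))\<^sup>2"
      using IH(3) unfolding signed_area.simps by linarith
    have "c * int (length (x # w)) = c + c * ?n" by (simp add: algebra_simps)
    then have "\<bar>letter_sum f (x # w)\<bar> \<le> c * int (length (x # w))"
      "\<bar>letter_sum g (x # w)\<bar> \<le> c * int (length (x # w))"
      using x IH(1,2) unfolding letter_sum_simps by linarith+
    with area show ?case by blast
  qed simp
  then show ?thesis by simp
qed

context group
begin

lemma letter_sum_eval:
  assumes h: "\<And>x y. \<lbrakk>x \<in> carrier G; y \<in> carrier G\<rbrakk> \<Longrightarrow> h (x \<otimes> y) = h x + (h y :: int)"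
    and "w \<in> words S" "S \<subseteq> carrier G"
  shows "letter_sum h w = h (word_eval G w)"
proof -
  have h1: "h \<one> = 0" using h[of \<one> \<one>] by simp
  have h_inv: "h (inv x) = - h x" if "x \<in> carrier G" for x using h[of x "inv x"] h1 that by simp
  show ?thesis using assms(2)
  proof (induction w)
    case Nil
    then show ?case by (simp add: h1)
  next
    case (Cons x w)
    then have w: "w \<in> words S" "fst x \<in> carrier G" using assms(3) by (auto simp: words_def)
    have "h (word_eval G (x # w)) = h (letter_eval G x) + h (word_eval G w)"
      using h[OF letter_eval_closed[OF w(2)] word_eval_closed[OF w(1) assms(3)]] by simp
    moreover have "h (letter_eval G x) = letter_val h x"
      using h_inv[OF w(2)] by (simp add: letter_eval_def letter_val_def)
    ultimately show ?case using Cons.IH[OF w(1)] by simp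
  qed
qed

text \<open>Relators are closed paths because \<open>f\<close> and \<open>g\<close> are additive, so
  their areas add up without cross terms and are unchanged by conjugation. A letter moves by at most
  \<open>c\<close> in each coordinate, so one relator contributes at most
  \<open>c\<^sup>2 * l\<^sup>2\<close>.\<close>

lemma signed_area_le_area:
  assumes hom: "\<And>x y. \<lbrakk>x \<in> carrier G; y \<in> carrier G\<rbrakk> \<Longrightarrow> f (x \<otimes> y) = f x + f y"
      "\<And>x y. \<lbrakk>x \<in> carrier G; y \<in> carrier G\<rbrakk> \<Longrightarrow> g (x \<otimes> y) = g x + g y"
    and S: "S \<subseteq> carrier G" "\<And>s. s \<in> S \<Longrightarrow> \<bar>f s\<bar> \<le> c" "\<And>s. s \<in> S \<Longrightarrow> \<bar>g s\<bar> \<le> c" "0 \<le> c"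
    and "product_of_conjugates S {r \<in> relations G S. length r \<le> l} m w"
  shows "\<bar>signed_area f g w\<bar> \<le> int m * (c\<^sup>2 * (int l)\<^sup>2)"
proof -
  let ?R = "{r \<in> relations G S. length r \<le> l}" and ?conj = "\<lambda>(u, r). u @ r @ word_inv u"
  obtain cs where cs: "length cs \<le> m" "set cs \<subseteq> words S \<times> ?R"
    "free_eq w (concat (map ?conj cs))"
    using assms(7) unfolding product_of_conjugates_def by blast
  have "letter_sum f (concat (map ?conj cs)) = 0 \<and> letter_sum g (concat (map ?conj cs)) = 0 \<and>
      \<bar>signed_area f g (concat (map ?conj cs))\<bar> \<le> int (length cs) * (c\<^sup>2 * (int l)\<^sup>2)"
    using cs(2)
  proof (induction cs)
    case (Cons a cs)
    obtain u r where a: "a = (u, r)" by (cases a)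
    have r: "r \<in> words S" "word_eval G r = \<one>" "length r \<le> l"
      using Cons.prems by (auto simp: a relations_def)
    have one: "f \<one> = 0" "g \<one> = 0" using hom(1)[of \<one> \<one>] hom(2)[of \<one> \<one>] by auto
    have sums: "letter_sum f r = 0" "letter_sum g r = 0"
      using letter_sum_eval[OF hom(1) r(1) S(1)] letter_sum_eval[OF hom(2) r(1) S(1)] r(2) one by auto
    have "\<bar>signed_area f g r\<bar> \<le> c\<^sup>2 * (int (length r))\<^sup>2" using signed_area_bound[OF r(1) S(2,3,4)] .
    moreover have "c\<^sup>2 * (int (length r))\<^sup>2 \<le> c\<^sup>2 * (int l)\<^sup>2"
      using r(3) by (intro mult_left_mono power_mono) auto
    ultimately have r_area: "\<bar>signed_area f g r\<bar> \<le> c\<^sup>2 * (int l)\<^sup>2" by linarith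
    have IH: "letter_sum f (concat (map ?conj cs)) = 0" "letter_sum g (concat (map ?conj cs)) = 0"
      "\<bar>signed_area f g (concat (map ?conj cs))\<bar> \<le> int (length cs) * (c\<^sup>2 * (int l)\<^sup>2)"
      using Cons by auto
    have "signed_area f g (concat (map ?conj (a # cs))) =
        signed_area f g r + signed_area f g (concat (map ?conj cs))"
      using IH(1,2) signed_area_conjugate[OF sums, of u]
        signed_area_append[of f g "u @ r @ word_inv u" "concat (map ?conj cs)"]
      by (simp add: a)
    moreover have "int (length (a # cs)) * (c\<^sup>2 * (int l)\<^sup>2) = c\<^sup>2 * (int l)\<^sup>2 + int (length cs) * (c\<^sup>2 * (int l)\<^sup>2)"
      by (simp add: algebra_simps)
    ultimately have "\<bar>signed_area f g (concat (map ?conj (a # cs)))\<bar> \<le> int (length (a # cs)) * (c\<^sup>2 * (int l)\<^sup>2)"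
      using r_area IH(3) by linarith
    then show ?case using IH(1,2) sums by (simp add: a)
  qed simp
  then have "\<bar>signed_area f g w\<bar> \<le> int (length cs) * (c\<^sup>2 * (int l)\<^sup>2)"
    using free_eq_signed_area[OF cs(3), of f g] by simp
  moreover have "int (length cs) * (c\<^sup>2 * (int l)\<^sup>2) \<le> int m * (c\<^sup>2 * (int l)\<^sup>2)"
    using cs(1) by (intro mult_right_mono) auto
  ultimately show ?thesis by linarith
qed

lemma word_eval_power:
  "\<lbrakk>w \<in> words S; S \<subseteq> carrier G\<rbrakk> \<Longrightarrow> concat (replicate n w) \<in> words S \<and>
    word_eval G (concat (replicate n w)) = word_eval G w [^] n"
proof (induction n)
  case (Suc n)
  then have "concat (replicate n w) \<in> words S"
    "word_eval G (concat (replicate n w)) = word_eval G w [^] n" by auto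
  with Suc.prems show ?case
    using word_eval_append[of w S "concat (replicate n w)"] word_eval_closed[of w S]
      nat_pow_Suc2[of "word_eval G w" n]
    by (simp add: words_append del: nat_pow_Suc)
qed (simp add: words_def)

lemma commutator_relation:
  assumes S: "S \<subseteq> carrier G" and uv: "u \<in> words S" "v \<in> words S"
    and comm: "word_eval G u \<otimes> word_eval G v = word_eval G v \<otimes> word_eval G u"
  shows "u @ v @ word_inv u @ word_inv v \<in> relations G S"
proof -
  have "word_eval G (u @ v @ word_inv u @ word_inv v) =
      word_eval G u \<otimes> word_eval G v \<otimes> inv (word_eval G v \<otimes> word_eval G u)"
    using uv word_inv_words[OF uv(1)] word_inv_words[OF uv(2)]
      word_eval_closed[OF uv(1) S] word_eval_closed[OF uv(2) S]
    by (simp add: word_eval_append[OF _ _ S] word_eval_word_inv[OF _ S] words_append inv_mult_group m_assoc)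
  also have "\<dots> = \<one>" unfolding comm using word_eval_closed[OF uv(1) S] word_eval_closed[OF uv(2) S]
    by (intro r_inv) simp
  finally show ?thesis using uv word_inv_words[OF uv(1)] word_inv_words[OF uv(2)]
    by (simp add: relations_def words_append)
qed

section \<open>From area estimates to growth classes\<close>

lemma dehn_function_nonneg: "0 \<le> x \<Longrightarrow> 0 \<le> dehn_function G S l x"
proof -
  assume "0 \<le> x"
  moreover have "[] \<in> relations G S" by (simp add: relations_def words_def)
  ultimately have "ereal_of_enat (area G S l []) \<le> dehn_function G S l x"
    unfolding dehn_function_def by (intro Sup_upper) force
  moreover have "0 \<le> ereal_of_enat (area G S l [])" by simp
  ultimately show ?thesis by (rule order.trans[rotated])
qed

lemma dehn_function_upper:
  assumes "\<And>w. w \<in> relations G S \<Longrightarrow>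
      product_of_conjugates S {r \<in> relations G S. length r \<le> l} (C * (length w + 1) ^ p) w"
    and "0 \<le> x"
  shows "dehn_function G S l x \<le> ereal (real C * (x + 1) ^ p)"
  unfolding dehn_function_def
proof (rule Sup_least, clarify)
  fix w assume w: "w \<in> relations G S" "real (length w) \<le> x"
  have "area G S l w \<le> enat (C * (length w + 1) ^ p)"
    unfolding area_def using assms(1)[OF w(1)] by (intro Inf_lower) blast
  then have "ereal_of_enat (area G S l w) \<le> ereal_of_enat (enat (C * (length w + 1) ^ p))"
    by (simp only: ereal_of_enat_le_iff)
  also have "\<dots> = ereal (real C * (real (length w) + 1) ^ p)" by (simp add: add.commute)
  also have "\<dots> \<le> ereal (real C * (x + 1) ^ p)"
    using w(2) by (auto intro!: mult_left_mono power_mono)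
  finally show "ereal_of_enat (area G S l w) \<le> ereal (real C * (x + 1) ^ p)" .
qed

lemma dehn_function_lower:
  assumes "w \<in> relations G S" "real (length w) \<le> x"
    and "\<And>m. product_of_conjugates S {r \<in> relations G S. length r \<le> l} m w \<Longrightarrow> k \<le> m"
  shows "ereal (real k) \<le> dehn_function G S l x"
proof -
  have "enat k \<le> area G S l w" unfolding area_def using assms(3) by (intro Inf_greatest) auto
  then have "ereal_of_enat (enat k) \<le> ereal_of_enat (area G S l w)" by (simp only: ereal_of_enat_le_iff)
  also have "\<dots> \<le> dehn_function G S l x"
    unfolding dehn_function_def using assms by (intro Sup_upper) blast
  finally show ?thesis by simp
qed

text \<open>The estimate of n from above comes from the linear error term in
  \<open>growth_equiv\<close> together with nonnegativity of the Dehn function. The area bound gives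
  the other inequality and makes the values finite, so that the computation takes place in the
  reals.\<close>

lemma growth_equiv_linear:
  assumes "\<And>w. w \<in> relations G S \<Longrightarrow>
      product_of_conjugates S {r \<in> relations G S. length r \<le> l} (C * (length w + 1)) w"
  shows "growth_equiv (dehn_function G S l) (\<lambda>n. ereal n)"
proof -
  let ?u = "dehn_function G S l"
  define c where "c = real C + 1"
  have c: "c > 0" by (simp add: c_def)
  have upper: "?u n \<le> ereal (c * (n + 1))" if "n \<ge> 0" for n
  proof -
    have "?u n \<le> ereal (real C * (n + 1) ^ 1)" using assms that by (intro dehn_function_upper) auto
    also have "\<dots> \<le> ereal (c * (n + 1))" using that by (simp add: c_def algebra_simps)
    finally show ?thesis .
  qed
  have "ereal 1 * ?u (1 * n) - ereal (c * n) - ereal c \<le> ereal n \<and>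
      ereal n \<le> ereal 1 * ?u (1 * n) + ereal (1 * n) + ereal 1" if n: "n \<ge> 0" for n
  proof -
    obtain r where r: "?u n = ereal r" "0 \<le> r" "r \<le> c * (n + 1)"
      using upper[OF n] dehn_function_nonneg[OF n, of S l] by (cases "?u n") auto
    then show ?thesis using n c by (simp add: algebra_simps)
  qed
  note bounds = this
  show ?thesis unfolding growth_equiv_def
    by (rule exI[of _ 1], rule exI[of _ 1], rule exI[of _ c], rule exI[of _ c],
      rule exI[of _ 1], rule exI[of _ 1], rule exI[of _ 1], rule exI[of _ 1])
      (use c bounds zero_less_one in blast)
qed

text \<open>The lower bounds are given for integers \<open>k\<close>, as relations of length at most
  L k and area at least k^2 / D. Rounding n down to \<open>k\<close> costs a factor two and a
  constant, by (k + 1)^2 <= 2 k^2 + 2.\<close>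

lemma growth_equiv_quadratic:
  assumes "\<And>w. w \<in> relations G S \<Longrightarrow>
      product_of_conjugates S {r \<in> relations G S. length r \<le> l} (C * (length w + 1)\<^sup>2) w"
    and D: "0 < D" and lower: "\<And>k. \<exists>w\<in>relations G S. length w \<le> L * k \<and>
      (\<forall>m. product_of_conjugates S {r \<in> relations G S. length r \<le> l} m w \<longrightarrow> k\<^sup>2 \<le> m * D)"
  shows "growth_equiv (dehn_function G S l) (\<lambda>n. ereal (n\<^sup>2))"
proof -
  let ?u = "dehn_function G S l"
  define c where "c = real C + 1"
  define b where "b = real L + 1"
  have c: "1 / (2 * c) > 0" "2 * real D > 0" "b > 0" "2 * real D + 2 > 0" "c > 0"
    using D by (auto simp: c_def b_def)
  have upper: "?u n \<le> ereal (c * (n + 1)\<^sup>2)" if "n \<ge> 0" for n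
  proof -
    have "?u n \<le> ereal (real C * (n + 1) ^ 2)" using assms(1) that by (intro dehn_function_upper) auto
    also have "\<dots> \<le> ereal (c * (n + 1)\<^sup>2)" by (simp add: c_def mult_right_mono)
    finally show ?thesis .
  qed
  have "ereal (1 / (2 * c)) * ?u (1 * n) - ereal (1 * n) - ereal 1 \<le> ereal (n\<^sup>2) \<and>
      ereal (n\<^sup>2) \<le> ereal (2 * real D) * ?u (b * n) + ereal (1 * n) + ereal (2 * real D + 2)"
    if n: "n \<ge> 0" for n
  proof
    obtain r where r: "?u n = ereal r" "0 \<le> r" "r \<le> c * (n + 1)\<^sup>2"
      using upper[OF n] dehn_function_nonneg[OF n, of S l] by (cases "?u n") auto
    have "(n + 1)\<^sup>2 \<le> 2 * n\<^sup>2 + 2"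
      using zero_le_power2[of "n - 1"] by (simp add: power2_eq_square algebra_simps)
    then have "c * (n + 1)\<^sup>2 \<le> c * (2 * n\<^sup>2 + 2)" using c by (intro mult_left_mono) auto
    with r(3) have "r \<le> 2 * c * (n\<^sup>2 + 1)" by (simp add: algebra_simps)
    then have "r / (2 * c) \<le> n\<^sup>2 + 1" using c by (simp add: pos_divide_le_eq mult.commute)
    then show "ereal (1 / (2 * c)) * ?u (1 * n) - ereal (1 * n) - ereal 1 \<le> ereal (n\<^sup>2)"
      using r(1) n by simp
  next
    define k where "k = nat \<lfloor>n\<rfloor>"
    have k: "real k \<le> n" "n \<le> real k + 1" using n by (auto simp: k_def)
    obtain w where w: "w \<in> relations G S" "length w \<le> L * k"
      "\<And>m. product_of_conjugates S {r \<in> relations G S. length r \<le> l} m w \<Longrightarrow> k\<^sup>2 \<le> m * D"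
      using lower[of k] by blast
    have "real (length w) \<le> real L * real k" using w(2) by (metis of_nat_le_iff of_nat_mult)
    also have "\<dots> \<le> b * n" using k(1) by (intro mult_mono) (auto simp: b_def)
    finally have len: "real (length w) \<le> b * n" .
    have "k\<^sup>2 div D \<le> m" if "product_of_conjugates S {r \<in> relations G S. length r \<le> l} m w" for m
      using w(3)[OF that] D by (metis div_le_mono div_mult_self_is_m)
    then have le_u: "ereal (real (k\<^sup>2 div D)) \<le> ?u (b * n)"
      using dehn_function_lower[OF w(1) len] by blast
    have bn: "0 \<le> b * n" using n c by simp
    obtain r where r: "?u (b * n) = ereal r" "real (k\<^sup>2 div D) \<le> r"
      using upper[OF bn] le_u by (cases "?u (b * n)") auto
    have "k\<^sup>2 \<le> D * (k\<^sup>2 div D + 1)"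
      using mult_div_mod_eq[of D "k\<^sup>2"] mod_less_divisor[OF D, of "k\<^sup>2"]
      by (simp only: add_mult_distrib2 mult_1_right)
    then have "real (k\<^sup>2) \<le> real (D * (k\<^sup>2 div D + 1))" by (simp only: of_nat_le_iff)
    also have "\<dots> = real D * (real (k\<^sup>2 div D) + 1)" by (simp add: algebra_simps)
    also have "\<dots> \<le> real D * (r + 1)" using r(2) by (intro mult_left_mono) auto
    finally have k2: "(real k)\<^sup>2 \<le> real D * r + real D" by (simp add: algebra_simps)
    have "n\<^sup>2 \<le> (real k + 1)\<^sup>2" using k n by (intro power_mono) auto
    also have "\<dots> \<le> 2 * (real k)\<^sup>2 + 2"
      using zero_le_power2[of "real k - 1"] by (simp add: power2_eq_square algebra_simps)
    finally have "n\<^sup>2 \<le> 2 * real D * r + 2 * real D + 2" using k2 by simp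
    then show "ereal (n\<^sup>2) \<le> ereal (2 * real D) * ?u (b * n) + ereal (1 * n) + ereal (2 * real D + 2)"
      using r(1) n by simp
  qed
  note bounds = this
  show ?thesis unfolding growth_equiv_def
    by (rule exI[of _ "1 / (2 * c)"], rule exI[of _ 1], rule exI[of _ 1], rule exI[of _ 1],
      rule exI[of _ "2 * real D"], rule exI[of _ b], rule exI[of _ 1],
      rule exI[of _ "2 * real D + 2"])
      (use c bounds zero_less_one in blast)
qed

text \<open>The relations are the commutators of the k-th powers of \<open>u\<close> and
  \<open>v\<close>. Their signed area is 2 k^2 times a determinant, a nonzero integer and hence of
  absolute value at least one. The summand 1 next to \<open>nat (c\<^sup>2) * l\<^sup>2\<close>
  keeps the divisor positive.\<close>

lemma dehn_quadratic_lower_bound: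
  assumes hom: "\<And>x y. \<lbrakk>x \<in> carrier G; y \<in> carrier G\<rbrakk> \<Longrightarrow> f (x \<otimes> y) = f x + (f y :: int)"
      "\<And>x y. \<lbrakk>x \<in> carrier G; y \<in> carrier G\<rbrakk> \<Longrightarrow> g (x \<otimes> y) = g x + (g y :: int)"
    and S: "S \<subseteq> carrier G" "\<And>s. s \<in> S \<Longrightarrow> \<bar>f s\<bar> \<le> c" "\<And>s. s \<in> S \<Longrightarrow> \<bar>g s\<bar> \<le> c" "0 \<le> c"
    and uv: "u \<in> words S" "v \<in> words S" "word_eval G u \<otimes> word_eval G v = word_eval G v \<otimes> word_eval G u"
    and nondeg: "f (word_eval G u) * g (word_eval G v) - g (word_eval G u) * f (word_eval G v) \<noteq> 0"
  shows "\<exists>w\<in>relations G S. length w \<le> (2 * (length u + length v)) * k \<and>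
      (\<forall>m. product_of_conjugates S {r \<in> relations G S. length r \<le> l} m w \<longrightarrow>
        k\<^sup>2 \<le> m * (nat (c\<^sup>2) * l\<^sup>2 + 1))"
proof -
  let ?U = "concat (replicate k u)" and ?V = "concat (replicate k v)"
  let ?w = "?U @ ?V @ word_inv ?U @ word_inv ?V"
  note U = word_eval_power[OF uv(1) S(1), of k] and V = word_eval_power[OF uv(2) S(1), of k]
  have closed: "word_eval G u \<in> carrier G" "word_eval G v \<in> carrier G"
    using word_eval_closed uv S(1) by blast+
  have "word_eval G u [^] k \<otimes> word_eval G v [^] k = word_eval G v [^] k \<otimes> word_eval G u [^] k"
  proof -
    have "word_eval G v \<otimes> word_eval G u [^] k = word_eval G u [^] k \<otimes> word_eval G v"
      using group_commutes_pow[OF uv(3) closed] by simp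
    from group_commutes_pow[OF this] closed show ?thesis by simp
  qed
  then have w: "?w \<in> relations G S" using commutator_relation[OF S(1)] U V by simp
  have len: "length ?w \<le> (2 * (length u + length v)) * k"
    by (simp add: length_concat sum_list_replicate algebra_simps)
  let ?d = "f (word_eval G u) * g (word_eval G v) - g (word_eval G u) * f (word_eval G v)"
  have "signed_area f g ?w = 2 * (int k)\<^sup>2 * ?d"
    using letter_sum_eval[OF hom(1) uv(1) S(1)] letter_sum_eval[OF hom(2) uv(1) S(1)]
      letter_sum_eval[OF hom(1) uv(2) S(1)] letter_sum_eval[OF hom(2) uv(2) S(1)]
    by (simp only: signed_area_commutator letter_sum_power) (simp add: algebra_simps power2_eq_square)
  then have "\<bar>signed_area f g ?w\<bar> = 2 * (int k)\<^sup>2 * \<bar>?d\<bar>" by (simp add: abs_mult)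
  moreover have "(int k)\<^sup>2 * 1 \<le> (int k)\<^sup>2 * \<bar>?d\<bar>" using nondeg by (intro mult_left_mono) auto
  moreover have "0 \<le> (int k)\<^sup>2" by simp
  ultimately have k_le: "(int k)\<^sup>2 \<le> \<bar>signed_area f g ?w\<bar>" by linarith
  have "k\<^sup>2 \<le> m * (nat (c\<^sup>2) * l\<^sup>2 + 1)"
    if "product_of_conjugates S {r \<in> relations G S. length r \<le> l} m ?w" for m
  proof -
    have "\<bar>signed_area f g ?w\<bar> \<le> int m * (c\<^sup>2 * (int l)\<^sup>2)"
      by (rule signed_area_le_area[OF hom S that])
    also have "\<dots> \<le> int m * (c\<^sup>2 * (int l)\<^sup>2 + 1)" by (intro mult_left_mono) auto
    also have "\<dots> = int (m * (nat (c\<^sup>2) * l\<^sup>2 + 1))" by (simp add: algebra_simps)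
    finally have "int (k\<^sup>2) \<le> int (m * (nat (c\<^sup>2) * l\<^sup>2 + 1))" using k_le by simp
    then show ?thesis by (simp only: of_nat_le_iff)
  qed
  with w len show ?thesis by blast
qed

end

section \<open>Finitely generated abelian groups\<close>

text \<open>Monotonicity in \<open>n\<close> lets a maximum over the finite set serve as a common
  bound. Uniform constants for finite sets of letters or coordinates are obtained from it.\<close>

lemma finite_uniform_bound:
  fixes Q :: "'x \<Rightarrow> nat \<Rightarrow> bool"
  assumes "finite Y" "\<And>x. x \<in> Y \<Longrightarrow> \<exists>n. Q x n" "\<And>x m n. \<lbrakk>Q x m; m \<le> n\<rbrakk> \<Longrightarrow> Q x n"
  shows "\<exists>n. \<forall>x\<in>Y. Q x n"
  using assms(1,2)
proof (induction Y rule: finite_induct)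
  case (insert x Y)
  then obtain m where "\<forall>y\<in>Y. Q y m" by auto
  moreover obtain n where "Q x n" using insert.prems[of x] by auto
  ultimately show ?case using assms(3) by (intro exI[of _ "max m n"]) (auto intro: max.cobounded1 max.cobounded2)
qed simp

section \<open>Integral combinations and rank\<close>

context comm_group
begin

definition int_comb :: "'a set \<Rightarrow> ('a \<Rightarrow> int) \<Rightarrow> 'a" where
  "int_comb B c = finprod G (\<lambda>x. x [^] c x) B"

lemma int_comb_closed [simp]: "B \<subseteq> carrier G \<Longrightarrow> int_comb B c \<in> carrier G"
  unfolding int_comb_def by (rule finprod_closed) auto

lemma int_comb_add:
  assumes "B \<subseteq> carrier G"
  shows "int_comb B (\<lambda>x. c x + d x) = int_comb B c \<otimes> int_comb B d"
proof -
  have "int_comb B (\<lambda>x. c x + d x) = finprod G (\<lambda>x. x [^] c x \<otimes> x [^] d x) B"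
    unfolding int_comb_def using assms
    by (intro finprod_cong) (auto simp: int_pow_mult subset_iff simp_implies_def)
  also have "\<dots> = int_comb B c \<otimes> int_comb B d"
    unfolding int_comb_def using assms by (intro finprod_multf) auto
  finally show ?thesis .
qed

lemma int_comb_zero [simp]: "int_comb B (\<lambda>x. 0) = \<one>"
  by (simp add: int_comb_def)

lemma int_comb_neg: "B \<subseteq> carrier G \<Longrightarrow> int_comb B (\<lambda>x. - c x) = inv (int_comb B c)"
  using int_comb_add[of B c "\<lambda>x. - c x"] by (simp add: inv_unique' inv_equality m_comm)

lemma int_comb_cong: "\<lbrakk>B \<subseteq> carrier G; \<And>x. x \<in> B \<Longrightarrow> c x = d x\<rbrakk> \<Longrightarrow> int_comb B c = int_comb B d"
  unfolding int_comb_def by (rule finprod_cong) (auto simp: simp_implies_def)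

lemma int_comb_single:
  assumes "finite B" "B \<subseteq> carrier G" "b \<in> B"
  shows "int_comb B (\<lambda>x. if x = b then k else 0) = b [^] k"
proof -
  have "int_comb B (\<lambda>x. if x = b then k else 0) = (\<Otimes>j\<in>B. if b = j then j [^] k else \<one>)"
    unfolding int_comb_def using assms by (intro finprod_cong) (auto simp: simp_implies_def)
  also have "\<dots> = b [^] k" using assms by (intro finprod_singleton) auto
  finally show ?thesis .
qed

lemma int_comb_pow:
  assumes "finite B" "B \<subseteq> carrier G"
  shows "int_comb B (\<lambda>x. c x * k) = int_comb B c [^] (k :: int)"
  using assms
proof (induction B rule: finite_induct)
  case (insert b B)
  then have b: "b \<in> carrier G" "B \<subseteq> carrier G" by auto
  have "int_comb (insert b B) e = b [^] e b \<otimes> int_comb B e" for e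
    unfolding int_comb_def using insert b by (intro finprod_insert) auto
  then show ?case using insert b by (simp add: int_pow_distrib int_pow_pow)
qed (simp add: int_comb_def)

lemma int_comb_sum:
  assumes "finite J" "B \<subseteq> carrier G"
  shows "int_comb B (\<lambda>x. \<Sum>j\<in>J. c j x) = finprod G (\<lambda>j. int_comb B (c j)) J"
  using assms
proof (induction J rule: finite_induct)
  case (insert j J)
  then show ?case by (simp add: int_comb_add finprod_insert)
qed simp

lemma int_comb_generate:
  assumes "finite Y" "Y \<subseteq> carrier G" "generate G Y = carrier G" "a \<in> carrier G"
  shows "\<exists>c. a = int_comb Y c"
proof -
  have "a \<in> generate G Y" using assms by simp
  then show ?thesis
  proof (induction rule: generate.induct)
    case one
    show ?case using int_comb_zero by metis
  next
    case (incl h)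
    then show ?case using int_comb_single[OF assms(1,2), of h 1] assms(2) by (metis int_pow_1 subsetD)
  next
    case (inv h)
    then have h: "h \<in> carrier G" using assms(2) by blast
    have "inv h = int_comb Y (\<lambda>x. if x = h then -1 else 0)"
      using int_comb_single[OF assms(1,2) inv, of "-1"] h by (simp add: int_pow_neg)
    then show ?case by blast
  next
    case (eng h1 h2)
    then show ?case using int_comb_add[OF assms(2)] by metis
  qed
qed

lemma int_independent_iff:
  "int_independent G B \<longleftrightarrow> finite B \<and> B \<subseteq> carrier G \<and> (\<forall>c. int_comb B c = \<one> \<longrightarrow> (\<forall>x\<in>B. c x = 0))"
  by (simp add: int_independent_def int_comb_def)

lemma int_independent_unique:
  assumes "int_independent G B" "int_comb B c = int_comb B d" "x \<in> B"
  shows "c x = d x"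
proof -
  have B: "B \<subseteq> carrier G" using assms(1) by (simp add: int_independent_iff)
  have "int_comb B (\<lambda>x. c x + - d x) = int_comb B c \<otimes> int_comb B (\<lambda>x. - d x)"
    by (rule int_comb_add[OF B])
  also have "\<dots> = \<one>" using assms(2) B by (simp add: int_comb_neg)
  finally have "c x + - d x = 0" using assms unfolding int_independent_iff by blast
  then show ?thesis by simp
qed

text \<open>Pigeonhole: the \<open>L ^ card B\<close> combinations of \<open>B\<close> with coefficients below \<open>L\<close> are distinct, but
  their coordinates with respect to \<open>Y\<close> lie in a box of side \<open>O(L)\<close>.\<close>

lemma int_independent_card_le:
  assumes Y: "finite Y" "Y \<subseteq> carrier G" "generate G Y = carrier G" and B: "int_independent G B"
  shows "card B \<le> card Y"
proof (rule ccontr)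
  assume less: "\<not> card B \<le> card Y"
  have fB: "finite B" "B \<subseteq> carrier G" using B by (auto simp: int_independent_iff)
  have "\<forall>b\<in>B. \<exists>c. b = int_comb Y c" using int_comb_generate[OF Y] fB by blast
  from bchoice[OF this] obtain m where m: "\<And>b. b \<in> B \<Longrightarrow> b = int_comb Y (m b)" by blast
  \<comment> \<open>Coefficients between 0 and L give coordinates of absolute value at most K L with
    respect to \<open>Y\<close>.\<close>
  define K where "K = (\<Sum>b\<in>B. \<Sum>x\<in>Y. \<bar>m b x\<bar>)"
  define \<Phi> where "\<Phi> = (\<lambda>c. \<lambda>x\<in>Y. \<Sum>b\<in>B. m b x * c b)"
  have comb: "int_comb B c = int_comb Y (\<lambda>x. \<Sum>b\<in>B. m b x * c b)" for c
  proof -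
    have "int_comb Y (\<lambda>x. \<Sum>b\<in>B. m b x * c b) = finprod G (\<lambda>b. int_comb Y (\<lambda>x. m b x * c b)) B"
      by (rule int_comb_sum[OF fB(1) Y(2)])
    also have "\<dots> = int_comb B c" unfolding int_comb_def[of B]
      using fB Y by (intro finprod_cong) (auto simp: simp_implies_def int_comb_pow m[symmetric])
    finally show ?thesis by simp
  qed
  have bound: "int L ^ card B \<le> (2 * K * int L + 1) ^ card Y" for L :: nat
  proof -
    let ?D = "B \<rightarrow>\<^sub>E {0..<int L}" and ?R = "Y \<rightarrow>\<^sub>E {- (K * int L)..K * int L}"
    have "inj_on \<Phi> ?D"
    proof (rule inj_onI)
      fix c d assume cd: "c \<in> ?D" "d \<in> ?D" "\<Phi> c = \<Phi> d"
      have "int_comb B c = int_comb B d"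
        unfolding comb
      proof (rule int_comb_cong[OF Y(2)])
        fix x assume "x \<in> Y"
        then show "(\<Sum>b\<in>B. m b x * c b) = (\<Sum>b\<in>B. m b x * d b)"
          using fun_cong[OF cd(3), of x] by (simp add: \<Phi>_def)
      qed
      then have "c x = d x" if "x \<in> B" for x using int_independent_unique[OF B] that by blast
      then show "c = d" using cd(1,2) by (intro PiE_ext) auto
    qed
    moreover have "\<Phi> ` ?D \<subseteq> ?R"
    proof clarify
      fix c assume c: "c \<in> ?D"
      have "\<bar>\<Sum>b\<in>B. m b x * c b\<bar> \<le> K * int L" if x: "x \<in> Y" for x
      proof -
        have "\<bar>m b x * c b\<bar> \<le> (\<Sum>x\<in>Y. \<bar>m b x\<bar>) * int L" if b: "b \<in> B" for b
        proof -
          have "\<bar>m b x\<bar> \<le> (\<Sum>x\<in>Y. \<bar>m b x\<bar>)" using x Y(1) by (intro member_le_sum) auto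
          moreover have "c b \<in> {0..<int L}" using c b by auto
          then have "\<bar>c b\<bar> \<le> int L" by auto
          moreover have "0 \<le> (\<Sum>x\<in>Y. \<bar>m b x\<bar>)" by (simp add: sum_nonneg)
          ultimately show ?thesis unfolding abs_mult by (rule mult_mono[OF _ _ _ abs_ge_zero])
        qed
        then have "(\<Sum>b\<in>B. \<bar>m b x * c b\<bar>) \<le> (\<Sum>b\<in>B. (\<Sum>x\<in>Y. \<bar>m b x\<bar>) * int L)" by (rule sum_mono)
        moreover have "\<bar>\<Sum>b\<in>B. m b x * c b\<bar> \<le> (\<Sum>b\<in>B. \<bar>m b x * c b\<bar>)" by (rule sum_abs)
        ultimately show ?thesis unfolding K_def sum_distrib_right by linarith
      qed
      then have "(\<Sum>b\<in>B. m b x * c b) \<in> {- (K * int L)..K * int L}" if "x \<in> Y" for x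
        using that by (simp add: abs_le_iff minus_le_iff)
      then show "\<Phi> c \<in> ?R" unfolding \<Phi>_def by (simp add: restrict_PiE_iff)
    qed
    ultimately have "card ?D \<le> card ?R" using Y(1) by (intro card_inj_on_le[of \<Phi>] finite_PiE) auto
    then have "L ^ card B \<le> nat (2 * K * int L + 1) ^ card Y"
      using fB(1) Y(1) by (simp add: card_PiE algebra_simps)
    then have "int (L ^ card B) \<le> int (nat (2 * K * int L + 1) ^ card Y)" by (simp only: of_nat_le_iff)
    moreover have "0 \<le> K" unfolding K_def by (intro sum_nonneg) auto
    ultimately show ?thesis by simp
  qed
  have K: "0 \<le> K" unfolding K_def by (intro sum_nonneg) auto
  \<comment> \<open>Once L exceeds (2 K + 1) ^ card Y, the box is too small even for card Y + 1
    independent elements.\<close>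
  define L where "L = nat ((2 * K + 1) ^ card Y + 1)"
  have L: "int L = (2 * K + 1) ^ card Y + 1" "1 \<le> L"
    using zero_le_power[of "2 * K + 1" "card Y"] K by (simp_all add: L_def le_nat_iff)
  have "int L ^ Suc (card Y) \<le> int L ^ card B" using less L(2) by (intro power_increasing) auto
  also have "\<dots> \<le> (2 * K * int L + 1) ^ card Y" by (rule bound)
  also have "\<dots> \<le> ((2 * K + 1) * int L) ^ card Y"
    using K L(2) by (intro power_mono) (auto simp: algebra_simps)
  finally have "int L * int L ^ card Y \<le> (2 * K + 1) ^ card Y * int L ^ card Y"
    by (simp add: power_mult_distrib)
  then have "int L \<le> (2 * K + 1) ^ card Y" using L(2) by (simp add: mult_le_cancel_right)
  then show False using L(1) by simp
qed

text \<open>Finite generation bounds the size of independent sets, so the set in the definition of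
  \<open>abelian_rank\<close> is finite; it contains 0 because of the empty set. Hence its
  \<open>Max\<close> is attained.\<close>

lemma abelian_rank_props:
  assumes "finitely_generated G"
  shows "\<exists>B. int_independent G B \<and> card B = abelian_rank G"
    and "int_independent G B' \<Longrightarrow> card B' \<le> abelian_rank G"
proof -
  obtain Y where Y: "finite Y" "Y \<subseteq> carrier G" "generate G Y = carrier G"
    using assms unfolding finitely_generated_def by blast
  let ?R = "{card B | B. int_independent G B}"
  have "?R \<subseteq> {..card Y}" using int_independent_card_le[OF Y] by blast
  then have fin: "finite ?R" by (rule finite_subset) simp
  moreover have "int_independent G {}" by (simp add: int_independent_def)
  then have "?R \<noteq> {}" by blast
  ultimately have "abelian_rank G \<in> ?R" unfolding abelian_rank_def by (rule Max_in)
  then show "\<exists>B. int_independent G B \<and> card B = abelian_rank G" by force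
  show "card B' \<le> abelian_rank G" if "int_independent G B'"
    unfolding abelian_rank_def using fin that by (intro Max_ge) auto
qed

text \<open>An independent set of maximal size becomes dependent when \<open>x\<close> is added, and
  in the dependency the exponent of \<open>x\<close> cannot vanish. Its sign is adjusted to make
  \<open>n\<close> positive.\<close>

lemma power_in_int_comb:
  assumes fg: "finitely_generated G" and B: "int_independent G B" "card B = abelian_rank G"
    and x: "x \<in> carrier G"
  shows "\<exists>n>0. \<exists>c. x [^] (n::int) = int_comb B c"
proof (cases "x \<in> B")
  case True
  have fB: "finite B" "B \<subseteq> carrier G" using B by (auto simp: int_independent_iff)
  show ?thesis using int_comb_single[OF fB True, of 1] by (intro exI[of _ 1]) (metis zero_less_one)
next
  case False
  have fB: "finite B" "B \<subseteq> carrier G" using B by (auto simp: int_independent_iff)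
  have "\<not> int_independent G (insert x B)"
    using abelian_rank_props(2)[OF fg, of "insert x B"] B(2) fB False by auto
  then obtain c y where c: "int_comb (insert x B) c = \<one>" "y \<in> insert x B" "c y \<noteq> 0"
    unfolding int_independent_iff using fB x by auto
  have split: "int_comb (insert x B) c = x [^] c x \<otimes> int_comb B c"
    unfolding int_comb_def using fB x False by (intro finprod_insert) auto
  have cx: "c x \<noteq> 0"
  proof
    assume "c x = 0"
    then have "int_comb B c = \<one>" using c(1) split fB x by simp
    then have "\<forall>y\<in>B. c y = 0" using B(1) unfolding int_independent_iff by blast
    with c(2,3) \<open>c x = 0\<close> show False by auto
  qed
  have 1: "x [^] c x = int_comb B (\<lambda>x. - c x)"
    using c(1) split fB x inv_equality[of "x [^] c x" "int_comb B c"] by (simp add: int_comb_neg)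
  show ?thesis
  proof (cases "c x > 0")
    case True
    with 1 show ?thesis by blast
  next
    case False
    then have "- c x > 0" using cx by simp
    moreover have "x [^] (- c x) = int_comb B c"
      using 1 int_comb_neg[OF fB(2), of "\<lambda>x. - c x"] x by (simp add: int_pow_neg)
    ultimately show ?thesis by blast
  qed
qed

text \<open>The product of the exponents belonging to finitely many generators works for all
  elements.\<close>

lemma uniform_power_in_int_comb:
  assumes fg: "finitely_generated G" and B: "int_independent G B" "card B = abelian_rank G"
  shows "\<exists>n>0. \<forall>x\<in>carrier G. \<exists>c. x [^] (n::int) = int_comb B c"
proof -
  obtain Y where Y: "finite Y" "Y \<subseteq> carrier G" "generate G Y = carrier G"
    using fg unfolding finitely_generated_def by blast
  have fB: "finite B" "B \<subseteq> carrier G" using B by (auto simp: int_independent_iff)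
  have "\<forall>x\<in>Y. \<exists>n>0. \<exists>c. x [^] (n::int) = int_comb B c"
    using power_in_int_comb[OF fg B] Y(2) by blast
  from bchoice[OF this] obtain n where n: "\<And>x. x \<in> Y \<Longrightarrow> 0 < n x"
    "\<And>x. x \<in> Y \<Longrightarrow> \<exists>c. x [^] (n x :: int) = int_comb B c" by blast
  define N where "N = (\<Prod>x\<in>Y. n x)"
  have "N > 0" unfolding N_def using n by (intro prod_pos) auto
  moreover have "\<exists>c. x [^] N = int_comb B c" if "x \<in> carrier G" for x
  proof -
    have "x \<in> generate G Y" using that Y by simp
    then show ?thesis
    proof (induction rule: generate.induct)
      case one
      show ?case using int_comb_zero[of B] by (intro exI[of _ "\<lambda>x. 0"]) simp
    next
      case (incl h)
      obtain c where c: "h [^] n h = int_comb B c" using n(2)[OF incl] by blast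
      have "N = n h * (\<Prod>x\<in>Y - {h}. n x)" unfolding N_def using Y(1) incl by (rule prod.remove)
      then have "h [^] N = int_comb B c [^] (\<Prod>x\<in>Y - {h}. n x)"
        using incl Y(2) c by (metis int_pow_pow subsetD)
      then show ?case using int_comb_pow[OF fB] by metis
    next
      case (inv h)
      then have h: "h \<in> carrier G" using Y by blast
      obtain c where c: "h [^] n h = int_comb B c" using n(2)[OF inv] by blast
      have "N = n h * (\<Prod>x\<in>Y - {h}. n x)" unfolding N_def using Y(1) inv by (rule prod.remove)
      then have "h [^] N = int_comb B c [^] (\<Prod>x\<in>Y - {h}. n x)" using h c by (metis int_pow_pow)
      then have "inv h [^] N = inv (int_comb B (\<lambda>x. c x * (\<Prod>x\<in>Y - {h}. n x)))"
        using int_comb_pow[OF fB] h by (simp add: int_pow_inv)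
      then show ?case using int_comb_neg[OF fB(2)] by metis
    next
      case (eng h1 h2)
      then have h: "h1 \<in> carrier G" "h2 \<in> carrier G" using Y generate_in_carrier by auto
      obtain c1 c2 where "h1 [^] N = int_comb B c1" "h2 [^] N = int_comb B c2" using eng by blast
      then have "(h1 \<otimes> h2) [^] N = int_comb B (\<lambda>x. c1 x + c2 x)"
        using h int_comb_add[OF fB(2)] by (simp add: int_pow_distrib)
      then show ?case by blast
    qed
  qed
  ultimately show ?thesis by blast
qed

text \<open>An n-th power has unique coordinates with respect to \<open>B\<close>, and uniqueness
  makes them additive. Passing to n-th powers gets rid of torsion and gives homomorphisms to the
  integers; the price is the factor n in their values on \<open>B\<close>.\<close>

lemma additive_coordinates:
  assumes fg: "finitely_generated G" and B: "int_independent G B" "card B = abelian_rank G"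
  shows "\<exists>n>0. \<exists>h. (\<forall>b\<in>B. \<forall>x\<in>carrier G. \<forall>y\<in>carrier G. h b (x \<otimes> y) = h b x + (h b y :: int)) \<and>
    (\<forall>b\<in>B. \<forall>b'\<in>B. h b b' = (if b' = b then n else 0))"
proof -
  obtain n where n: "n > 0" "\<forall>x\<in>carrier G. \<exists>c. x [^] (n::int) = int_comb B c"
    using uniform_power_in_int_comb[OF assms] by blast
  from bchoice[OF n(2)] obtain \<phi> where \<phi>: "\<And>x. x \<in> carrier G \<Longrightarrow> x [^] n = int_comb B (\<phi> x)" by blast
  have fB: "finite B" "B \<subseteq> carrier G" using B by (auto simp: int_independent_iff)
  have "\<phi> (x \<otimes> y) b = \<phi> x b + \<phi> y b" if "b \<in> B" "x \<in> carrier G" "y \<in> carrier G" for x y b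
  proof -
    have "int_comb B (\<phi> (x \<otimes> y)) = int_comb B (\<lambda>b. \<phi> x b + \<phi> y b)"
      using that \<phi>[of "x \<otimes> y"] \<phi>[of x] \<phi>[of y] int_comb_add[OF fB(2)] by (simp add: int_pow_distrib)
    from int_independent_unique[OF B(1) this that(1)] show ?thesis .
  qed
  moreover have "\<phi> b' b = (if b' = b then n else 0)" if "b \<in> B" "b' \<in> B" for b b'
  proof -
    have "int_comb B (\<phi> b') = int_comb B (\<lambda>x. if x = b' then n else 0)"
      using int_comb_single[OF fB that(2), of n] \<phi>[of b'] that fB by auto
    from int_independent_unique[OF B(1) this that(1)] show ?thesis by auto
  qed
  ultimately show ?thesis using n(1) by (intro exI[of _ n] conjI exI[of _ "\<lambda>b x. \<phi> x b"]) auto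
qed

text \<open>The coefficients with respect to generators are divided by n with remainder: the
  multiples of n land in the span of \<open>B\<close>, and the finitely many remainders make up
  \<open>P\<close>. Every coset is covered, possibly more than once.\<close>

lemma finite_transversal:
  assumes fg: "finitely_generated G" and B: "int_independent G B" "card B = abelian_rank G"
  shows "\<exists>P. finite P \<and> P \<subseteq> carrier G \<and> \<one> \<in> P \<and> (\<forall>a\<in>carrier G. \<exists>p\<in>P. \<exists>c. a = int_comb B c \<otimes> p)"
proof -
  obtain Y where Y: "finite Y" "Y \<subseteq> carrier G" "generate G Y = carrier G"
    using fg unfolding finitely_generated_def by blast
  obtain n where n: "n > 0" "\<forall>x\<in>carrier G. \<exists>c. x [^] (n::int) = int_comb B c"
    using uniform_power_in_int_comb[OF assms] by blast
  define P where "P = int_comb Y ` (Y \<rightarrow>\<^sub>E {0..<n})"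
  have P: "finite P" "P \<subseteq> carrier G" unfolding P_def using Y by (auto intro!: finite_PiE)
  have mem: "int_comb Y (\<lambda>x. c x mod n) \<in> P" for c
  proof -
    have "int_comb Y (\<lambda>x. c x mod n) = int_comb Y (\<lambda>x\<in>Y. c x mod n)"
      using Y(2) by (intro int_comb_cong) auto
    moreover have "(\<lambda>x\<in>Y. c x mod n) \<in> Y \<rightarrow>\<^sub>E {0..<n}" using n(1) by auto
    ultimately show ?thesis unfolding P_def by blast
  qed
  have "\<one> \<in> P" using mem[of "\<lambda>x. 0"] by simp
  moreover have "\<exists>p\<in>P. \<exists>c. a = int_comb B c \<otimes> p" if a: "a \<in> carrier G" for a
  proof -
    obtain c where c: "a = int_comb Y c" using int_comb_generate[OF Y a] by blast
    have "int_comb Y c = int_comb Y (\<lambda>x. (c x div n) * n + c x mod n)"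
      using Y(2) by (intro int_comb_cong) auto
    also have "\<dots> = int_comb Y (\<lambda>x. c x div n) [^] n \<otimes> int_comb Y (\<lambda>x. c x mod n)"
      using int_comb_add[OF Y(2), of "\<lambda>x. (c x div n) * n" "\<lambda>x. c x mod n"]
        int_comb_pow[OF Y(1,2), of "\<lambda>x. c x div n" n] by simp
    finally have "a = int_comb Y (\<lambda>x. c x div n) [^] n \<otimes> int_comb Y (\<lambda>x. c x mod n)" using c by simp
    moreover obtain e where "int_comb Y (\<lambda>x. c x div n) [^] n = int_comb B e"
      using bspec[OF n(2) int_comb_closed[OF Y(2)]] by blast
    ultimately have "a = int_comb B e \<otimes> int_comb Y (\<lambda>x. c x mod n)" by simp
    then show ?thesis using mem[of c] by blast
  qed
  ultimately show ?thesis using P by blast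
qed

section \<open>Reduced words and quadratic area\<close>

definition reduced :: "'a set \<Rightarrow> 'a list \<Rightarrow> bool" where
  "reduced B w \<longleftrightarrow> (\<forall>b\<in>B. \<not> (b \<in> set w \<and> inv b \<in> set w))"

definition exponent :: "'a list \<Rightarrow> 'a \<Rightarrow> int" where
  "exponent w b = int (count_list w b) - int (count_list w (inv b))"

text \<open>Independence is applied to the coefficients that are 1 at \<open>b\<close> and at
  \<open>b'\<close>, or 2 if these coincide. So letters from \<open>B\<close> and their inverses can
  be told apart in a word.\<close>

lemma int_independent_inv:
  assumes "int_independent G B" "b \<in> B" "b' \<in> B"
  shows "inv b \<noteq> b'"
proof
  assume eq: "inv b = b'"
  have B: "finite B" "B \<subseteq> carrier G" using assms by (auto simp: int_independent_iff)
  let ?c = "\<lambda>x. (if x = b then 1 else 0) + (if x = b' then 1 else 0 :: int)"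
  have "int_comb B ?c = b [^] (1::int) \<otimes> b' [^] (1::int)"
    using int_comb_add[OF B(2), of "\<lambda>x. if x = b then 1 else 0" "\<lambda>x. if x = b' then 1 else 0"]
      int_comb_single[OF B assms(2), of 1] int_comb_single[OF B assms(3), of 1] by simp
  also have "\<dots> = \<one>" using eq assms B by (auto simp: subset_iff)
  finally have "?c b = 0" using assms unfolding int_independent_iff by blast
  then show False by (simp split: if_splits)
qed

lemma list_prod_exponent:
  assumes B: "int_independent G B" and "w \<in> lists (B \<union> m_inv G ` B)"
  shows "list_prod G w = int_comb B (exponent w)"
  using assms(2)
proof (induction w)
  case Nil
  have "exponent [] = (\<lambda>x. 0)" by (simp add: exponent_def fun_eq_iff)
  then show ?case by simp
next
  case (Cons x w)
  have fB: "finite B" "B \<subseteq> carrier G" using B by (auto simp: int_independent_iff)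
  have IH: "list_prod G w = int_comb B (exponent w)" using Cons by simp
  obtain b k where b: "b \<in> B" "x = b [^] (k::int)" "\<And>b'. b' \<in> B \<Longrightarrow>
      exponent (x # w) b' = (if b' = b then k else 0) + exponent w b'"
  proof (cases "x \<in> B")
    case True
    have "exponent (x # w) b' = (if b' = x then 1 else 0) + exponent w b'" if "b' \<in> B" for b'
      using int_independent_inv[OF B that True] by (auto simp: exponent_def)
    then show thesis using that[of x 1] True fB by auto
  next
    case False
    then obtain b where b: "b \<in> B" "x = inv b" using Cons by auto
    have "exponent (x # w) b' = (if b' = b then -1 else 0) + exponent w b'" if "b' \<in> B" for b'
    proof -
      have "x \<noteq> b'" using int_independent_inv[OF B b(1) that] b(2) by simp
      moreover have "x = inv b' \<longleftrightarrow> b' = b" using b that fB(2) by (metis inv_inv subsetD)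
      ultimately show ?thesis by (auto simp: exponent_def)
    qed
    then show thesis using that[of b "-1"] b fB by (auto simp: int_pow_neg)
  qed
  have "int_comb B (exponent (x # w)) = int_comb B (\<lambda>b'. (if b' = b then k else 0) + exponent w b')"
    using b(3) fB(2) by (intro int_comb_cong)
  also have "\<dots> = x \<otimes> list_prod G w"
    using int_comb_add[OF fB(2)] int_comb_single[OF fB b(1)] IH b(2) by simp
  finally show ?case by simp
qed

text \<open>In a reduced word no letter occurs with both signs, so nothing cancels in the exponents.
  Its length is thus determined by its value, which \<open>abelian_filling\<close> relies
  on.\<close>

lemma length_reduced:
  assumes B: "int_independent G B" and w: "w \<in> lists (B \<union> m_inv G ` B)" "reduced B w"
  shows "int (length w) = (\<Sum>b\<in>B. \<bar>exponent w b\<bar>)"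
proof -
  have fB: "finite B" "B \<subseteq> carrier G" using B by (auto simp: int_independent_iff)
  have inj: "inj_on (m_inv G) B" using fB by (intro inj_onI) (metis inv_inv subsetD)
  have disj: "B \<inter> m_inv G ` B = {}" using int_independent_inv[OF B] by blast
  have "length w = sum (count_list w) (B \<union> m_inv G ` B)"
    using w(1) fB by (intro sum_count_set[symmetric]) auto
  also have "\<dots> = sum (count_list w) B + sum (count_list w) (m_inv G ` B)"
    using fB disj by (intro sum.union_disjoint) auto
  also have "sum (count_list w) (m_inv G ` B) = (\<Sum>b\<in>B. count_list w (inv b))"
    using inj by (simp add: sum.reindex)
  finally have "int (length w) = (\<Sum>b\<in>B. int (count_list w b) + int (count_list w (inv b)))"
    by (simp add: sum.distrib)
  also have "\<dots> = (\<Sum>b\<in>B. \<bar>exponent w b\<bar>)"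
  proof (rule sum.cong[OF HOL.refl])
    fix b assume "b \<in> B"
    then have "b \<notin> set w \<or> inv b \<notin> set w" using w(2) by (auto simp: reduced_def)
    then have "count_list w b = 0 \<or> count_list w (inv b) = 0" by (metis count_notin)
    then show "int (count_list w b) + int (count_list w (inv b)) = \<bar>exponent w b\<bar>"
      by (auto simp: exponent_def)
  qed
  finally show ?thesis .
qed

lemma rewr_commute:
  assumes "T \<subseteq> carrier G" "2 \<le> l" "x \<in> T" "w \<in> lists T"
  shows "rewr G T l (length w) (x # w) (w @ [x])"
  using assms(4)
proof (induction w)
  case Nil
  then show ?case using assms by simp
next
  case (Cons y w)
  then have y: "y \<in> T" "w \<in> lists T" by auto
  have "x \<in> carrier G" "y \<in> carrier G" using assms y by auto
  then have "rewr G T l 1 [x, y] [y, x]" using assms y by (intro rewr_base) (simp_all add: m_comm)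
  then have "rewr G T l 1 ([x, y] @ w) ([y, x] @ w)" using y by (intro rewr_congr_right)
  also have "rewr G T l (length w) ([y, x] @ w) (y # w @ [x])"
    using rewr_congr_left[OF Cons.IH, of "[y]"] y by simp
  finally show ?case by simp
qed

lemma rewr_reduced:
  assumes T: "T \<subseteq> carrier G" "B \<union> m_inv G ` B \<subseteq> T" "B \<subseteq> carrier G" "\<And>b. b \<in> B \<Longrightarrow> inv b \<noteq> b"
    and l: "2 \<le> l" and "w \<in> lists (B \<union> m_inv G ` B)"
  shows "\<exists>v. v \<in> lists (B \<union> m_inv G ` B) \<and> reduced B v \<and> rewr G T l ((length w)\<^sup>2) w v"
  using assms(6)
proof (induction "length w" arbitrary: w rule: less_induct)
  case less
  let ?D = "B \<union> m_inv G ` B"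
  have wT: "w \<in> lists T" using less.prems T(2) by auto
  show ?case
  proof (cases "reduced B w")
    case True
    then show ?thesis using less.prems wT by (intro exI[of _ w]) simp
  next
    case False
    then obtain b where b: "b \<in> B" "b \<in> set w" "inv b \<in> set w" by (auto simp: reduced_def)
    have bc: "b \<in> carrier G" using b T by auto
    obtain p q where pq: "w = p @ b # q" using b(2) by (meson split_list)
    have "inv b \<in> set p \<or> inv b \<in> set q" using b(3) pq T(4)[OF b(1)] by auto
    then obtain x a m z where w: "w = a @ x # m @ inv x # z" "x \<in> carrier G"
    proof
      assume "inv b \<in> set p"
      then obtain p1 p2 where "p = p1 @ inv b # p2" by (meson split_list)
      then show thesis using that[of p1 "inv b" p2 q] pq bc by simp
    next
      assume "inv b \<in> set q"
      then obtain p1 p2 where "q = p1 @ inv b # p2" by (meson split_list)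
      then show thesis using that[of p b p1 p2] pq bc by simp
    qed
    have mem: "a \<in> lists T" "m \<in> lists T" "z \<in> lists T" "x \<in> T" "inv x \<in> T"
      using wT w by auto
    have "rewr G T l (length m) (x # m) (m @ [x])" using T l mem by (intro rewr_commute)
    from rewr_congr[OF this, of a "inv x # z"]
    have "rewr G T l (length m) w (a @ m @ [x, inv x] @ z)" using mem w(1) by simp
    also have "rewr G T l 1 (a @ m @ [x, inv x] @ z) (a @ m @ z)"
    proof -
      have "rewr G T l 1 [x, inv x] []" using mem l w(2) by (intro rewr_base) auto
      from rewr_congr[OF this, of "a @ m" z] show ?thesis using mem by simp
    qed
    finally have 1: "rewr G T l (length m + 1) w (a @ m @ z)" .
    have "a @ m @ z \<in> lists ?D" "length (a @ m @ z) < length w" using less.prems w by auto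
    then obtain v where v: "v \<in> lists ?D" "reduced B v" "rewr G T l ((length (a @ m @ z))\<^sup>2) (a @ m @ z) v"
      using less.hyps[of "a @ m @ z"] by blast
    have "rewr G T l (length m + 1 + (length (a @ m @ z))\<^sup>2) w v" by (rule rewr_trans'[OF 1 v(3)])
    moreover have "length m + 1 + (length (a @ m @ z))\<^sup>2 \<le> (length w)\<^sup>2"
    proof -
      define n where "n = length (a @ m @ z)"
      have "length w = n + 2" "length m \<le> n" using w(1) by (auto simp: n_def)
      then show ?thesis unfolding n_def[symmetric] by (simp add: power2_eq_square)
    qed
    ultimately have "rewr G T l ((length w)\<^sup>2) w v" by (rule rewr_mono)
    then show ?thesis using v by blast
  qed
qed

lemma int_comb_word:
  assumes "finite B" "B \<subseteq> carrier G"
  shows "\<exists>w\<in>lists (B \<union> m_inv G ` B). list_prod G w = int_comb B c"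
  using assms
proof (induction B rule: finite_induct)
  case empty
  then show ?case by (simp add: int_comb_def)
next
  case (insert b B)
  then have b: "b \<in> carrier G" "B \<subseteq> carrier G" by auto
  obtain w where w: "w \<in> lists (B \<union> m_inv G ` B)" "list_prod G w = int_comb B c" using insert by auto
  define v where "v = (if c b \<ge> 0 then replicate (nat (c b)) b else replicate (nat (- c b)) (inv b))"
  have v: "v \<in> lists (insert b B \<union> m_inv G ` insert b B)" "v \<in> lists (carrier G)"
    using b by (auto simp: v_def)
  have "list_prod G v = b [^] c b"
  proof (cases "c b \<ge> 0")
    case True
    then show ?thesis using b int_pow_int[of G b "nat (c b)"] by (simp add: v_def list_prod_replicate)
  next
    case False
    then have "b [^] c b = inv (b [^] int (nat (- c b)))" using b by (simp flip: int_pow_neg)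
    also have "\<dots> = inv b [^] (nat (- c b))" using b by (simp add: int_pow_int nat_pow_inv)
    finally show ?thesis using False b by (simp add: v_def list_prod_replicate)
  qed
  moreover have "w \<in> lists (carrier G)" using w(1) b(2) by auto
  ultimately have "list_prod G (v @ w) = b [^] c b \<otimes> int_comb B c"
    using v w by (simp add: list_prod_append)
  also have "\<dots> = int_comb (insert b B) c"
    unfolding int_comb_def using insert b by (intro finprod_insert[symmetric]) auto
  finally show ?case using v(1) w(1) by (intro bexI[of _ "v @ w"]) auto
qed

text \<open>A relation is turned into a word over \<open>B\<close> and its inverses followed by a
  letter \<open>p\<close> of \<open>P\<close>, and the word before \<open>p\<close> is reduced. Its
  value is the inverse of \<open>p\<close>. By uniqueness of exponents all reduced words of this
  value have the same length, so one relation of bounded length finishes the filling. Two words with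
  equal values are compared through the quotient.\<close>

theorem abelian_filling:
  assumes B: "int_independent G B" and P: "finite P" "P \<subseteq> carrier G" "\<one> \<in> P"
      "\<And>a. a \<in> carrier G \<Longrightarrow> \<exists>p\<in>P. \<exists>c. a = int_comb B c \<otimes> p"
    and T: "finite T" "T \<subseteq> carrier G" "\<And>s. s \<in> T \<Longrightarrow> inv s \<in> T" "B \<subseteq> T" "P \<subseteq> T"
  shows "\<exists>l C. \<forall>u v n. u \<in> lists T \<longrightarrow> v \<in> lists T \<longrightarrow> length u \<le> n \<longrightarrow> length v \<le> n \<longrightarrow>
    list_prod G u = list_prod G v \<longrightarrow> rewr G T l (C * (n + 1)\<^sup>2) u v"
proof -
  let ?D = "B \<union> m_inv G ` B"
  have fB: "finite B" "B \<subseteq> carrier G" using B by (auto simp: int_independent_iff)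
  have D: "?D \<subseteq> T" using T by auto
  have lists_D: "w \<in> lists T" "w \<in> lists (carrier G)" if "w \<in> lists ?D" for w
    using that lists_mono[OF D] lists_mono[OF T(2)] by blast+
  define absorbs where "absorbs = (\<lambda>(p, s) c. \<exists>\<beta> p'. \<beta> \<in> lists ?D \<and> length \<beta> \<le> c \<and> p' \<in> P \<and>
      p \<otimes> s = list_prod G \<beta> \<otimes> p')"
  have "\<exists>c. \<forall>x\<in>P \<times> T. absorbs x c"
  proof (rule finite_uniform_bound)
    show "finite (P \<times> T)" using P T by simp
    show "\<exists>c. absorbs x c" if xPT: "x \<in> P \<times> T" for x
    proof -
      obtain p s where x: "x = (p, s)" "p \<in> carrier G" "s \<in> carrier G"
        using xPT subsetD[OF P(2)] subsetD[OF T(2)] by (cases x) auto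
      obtain p' c where p': "p' \<in> P" "p \<otimes> s = int_comb B c \<otimes> p'" using P(4)[of "p \<otimes> s"] x by auto
      obtain \<beta> where \<beta>: "\<beta> \<in> lists ?D" "list_prod G \<beta> = int_comb B c" using int_comb_word[OF fB] by blast
      then have "absorbs x (length \<beta>)"
        unfolding absorbs_def x prod.case using p' by (intro exI[of _ \<beta>] exI[of _ p']) simp
      then show ?thesis by blast
    qed
    show "absorbs x n" if "absorbs x m" "m \<le> n" for x m n
      using that unfolding absorbs_def by (cases x) (auto intro: le_trans)
  qed
  then obtain c1 where c1: "\<forall>x\<in>P \<times> T. absorbs x c1" by blast
  define short where "short = (\<lambda>p c. \<forall>\<beta>. \<beta> \<in> lists ?D \<longrightarrow> reduced B \<beta> \<longrightarrow> list_prod G \<beta> \<otimes> p = \<one> \<longrightarrow>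
      length \<beta> \<le> c)"
  have "\<exists>c. \<forall>p\<in>P. short p c"
  proof (rule finite_uniform_bound)
    show "finite P" by fact
    show "\<exists>c. short p c" if pP: "p \<in> P" for p
    proof (cases "\<exists>\<beta>. \<beta> \<in> lists ?D \<and> reduced B \<beta> \<and> list_prod G \<beta> \<otimes> p = \<one>")
      case True
      then obtain \<beta> where \<beta>: "\<beta> \<in> lists ?D" "reduced B \<beta>" "list_prod G \<beta> \<otimes> p = \<one>" by blast
      have "length \<beta>' = length \<beta>" if \<beta>': "\<beta>' \<in> lists ?D" "reduced B \<beta>'" "list_prod G \<beta>' \<otimes> p = \<one>" for \<beta>'
      proof -
        have "list_prod G \<beta> \<in> carrier G" "list_prod G \<beta>' \<in> carrier G"
          using \<beta>(1) \<beta>'(1) lists_D by (auto intro!: list_prod_closed)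
        then have "list_prod G \<beta>' = list_prod G \<beta>"
          using \<beta>(3) \<beta>'(3) pP P(2) by (metis r_cancel subsetD)
        then have "exponent \<beta>' b = exponent \<beta> b" if "b \<in> B" for b
          using int_independent_unique[OF B _ that] list_prod_exponent[OF B] \<beta>(1) \<beta>'(1) by metis
        then have "int (length \<beta>') = int (length \<beta>)"
          using length_reduced[OF B \<beta>(1,2)] length_reduced[OF B \<beta>'(1,2)] by simp
        then show ?thesis by simp
      qed
      then show ?thesis unfolding short_def by (intro exI[of _ "length \<beta>"]) simp
    next
      case False
      then show ?thesis unfolding short_def by blast
    qed
    show "short p n" if "short p m" "m \<le> n" for p m n
      using that unfolding short_def by (meson le_trans)
  qed
  then obtain c2 where c2: "\<forall>p\<in>P. short p c2" by blast
  \<comment> \<open>Room for the relations of \<open>rewr_absorb\<close>, and for a reduced word of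
    length at most \<open>c2\<close> followed by a letter of \<open>P\<close>.\<close>
  define l where "l = c1 + c2 + 2"
  have triv: "rewr G T l ((c1\<^sup>2 + 2) * (length u + 1)\<^sup>2) u []" if u: "u \<in> lists T" "list_prod G u = \<one>" for u
  proof -
    obtain \<beta> p where \<beta>: "\<beta> \<in> lists ?D" "length \<beta> \<le> c1 * length u" "p \<in> P"
      "rewr G T l (length u) (\<one> # u) (\<beta> @ [p])"
      using rewr_absorb[OF is_group T(2) T(5) D _ _ u(1) P(3), of c1 l] c1
      unfolding absorbs_def l_def by auto
    obtain \<gamma> where \<gamma>: "\<gamma> \<in> lists ?D" "reduced B \<gamma>" "rewr G T l ((length \<beta>)\<^sup>2) \<beta> \<gamma>"
      using rewr_reduced[OF T(2) D fB(2) _ _ \<beta>(1), of l] int_independent_inv[OF B] by (auto simp: l_def)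
    have carr: "u \<in> lists (carrier G)" "p \<in> carrier G" "\<gamma> \<in> lists (carrier G)" "\<gamma> \<in> lists T" "p \<in> T"
      using u(1) \<beta>(3) P(2) T(2,5) lists_D[OF \<gamma>(1)] lists_mono[OF T(2)] by blast+
    have "rewr G T l 1 [] [\<one>]" using P T by (intro rewr_base) (auto simp: l_def)
    from rewr_congr_right[OF this u(1)] have "rewr G T l 1 u (\<one> # u)" by simp
    also note \<beta>(4)
    also have "rewr G T l ((length \<beta>)\<^sup>2) (\<beta> @ [p]) (\<gamma> @ [p])"
      using carr by (intro rewr_congr_right \<gamma>) auto
    finally have 1: "rewr G T l (1 + length u + (length \<beta>)\<^sup>2) u (\<gamma> @ [p])" .
    have prod: "list_prod G \<gamma> \<otimes> p = \<one>"
      using rewr_list_prod[OF 1 is_group T(2)] u(2) carr by (simp add: list_prod_append)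
    then have "length \<gamma> \<le> c2" using c2 \<beta>(3) \<gamma>(1,2) unfolding short_def by blast
    then have "rewr G T l 1 (\<gamma> @ [p]) []"
      using carr prod by (intro rewr_base) (auto simp: l_def list_prod_append)
    from rewr_trans'[OF 1 this] show ?thesis
    proof (rule rewr_mono)
      have "(length \<beta>)\<^sup>2 \<le> (c1 * (length u + 1))\<^sup>2"
        using \<beta>(2) by (intro power_mono) auto
      then have "(length \<beta>)\<^sup>2 \<le> c1\<^sup>2 * (length u + 1)\<^sup>2" by (simp only: power_mult_distrib)
      moreover have "length u + 1 \<le> (length u + 1)\<^sup>2" by (rule self_le_power) auto
      ultimately show "1 + length u + (length \<beta>)\<^sup>2 + 1 \<le> (c1\<^sup>2 + 2) * (length u + 1)\<^sup>2"
        unfolding add_mult_distrib by linarith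
    qed
  qed
  have "rewr G T l ((1 + (c1\<^sup>2 + 2) * 4) * (n + 1)\<^sup>2) u v"
    if uv: "u \<in> lists T" "v \<in> lists T" "length u \<le> n" "length v \<le> n" "list_prod G u = list_prod G v" for u v n
  proof -
    let ?v = "list_inv G v"
    have v': "?v \<in> lists T" using uv(2) T(3) by (rule list_inv_in_lists)
    have carr: "u \<in> lists (carrier G)" "v \<in> lists (carrier G)" "?v \<in> lists (carrier G)"
      using uv v' T by auto
    have "rewr G T l (length v) (?v @ v) []"
      using rewr_cancel(2)[OF is_group T(2,3) _ uv(2)] by (simp add: l_def)
    from rewr_congr_left[OF rewr_sym[OF this] uv(1)]
    have "rewr G T l (length v) u ((u @ ?v) @ v)" by simp
    also have "rewr G T l ((c1\<^sup>2 + 2) * (length (u @ ?v) + 1)\<^sup>2) ((u @ ?v) @ v) ([] @ v)"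
      using uv v' carr by (intro rewr_congr_right triv) (auto simp: list_prod_append list_prod_list_inv)
    finally have "rewr G T l (length v + (c1\<^sup>2 + 2) * (length (u @ ?v) + 1)\<^sup>2) u v" by simp
    then show ?thesis
    proof (rule rewr_mono)
      have "(length (u @ ?v) + 1)\<^sup>2 \<le> (2 * (n + 1))\<^sup>2" using uv(3,4) by (intro power_mono) auto
      also have "\<dots> = 4 * (n + 1)\<^sup>2" by (simp only: power_mult_distrib) simp
      finally have "(c1\<^sup>2 + 2) * (length (u @ ?v) + 1)\<^sup>2 \<le> (c1\<^sup>2 + 2) * (4 * (n + 1)\<^sup>2)"
        by (rule mult_le_mono2)
      moreover have "n + 1 \<le> (n + 1)\<^sup>2" by (rule self_le_power) auto
      ultimately show "length v + (c1\<^sup>2 + 2) * (length (u @ ?v) + 1)\<^sup>2 \<le> (1 + (c1\<^sup>2 + 2) * 4) * (n + 1)\<^sup>2"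
        using uv(4) unfolding add_mult_distrib mult.assoc by linarith
    qed
  qed
  then show ?thesis by blast
qed

end

section \<open>Change of generating set\<close>

lemma (in group) generate_lists:
  assumes "S \<subseteq> carrier G" "\<And>s. s \<in> S \<Longrightarrow> inv s \<in> S" "x \<in> generate G S"
  shows "\<exists>w\<in>lists S. list_prod G w = x"
  using assms(3)
proof (induction rule: generate.induct)
  case one
  show ?case by (intro bexI[of _ "[]"]) auto
next
  case (incl h)
  then show ?case using assms(1) by (intro bexI[of _ "[h]"]) auto
next
  case (inv h)
  then show ?case using assms(1,2) by (intro bexI[of _ "[inv h]"]) auto
next
  case (eng h1 h2)
  then obtain w1 w2 where w: "w1 \<in> lists S" "list_prod G w1 = h1" "w2 \<in> lists S" "list_prod G w2 = h2" by blast
  moreover have "w1 \<in> lists (carrier G)" "w2 \<in> lists (carrier G)"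
    using w lists_mono[OF assms(1)] by blast+
  ultimately show ?case by (intro bexI[of _ "w1 @ w2"]) (auto simp: list_prod_append)
qed

text \<open>By the Baire category theorem some \<open>S ^ n\<close> has nonempty interior, so finitely many of its
  translates cover a given compact set.\<close>

lemma compact_boundedly_generated:
  assumes G: "locally_compact_group G T" and S: "compact_symmetric_generating G T S" and K: "compactin T K"
  shows "group.boundedly_generates G S K"
proof -
  interpret group G using G by (simp add: locally_compact_group_def)
  have top: "topspace T = carrier G" and Haus: "Hausdorff_space T" and lc: "locally_compact_space T"
    and mult: "continuous_map (prod_topology T T) T (\<lambda>(x, y). x \<otimes>\<^bsub>G\<^esub> y)"
    using G by (simp_all add: locally_compact_group_def)
  have S': "compactin T S" "S \<subseteq> carrier G" "\<And>s. s \<in> S \<Longrightarrow> inv\<^bsub>G\<^esub> s \<in> S" "generate G S = carrier G"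
    using S by (simp_all add: compact_symmetric_generating_def)
  \<comment> \<open>Products of exactly n letters: compact as continuous images of products of
    \<open>S\<close>, and exhausting the group since inverses of letters are letters.\<close>
  define E where "E = (\<lambda>n. {list_prod G w | w. w \<in> lists S \<and> length w = n})"
  have compact_E: "compactin T (E n)" for n
  proof (induction n)
    case 0
    have "E 0 = {\<one>\<^bsub>G\<^esub>}" by (auto simp: E_def)
    then show ?case using top by simp
  next
    case (Suc n)
    have "E (Suc n) = (\<lambda>(x, y). x \<otimes>\<^bsub>G\<^esub> y) ` (S \<times> E n)"
    proof (rule subset_antisym; rule subsetI)
      fix x assume "x \<in> E (Suc n)"
      then obtain w where w: "x = list_prod G w" "w \<in> lists S" "length w = Suc n" by (auto simp: E_def)
      then obtain s v where sv: "w = s # v" by (cases w) auto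
      then have v: "v \<in> lists S" "length v = n" using w by auto
      then have "list_prod G v \<in> E n" unfolding E_def by blast
      moreover have "s \<in> S" "x = s \<otimes>\<^bsub>G\<^esub> list_prod G v" using w sv by auto
      ultimately show "x \<in> (\<lambda>(x, y). x \<otimes>\<^bsub>G\<^esub> y) ` (S \<times> E n)" by (intro image_eqI[of _ _ "(s, list_prod G v)"]) auto
    next
      fix x assume "x \<in> (\<lambda>(x, y). x \<otimes>\<^bsub>G\<^esub> y) ` (S \<times> E n)"
      then obtain s y where sy: "s \<in> S" "y \<in> E n" "x = s \<otimes>\<^bsub>G\<^esub> y" by auto
      then obtain w where "w \<in> lists S" "length w = n" "x = s \<otimes>\<^bsub>G\<^esub> list_prod G w"
        unfolding E_def by blast
      then show "x \<in> E (Suc n)" unfolding E_def using sy(1) by (intro CollectI exI[of _ "s # w"]) simp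
    qed
    moreover have "compactin (prod_topology T T) (S \<times> E n)" using Suc S'(1) by (simp add: compactin_Times)
    from image_compactin[OF this mult] have "compactin T ((\<lambda>(x, y). x \<otimes>\<^bsub>G\<^esub> y) ` (S \<times> E n))" .
    ultimately show ?case by simp
  qed
  have all_E: "\<exists>n. x \<in> E n" if "x \<in> carrier G" for x
  proof -
    have "x \<in> generate G S" using S'(4) that by simp
    then obtain w where "w \<in> lists S" "list_prod G w = x" using generate_lists S'(2,3) by blast
    then show ?thesis unfolding E_def by blast
  qed
  have E_carrier: "E n \<subseteq> carrier G" for n using compactin_subset_topspace[OF compact_E[of n]] top by simp
  have "\<exists>n. T interior_of E n \<noteq> {}"
  proof (rule ccontr)
    assume "\<not> ?thesis"
    then have empty: "T interior_of E n = {}" for n by blast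
    have "T interior_of (\<Union>(range E)) = {}"
    proof (rule Baire_category_alt)
      show "completely_metrizable_space T \<or> locally_compact_space T \<and> regular_space T"
        using lc locally_compact_Hausdorff_imp_regular_space[OF lc Haus] by blast
      show "countable (range E)" by simp
      show "closedin T C \<and> T interior_of C = {}" if C: "C \<in> range E" for C
      proof -
        obtain k where "C = E k" using C by blast
        then show ?thesis using empty[of k] compactin_imp_closedin[OF Haus compact_E[of k]] by simp
      qed
    qed
    moreover have "\<Union>(range E) = topspace T"
    proof
      show "\<Union>(range E) \<subseteq> topspace T" using E_carrier top by (simp add: UN_least)
      show "topspace T \<subseteq> \<Union>(range E)"
      proof
        fix x assume "x \<in> topspace T"
        then obtain n where "x \<in> E n" using all_E[of x] top by auto
        then show "x \<in> \<Union>(range E)" by blast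
      qed
    qed
    ultimately have "T interior_of topspace T = {}" by simp
    then have "topspace T = {}" unfolding interior_of_topspace .
    then show False unfolding top using one_closed by blast
  qed
  then obtain n where "T interior_of E n \<noteq> {}" ..
  then obtain u where u: "u \<in> T interior_of E n" by blast
  let ?U = "T interior_of E n"
  have uc: "u \<in> carrier G" using subsetD[OF interior_of_subset_topspace u] top by simp
  \<comment> \<open>The left translate of the interior of \<open>E n\<close> that carries the point
    \<open>u\<close> to \<open>g\<close>.\<close>
  define V where "V = (\<lambda>g. {x \<in> topspace T. (u \<otimes>\<^bsub>G\<^esub> inv\<^bsub>G\<^esub> g) \<otimes>\<^bsub>G\<^esub> x \<in> ?U})"
  have V_open: "openin T (V g)" if "g \<in> carrier G" for g
  proof -
    have "continuous_map T (prod_topology T T) (\<lambda>x. (u \<otimes>\<^bsub>G\<^esub> inv\<^bsub>G\<^esub> g, x))"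
      using uc that top by (intro continuous_map_pairedI) auto
    then have "continuous_map T T ((\<lambda>(x, y). x \<otimes>\<^bsub>G\<^esub> y) \<circ> (\<lambda>x. (u \<otimes>\<^bsub>G\<^esub> inv\<^bsub>G\<^esub> g, x)))"
      using mult by (rule continuous_map_compose)
    then have "continuous_map T T (\<lambda>x. (u \<otimes>\<^bsub>G\<^esub> inv\<^bsub>G\<^esub> g) \<otimes>\<^bsub>G\<^esub> x)" by (simp add: o_def)
    then show ?thesis unfolding V_def by (rule openin_continuous_map_preimage) simp
  qed
  have Kc: "K \<subseteq> carrier G" using compactin_subset_topspace[OF K] top by simp
  have V_mem: "g \<in> V g" if "g \<in> carrier G" for g
    using that u uc top by (simp add: V_def m_assoc)
  have "K \<subseteq> \<Union>(V ` K)" using V_mem Kc by blast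
  then obtain \<F> where \<F>: "finite \<F>" "\<F> \<subseteq> V ` K" "K \<subseteq> \<Union>\<F>"
    using compactinD[OF K, of "V ` K"] V_open Kc by blast
  then obtain J where J: "finite J" "J \<subseteq> K" "\<F> = V ` J" by (meson finite_subset_image)
  \<comment> \<open>The finitely many translating elements are products of a bounded number of
    letters.\<close>
  have "\<exists>m. \<forall>g\<in>J. \<exists>k\<le>m. g \<otimes>\<^bsub>G\<^esub> inv\<^bsub>G\<^esub> u \<in> E k"
  proof -
    have "\<forall>g\<in>J. \<exists>k. g \<otimes>\<^bsub>G\<^esub> inv\<^bsub>G\<^esub> u \<in> E k" using all_E J(2) Kc uc by auto
    from bchoice[OF this] obtain k where k: "\<forall>g\<in>J. g \<otimes>\<^bsub>G\<^esub> inv\<^bsub>G\<^esub> u \<in> E (k g)" by blast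
    have "\<forall>g\<in>J. k g \<le> Max (insert 0 (k ` J))" using J(1) by auto
    then show ?thesis using k by blast
  qed
  then obtain m where m: "\<forall>g\<in>J. \<exists>k\<le>m. g \<otimes>\<^bsub>G\<^esub> inv\<^bsub>G\<^esub> u \<in> E k" by blast
  have "\<exists>w\<in>lists S. length w \<le> m + n \<and> list_prod G w = x" if x: "x \<in> K" for x
  proof -
    obtain g where g: "g \<in> J" "x \<in> V g" using x \<F>(3) J(3) by blast
    have gc: "g \<in> carrier G" "x \<in> carrier G" using g J(2) Kc x by auto
    obtain k where k: "k \<le> m" "g \<otimes>\<^bsub>G\<^esub> inv\<^bsub>G\<^esub> u \<in> E k" using m g(1) by blast
    obtain w where w: "w \<in> lists S" "length w = k" "g \<otimes>\<^bsub>G\<^esub> inv\<^bsub>G\<^esub> u = list_prod G w"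
      using k(2) unfolding E_def by blast
    have "(u \<otimes>\<^bsub>G\<^esub> inv\<^bsub>G\<^esub> g) \<otimes>\<^bsub>G\<^esub> x \<in> E n" using g(2) interior_of_subset[of T "E n"] by (auto simp: V_def)
    then obtain v where v: "v \<in> lists S" "length v = n" "(u \<otimes>\<^bsub>G\<^esub> inv\<^bsub>G\<^esub> g) \<otimes>\<^bsub>G\<^esub> x = list_prod G v"
      unfolding E_def by blast
    have "w \<in> lists (carrier G)" "v \<in> lists (carrier G)" using w v lists_mono[OF S'(2)] by blast+
    then have "list_prod G (w @ v) = (g \<otimes>\<^bsub>G\<^esub> inv\<^bsub>G\<^esub> u) \<otimes>\<^bsub>G\<^esub> ((u \<otimes>\<^bsub>G\<^esub> inv\<^bsub>G\<^esub> g) \<otimes>\<^bsub>G\<^esub> x)"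
      using w v by (simp add: list_prod_append)
    also have "\<dots> = (g \<otimes>\<^bsub>G\<^esub> inv\<^bsub>G\<^esub> u) \<otimes>\<^bsub>G\<^esub> (inv\<^bsub>G\<^esub> (g \<otimes>\<^bsub>G\<^esub> inv\<^bsub>G\<^esub> u) \<otimes>\<^bsub>G\<^esub> x)"
      using gc uc by (simp add: inv_mult_group)
    also have "\<dots> = x" using gc uc by (simp flip: m_assoc)
    finally show ?thesis using w(1,2) v(1,2) k(1) by (intro bexI[of _ "w @ v"]) auto
  qed
  then show ?thesis unfolding boundedly_generates_def by blast
qed

section \<open>Dehn functions from one filled generating set\<close>

lemma compact_symmetric_generating_props:
  assumes "compact_symmetric_generating G T S"
  shows "S \<subseteq> carrier G" "\<And>s. s \<in> S \<Longrightarrow> inv\<^bsub>G\<^esub> s \<in> S" "generate G S = carrier G" "compactin T S"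
  using assms by (simp_all add: compact_symmetric_generating_def)

lemma area_bound_any_generating_set:
  assumes G: "locally_compact_group G T" and S: "compact_symmetric_generating G T S"
    and S0: "compact_symmetric_generating G T S0" "group.polynomially_filled G p S0" and p: "1 \<le> p"
  shows "\<exists>l0 C. \<forall>l\<ge>l0. \<forall>w\<in>relations G S.
    product_of_conjugates S {r \<in> relations G S. length r \<le> l} (C * (length w + 1) ^ p) w"
proof -
  interpret group G using G by (simp add: locally_compact_group_def)
  note Sp = compact_symmetric_generating_props[OF S] and S0p = compact_symmetric_generating_props[OF S0(1)]
  show ?thesis
    using area_bound_transfer[OF Sp(1,2) S0p(1) compact_boundedly_generated[OF G S S0p(4)]
      compact_boundedly_generated[OF G S0(1) Sp(4)] S0(2) p] .
qed

text \<open>All relations up to a fixed length serve as relators; a bound on areas in particular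
  says that every relation is a product of their conjugates.\<close>

theorem compactly_presented_if_filled:
  assumes G: "locally_compact_group G T"
    and S0: "compact_symmetric_generating G T S0" "group.polynomially_filled G p S0" and p: "1 \<le> p"
  shows "compactly_presented G T"
proof -
  obtain l C where l: "\<forall>w\<in>relations G S0.
      product_of_conjugates S0 {r \<in> relations G S0. length r \<le> l} (C * (length w + 1) ^ p) w"
    using area_bound_any_generating_set[OF G S0(1) S0 p] by blast
  let ?R = "{r \<in> relations G S0. length r \<le> l}"
  have "\<exists>m. product_of_conjugates S0 (?R \<union> word_inv ` ?R) m w" if "w \<in> relations G S0" for w
    using product_of_conjugates_mono[OF bspec[OF l that] order_refl Un_upper1] by blast
  then have "presentation G S0 ?R"
    unfolding presentation_def using compact_symmetric_generating_props[OF S0(1)] by auto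
  then show ?thesis unfolding compactly_presented_def using G S0(1) by blast
qed

theorem linear_dehn_function_if_filled:
  assumes G: "locally_compact_group G T"
    and S0: "compact_symmetric_generating G T S0" "group.polynomially_filled G 1 S0"
  shows "linear_dehn_function G T"
  unfolding linear_dehn_function_def has_dehn_growth_def
proof (intro allI impI)
  interpret group G using G by (simp add: locally_compact_group_def)
  fix S assume S: "compact_symmetric_generating G T S"
  obtain l0 C where C: "\<forall>l\<ge>l0. \<forall>w\<in>relations G S.
      product_of_conjugates S {r \<in> relations G S. length r \<le> l} (C * (length w + 1) ^ 1) w"
    using area_bound_any_generating_set[OF G S S0] by blast
  have "growth_equiv (dehn_function G S l) (\<lambda>n. ereal n)" if "l \<ge> l0" for l
    using growth_equiv_linear[of S l C] C that by simp
  then show "\<exists>l0. \<forall>l\<ge>l0. growth_equiv (dehn_function G S l) ereal" by blast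
qed

text \<open>\<open>f\<close> and \<open>g\<close> are the plane coordinates for the signed area,
  bounded on every compact generating set by \<open>bdd\<close>. The commuting elements
  \<open>x\<close> and \<open>y\<close> with nonzero determinant supply the commutator relations of
  large area.\<close>

theorem quadratic_dehn_function_if_filled:
  assumes G: "locally_compact_group G T"
    and S0: "compact_symmetric_generating G T S0" "group.polynomially_filled G 2 S0"
    and hom: "\<And>x y. \<lbrakk>x \<in> carrier G; y \<in> carrier G\<rbrakk> \<Longrightarrow> f (x \<otimes>\<^bsub>G\<^esub> y) = f x + (f y :: int)"
      "\<And>x y. \<lbrakk>x \<in> carrier G; y \<in> carrier G\<rbrakk> \<Longrightarrow> g (x \<otimes>\<^bsub>G\<^esub> y) = g x + (g y :: int)"
    and bdd: "\<And>S. compactin T S \<Longrightarrow> \<exists>c. \<forall>s\<in>S. \<bar>f s\<bar> \<le> c \<and> \<bar>g s\<bar> \<le> c"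
    and xy: "x \<in> carrier G" "y \<in> carrier G" "x \<otimes>\<^bsub>G\<^esub> y = y \<otimes>\<^bsub>G\<^esub> x" "f x * g y - g x * f y \<noteq> 0"
  shows "quadratic_dehn_function G T"
  unfolding quadratic_dehn_function_def has_dehn_growth_def
proof (intro allI impI)
  interpret group G using G by (simp add: locally_compact_group_def)
  fix S assume S: "compact_symmetric_generating G T S"
  note Sp = compact_symmetric_generating_props[OF S]
  have "\<exists>l0 C. \<forall>l\<ge>l0. \<forall>w\<in>relations G S.
      product_of_conjugates S {r \<in> relations G S. length r \<le> l} (C * (length w + 1)\<^sup>2) w"
    by (rule area_bound_any_generating_set[OF G S S0]) simp
  then obtain l0 C where C: "\<forall>l\<ge>l0. \<forall>w\<in>relations G S.
      product_of_conjugates S {r \<in> relations G S. length r \<le> l} (C * (length w + 1)\<^sup>2) w"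
    by (elim exE)
  obtain c where c0: "\<forall>s\<in>S. \<bar>f s\<bar> \<le> c \<and> \<bar>g s\<bar> \<le> c" using bdd[OF Sp(4)] ..
  have c: "\<bar>f s\<bar> \<le> max c 0" "\<bar>g s\<bar> \<le> max c 0" if "s \<in> S" for s
    by (rule max.coboundedI1, use bspec[OF c0 that] in simp)+
  have "\<exists>u\<in>words S. word_eval G u = z" if "z \<in> carrier G" for z
  proof -
    have "z \<in> generate G S" using Sp(3) that by simp
    then obtain w where w: "w \<in> lists S" "list_prod G w = z" using generate_lists Sp(1,2) by blast
    then show ?thesis using word_eval_map_pos[of w]
      by (intro bexI[of _ "map (\<lambda>s. (s, True)) w"]) (auto simp: words_def)
  qed
  then obtain u v where uv: "u \<in> words S" "word_eval G u = x" "v \<in> words S" "word_eval G v = y"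
    using xy(1,2) by blast
  have "growth_equiv (dehn_function G S l) (\<lambda>n. ereal (n\<^sup>2))" if l: "l \<ge> l0" for l
  proof (rule growth_equiv_quadratic)
    show "product_of_conjugates S {r \<in> relations G S. length r \<le> l} (C * (length w + 1)\<^sup>2) w"
      if "w \<in> relations G S" for w using C l that by blast
    show "0 < nat ((max c 0)\<^sup>2) * l\<^sup>2 + 1" by simp
    show "\<exists>w\<in>relations G S. length w \<le> (2 * (length u + length v)) * k \<and>
      (\<forall>m. product_of_conjugates S {r \<in> relations G S. length r \<le> l} m w \<longrightarrow>
        k\<^sup>2 \<le> m * (nat ((max c 0)\<^sup>2) * l\<^sup>2 + 1))" for k
    proof (rule dehn_quadratic_lower_bound[where f = f and g = g and c = "max c 0"])
      show "f (x \<otimes>\<^bsub>G\<^esub> y) = f x + f y" "g (x \<otimes>\<^bsub>G\<^esub> y) = g x + g y"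
        if "x \<in> carrier G" "y \<in> carrier G" for x y using hom that by blast+
      show "S \<subseteq> carrier G" "u \<in> words S" "v \<in> words S" by fact+
      show "\<bar>f s\<bar> \<le> max c 0" "\<bar>g s\<bar> \<le> max c 0" if "s \<in> S" for s using c that by blast+
      show "word_eval G u \<otimes>\<^bsub>G\<^esub> word_eval G v = word_eval G v \<otimes>\<^bsub>G\<^esub> word_eval G u"
        unfolding uv by (rule xy(3))
      show "f (word_eval G u) * g (word_eval G v) - g (word_eval G u) * f (word_eval G v) \<noteq> 0"
        unfolding uv by (rule xy(4))
    qed (rule max.cobounded2)
  qed
  then show "\<exists>l0. \<forall>l\<ge>l0. growth_equiv (dehn_function G S l) (\<lambda>n. ereal (n\<^sup>2))" by blast
qed

section \<open>Topology of normed fields\<close>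

context normed_field
begin

lemma norm_one: "N \<one> = 1"
  using norm_mult[of \<one> \<one>] norm_eq_zero_iff[of \<one>] by simp

lemma norm_zero [simp]: "N \<zero> = 0"
  using norm_eq_zero_iff[of \<zero>] by simp

text \<open>The norm of minus one is a nonnegative real number with square 1.\<close>

lemma norm_minus: "x \<in> carrier K \<Longrightarrow> N (\<ominus> x) = N x"
proof -
  assume x: "x \<in> carrier K"
  have "N (\<ominus> \<one>) * N (\<ominus> \<one>) = 1" using norm_mult[of "\<ominus> \<one>" "\<ominus> \<one>"] norm_one by (simp add: l_minus)
  then have "N (\<ominus> \<one>) = 1" using norm_nonneg[of "\<ominus> \<one>"] by (simp add: square_eq_1_iff)
  then show ?thesis using norm_mult[of "\<ominus> \<one>" x] x by (simp add: l_minus)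
qed

lemma norm_pow: "x \<in> carrier K \<Longrightarrow> N (x [^] (n::nat)) = N x ^ n"
  by (induction n) (auto simp: norm_one norm_mult)

lemma metric: "Metric_space (carrier K) (norm_dist K N)"
proof
  show "0 \<le> norm_dist K N x y" for x y by (simp add: norm_dist_def norm_nonneg)
  show "norm_dist K N x y = norm_dist K N y x" for x y
  proof (cases "x \<in> carrier K \<and> y \<in> carrier K")
    case True
    then have "\<ominus> (x \<ominus> y) = y \<ominus> x" by (simp add: minus_eq minus_add a_comm)
    then show ?thesis using True norm_minus[of "x \<ominus> y"] by (simp add: norm_dist_def)
  qed (auto simp: norm_dist_def)
  show "norm_dist K N x y = 0 \<longleftrightarrow> x = y" if "x \<in> carrier K" "y \<in> carrier K" for x y
    using that norm_eq_zero_iff[of "x \<ominus> y"] by (simp add: norm_dist_def)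
  show "norm_dist K N x z \<le> norm_dist K N x y + norm_dist K N y z"
    if "x \<in> carrier K" "y \<in> carrier K" "z \<in> carrier K" for x y z
  proof -
    have "(x \<ominus> y) \<oplus> (y \<ominus> z) = x \<ominus> z" using that by (simp add: minus_eq a_assoc r_neg1)
    then show ?thesis using norm_triangle[of "x \<ominus> y" "y \<ominus> z"] that by (simp add: norm_dist_def)
  qed
qed

sublocale metric: Metric_space "carrier K" "norm_dist K N"
  by (rule metric)

abbreviation "ntop \<equiv> norm_topology K N"

lemma topspace_norm_topology [simp]: "topspace ntop = carrier K"
  by (simp add: norm_topology_def)

lemma Hausdorff_norm_topology: "Hausdorff_space ntop"
  by (simp add: norm_topology_def metric.Hausdorff_space_mtopology)

lemma in_mball: "y \<in> metric.mball x r \<longleftrightarrow> x \<in> carrier K \<and> y \<in> carrier K \<and> N (x \<ominus> y) < r"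
  by (auto simp: metric.mball_def norm_dist_def)

lemma continuous_norm_topologyD:
  assumes "continuous_map T ntop f" "x \<in> topspace T" "0 < e"
  shows "\<exists>U. openin T U \<and> x \<in> U \<and> (\<forall>y\<in>U. f y \<in> carrier K \<and> N (f x \<ominus> f y) < e)"
proof -
  have "\<exists>U. openin T U \<and> x \<in> U \<and> (\<forall>y\<in>U. f y \<in> metric.mball (f x) e)"
    using assms unfolding norm_topology_def metric.continuous_map_to_metric by blast
  then show ?thesis unfolding in_mball by blast
qed

lemma continuous_norm_topologyI:
  assumes "\<And>x. x \<in> topspace T \<Longrightarrow> f x \<in> carrier K"
    and "\<And>x e. \<lbrakk>x \<in> topspace T; 0 < e\<rbrakk> \<Longrightarrow> \<exists>U. openin T U \<and> x \<in> U \<and> (\<forall>y\<in>U. N (f x \<ominus> f y) < e)"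
  shows "continuous_map T ntop f"
  unfolding norm_topology_def metric.continuous_map_to_metric
proof (intro ballI allI impI)
  fix x and e :: real assume x: "x \<in> topspace T" "0 < e"
  then obtain U where U: "openin T U" "x \<in> U" "\<forall>y\<in>U. N (f x \<ominus> f y) < e" using assms(2) by blast
  then have "\<forall>y\<in>U. f y \<in> metric.mball (f x) e"
    using assms(1) x openin_subset[OF U(1)] by (auto simp: norm_dist_def)
  then show "\<exists>U. openin T U \<and> x \<in> U \<and> (\<forall>y\<in>U. f y \<in> metric.mball (f x) e)" using U by blast
qed

lemma continuous_map_range:
  "\<lbrakk>continuous_map T ntop f; x \<in> topspace T\<rbrakk> \<Longrightarrow> f x \<in> carrier K"
  by (metis continuous_map_funspace Pi_mem topspace_norm_topology)

lemma continuous_map_field_add: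
  assumes f: "continuous_map T ntop f" and g: "continuous_map T ntop g"
  shows "continuous_map T ntop (\<lambda>x. f x \<oplus> g x)"
proof (rule continuous_norm_topologyI)
  fix x and e :: real assume x: "x \<in> topspace T" and e: "0 < e"
  obtain U where U: "openin T U" "x \<in> U" "\<forall>y\<in>U. f y \<in> carrier K \<and> N (f x \<ominus> f y) < e / 2"
    using continuous_norm_topologyD[OF f x, of "e / 2"] e by auto
  obtain V where V: "openin T V" "x \<in> V" "\<forall>y\<in>V. g y \<in> carrier K \<and> N (g x \<ominus> g y) < e / 2"
    using continuous_norm_topologyD[OF g x, of "e / 2"] e by auto
  have "N ((f x \<oplus> g x) \<ominus> (f y \<oplus> g y)) < e" if "y \<in> U \<inter> V" for y
  proof -
    have c: "f x \<in> carrier K" "g x \<in> carrier K" "f y \<in> carrier K" "g y \<in> carrier K"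
      using continuous_map_range[OF f x] continuous_map_range[OF g x] U V that by auto
    have "(f x \<oplus> g x) \<ominus> (f y \<oplus> g y) = (f x \<ominus> f y) \<oplus> (g x \<ominus> g y)"
      using c by (simp add: minus_eq minus_add a_ac)
    then show ?thesis
      using norm_triangle[of "f x \<ominus> f y" "g x \<ominus> g y"] c bspec[OF U(3), of y] bspec[OF V(3), of y] that
      by simp
  qed
  then show "\<exists>U. openin T U \<and> x \<in> U \<and> (\<forall>y\<in>U. N ((f x \<oplus> g x) \<ominus> (f y \<oplus> g y)) < e)"
    using U V by (intro exI[of _ "U \<inter> V"]) auto
qed (use continuous_map_range[OF f] continuous_map_range[OF g] in auto)

lemma continuous_map_field_mult:
  assumes f: "continuous_map T ntop f" and g: "continuous_map T ntop g"
  shows "continuous_map T ntop (\<lambda>x. f x \<otimes> g x)"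
proof (rule continuous_norm_topologyI)
  fix x and e :: real assume x: "x \<in> topspace T" and e: "0 < e"
  have fx: "f x \<in> carrier K" "g x \<in> carrier K" using continuous_map_range[OF f x] continuous_map_range[OF g x] by auto
  define D where "D = N (f x) + N (g x) + 1"
  have D: "1 \<le> D" using norm_nonneg fx by (simp add: D_def)
  define d where "d = min 1 (e / (2 * D))"
  have d: "0 < d" "d \<le> 1" "d * D < e"
  proof -
    show "0 < d" "d \<le> 1" using e D by (auto simp: d_def)
    have "d * D \<le> e / (2 * D) * D" using D by (intro mult_right_mono) (auto simp: d_def)
    also have "\<dots> < e" using e D by simp
    finally show "d * D < e" .
  qed
  obtain U where U: "openin T U" "x \<in> U" "\<forall>y\<in>U. f y \<in> carrier K \<and> N (f x \<ominus> f y) < d"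
    using continuous_norm_topologyD[OF f x d(1)] by auto
  obtain V where V: "openin T V" "x \<in> V" "\<forall>y\<in>V. g y \<in> carrier K \<and> N (g x \<ominus> g y) < d"
    using continuous_norm_topologyD[OF g x d(1)] by auto
  have "N ((f x \<otimes> g x) \<ominus> (f y \<otimes> g y)) < e" if "y \<in> U \<inter> V" for y
  proof -
    have c: "f y \<in> carrier K" "g y \<in> carrier K" and lt: "N (f x \<ominus> f y) < d" "N (g x \<ominus> g y) < d"
      using U V that by auto
    have "(f x \<otimes> g x) \<ominus> (f y \<otimes> g y) = ((f x \<ominus> f y) \<otimes> g x) \<oplus> (f y \<otimes> (g x \<ominus> g y))"
      using fx c by (simp add: minus_eq l_distr r_distr l_minus r_minus a_assoc r_neg1)
    then have "N ((f x \<otimes> g x) \<ominus> (f y \<otimes> g y)) \<le> N (f x \<ominus> f y) * N (g x) + N (f y) * N (g x \<ominus> g y)"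
      using norm_triangle[of "(f x \<ominus> f y) \<otimes> g x" "f y \<otimes> (g x \<ominus> g y)"] fx c by (simp add: norm_mult)
    moreover have "N (f y) \<le> N (f x) + 1"
    proof -
      have "f y = f x \<oplus> \<ominus> (f x \<ominus> f y)" using fx c by (simp add: minus_eq minus_add r_neg1 r_neg2)
      then have "N (f y) \<le> N (f x) + N (f x \<ominus> f y)"
        using norm_triangle[of "f x" "\<ominus> (f x \<ominus> f y)"] norm_minus[of "f x \<ominus> f y"] fx c by simp
      then show ?thesis using lt d by simp
    qed
    then have "N (f y) * N (g x \<ominus> g y) \<le> (N (f x) + 1) * d"
      using lt c fx norm_nonneg by (intro mult_mono) auto
    moreover have "N (f x \<ominus> f y) * N (g x) \<le> d * N (g x)"
      using lt fx norm_nonneg by (intro mult_right_mono) auto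
    ultimately have "N ((f x \<otimes> g x) \<ominus> (f y \<otimes> g y)) \<le> d * D" by (simp add: D_def algebra_simps)
    then show ?thesis using d(3) by simp
  qed
  then show "\<exists>U. openin T U \<and> x \<in> U \<and> (\<forall>y\<in>U. N ((f x \<otimes> g x) \<ominus> (f y \<otimes> g y)) < e)"
    using U V by (intro exI[of _ "U \<inter> V"]) auto
qed (use continuous_map_range[OF f] continuous_map_range[OF g] in auto)

text \<open>A compact neighbourhood of zero contains a small closed ball, and multiplication by a
  high power of the inverse of \<open>c\<close> stretches it over any given ball. In the application
  \<open>c\<close> is the scalar by which a contraction acts.\<close>

lemma compactin_ball:
  assumes lc: "locally_compact_space ntop" and c: "c \<in> carrier K" "0 < N c" "N c < 1"
  shows "compactin ntop {x \<in> carrier K. N x \<le> r}"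
proof -
  have ball_closed: "closedin ntop {x \<in> carrier K. N x \<le> r}" for r
  proof -
    have "{x \<in> carrier K. N x \<le> r} = metric.mcball \<zero> r"
      using norm_minus by (auto simp: metric.mcball_def norm_dist_def minus_eq)
    then show ?thesis by (simp add: norm_topology_def)
  qed
  obtain U C where U: "openin ntop U" "compactin ntop C" "\<zero> \<in> U" "U \<subseteq> C"
    using lc unfolding locally_compact_space_def by (metis topspace_norm_topology zero_closed)
  obtain e where e: "0 < e" "metric.mball \<zero> e \<subseteq> U"
    using U(1,3) by (auto simp: norm_topology_def metric.openin_mtopology)
  have small: "compactin ntop {x \<in> carrier K. N x \<le> e / 2}"
  proof (rule closed_compactin[OF U(2) _ ball_closed])
    have "x \<in> metric.mball \<zero> e" if "x \<in> carrier K" "N x \<le> e / 2" for x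
      using that e(1) norm_minus[OF that(1)] unfolding in_mball by (simp add: minus_eq)
    then show "{x \<in> carrier K. N x \<le> e / 2} \<subseteq> C" using e(2) U(4) by blast
  qed
  have "(\<lambda>n. N c ^ n) \<longlonglongrightarrow> 0" using c by (intro LIMSEQ_realpow_zero) auto
  then have "(\<lambda>n. N c ^ n * r) \<longlonglongrightarrow> 0 * r" by (intro tendsto_mult tendsto_const)
  then have "eventually (\<lambda>n. N c ^ n * r < e / 2) sequentially"
    using e(1) by (intro order_tendstoD(2)[of _ "0 * r"]) auto
  then obtain n where n: "N c ^ n * r < e / 2" by (auto simp: eventually_sequentially)
  have cn: "c [^] n \<in> Units K" 
    using c norm_pow[OF c(1), of n] by (auto simp: field_Units)
  let ?d = "inv (c [^] n)"
  have dK: "?d \<in> carrier K" using cn by simp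
  have "continuous_map ntop ntop (\<lambda>x. ?d \<otimes> x)"
    using dK by (intro continuous_map_field_mult) auto
  from image_compactin[OF small this]
  have "compactin ntop ((\<lambda>x. ?d \<otimes> x) ` {x \<in> carrier K. N x \<le> e / 2})" .
  moreover have "{x \<in> carrier K. N x \<le> r} \<subseteq> (\<lambda>x. ?d \<otimes> x) ` {x \<in> carrier K. N x \<le> e / 2}"
  proof
    fix x assume x: "x \<in> {x \<in> carrier K. N x \<le> r}"
    have "N (c [^] n \<otimes> x) \<le> N c ^ n * r"
      using x c by (simp add: norm_mult norm_pow mult_left_mono)
    then have "c [^] n \<otimes> x \<in> {x \<in> carrier K. N x \<le> e / 2}" using n x c by simp
    moreover have "x = ?d \<otimes> (c [^] n \<otimes> x)" using x cn c by (simp flip: m_assoc)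
    ultimately show "x \<in> (\<lambda>x. ?d \<otimes> x) ` {x \<in> carrier K. N x \<le> e / 2}" by blast
  qed
  ultimately show ?thesis using ball_closed by (rule closed_compactin)
qed

end

section \<open>The semidirect product\<close>

lemma semidirect_product_group:
  assumes V: "group V" and A: "group A"
    and hom: "\<And>a. a \<in> carrier A \<Longrightarrow> \<phi> a \<in> hom V V"
    and one: "\<And>v. v \<in> carrier V \<Longrightarrow> \<phi> \<one>\<^bsub>A\<^esub> v = v"
    and mult: "\<And>a b v. \<lbrakk>a \<in> carrier A; b \<in> carrier A; v \<in> carrier V\<rbrakk> \<Longrightarrow> \<phi> (a \<otimes>\<^bsub>A\<^esub> b) v = \<phi> a (\<phi> b v)"
  shows "group (semidirect_product V A \<phi>)"
proof -
  interpret V: group V by fact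
  interpret A: group A by fact
  have closed: "\<phi> a v \<in> carrier V" if "a \<in> carrier A" "v \<in> carrier V" for a v
    using hom_in_carrier[OF hom] that by blast
  show ?thesis
  proof (rule groupI)
    fix x assume "x \<in> carrier (semidirect_product V A \<phi>)"
    then obtain v a where x: "x = (v, a)" "v \<in> carrier V" "a \<in> carrier A"
      by (auto simp: semidirect_product_def)
    let ?y = "(\<phi> (inv\<^bsub>A\<^esub> a) (inv\<^bsub>V\<^esub> v), inv\<^bsub>A\<^esub> a)"
    have "\<phi> (inv\<^bsub>A\<^esub> a) (inv\<^bsub>V\<^esub> v) \<otimes>\<^bsub>V\<^esub> \<phi> (inv\<^bsub>A\<^esub> a) v = \<phi> (inv\<^bsub>A\<^esub> a) \<one>\<^bsub>V\<^esub>"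
      using hom_mult[OF hom, of "inv\<^bsub>A\<^esub> a" "inv\<^bsub>V\<^esub> v" v] x by simp
    also have "\<dots> = \<one>\<^bsub>V\<^esub>" using hom_one[OF hom V V] x by simp
    finally show "\<exists>y\<in>carrier (semidirect_product V A \<phi>).
        y \<otimes>\<^bsub>semidirect_product V A \<phi>\<^esub> x = \<one>\<^bsub>semidirect_product V A \<phi>\<^esub>"
      using x closed by (intro bexI[of _ ?y]) (auto simp: semidirect_product_def)
  next
    fix x y z assume "x \<in> carrier (semidirect_product V A \<phi>)" "y \<in> carrier (semidirect_product V A \<phi>)"
      "z \<in> carrier (semidirect_product V A \<phi>)"
    then show "x \<otimes>\<^bsub>semidirect_product V A \<phi>\<^esub> y \<otimes>\<^bsub>semidirect_product V A \<phi>\<^esub> z =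
        x \<otimes>\<^bsub>semidirect_product V A \<phi>\<^esub> (y \<otimes>\<^bsub>semidirect_product V A \<phi>\<^esub> z)"
      using hom_mult[OF hom] closed
      by (auto simp: semidirect_product_def V.m_assoc A.m_assoc mult)
  qed (auto simp: semidirect_product_def closed one)
qed

section \<open>Coordinates in the semidirect product\<close>

locale scalar_semidirect_setup = A: comm_group A for A :: "'a monoid" (structure) +
  fixes m :: nat and k :: "nat \<Rightarrow> nat" and F :: "nat \<Rightarrow> nat \<Rightarrow> 'k ring"
    and N :: "nat \<Rightarrow> nat \<Rightarrow> 'k \<Rightarrow> real" and \<rho> :: "nat \<Rightarrow> nat \<Rightarrow> 'a \<Rightarrow> 'k"
  assumes fg: "finitely_generated A"
    and fields: "\<And>i j. \<lbrakk>i \<in> {1..m}; j \<in> {1..k i}\<rbrakk> \<Longrightarrow> local_field (F i j) (N i j)"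
    and \<rho>_hom: "\<And>i j. \<lbrakk>i \<in> {1..m}; j \<in> {1..k i}\<rbrakk> \<Longrightarrow> \<rho> i j \<in> hom A (Multiplicative_Group.mult_of (F i j))"
    and contraction: "\<And>i i'. \<lbrakk>i \<in> {1..m}; i' \<in> {1..m}\<rbrakk> \<Longrightarrow>
           \<exists>a \<in> carrier A. (\<forall>j \<in> {1..k i}. N i j (\<rho> i j a) < 1) \<and>
                            (\<forall>j \<in> {1..k i'}. N i' j (\<rho> i' j a) < 1)"
begin

text \<open>The admissible pairs of indices; equations in the group are checked at each such pair,
  inside a single field.\<close>

definition idx :: "nat \<Rightarrow> nat \<Rightarrow> bool" where
  "idx i j \<longleftrightarrow> i \<in> {1..m} \<and> j \<in> {1..k i}"

definition vectors :: "(nat \<Rightarrow> nat \<Rightarrow> 'k) set" where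
  "vectors = (\<Pi>\<^sub>E i\<in>{1..m}. \<Pi>\<^sub>E j\<in>{1..k i}. carrier (F i j))"

abbreviation G where "G \<equiv> scalar_semidirect m k F \<rho> A"
abbreviation Top where "Top \<equiv> scalar_semidirect_topology m k F N A"

lemma local_field_idx: "idx i j \<Longrightarrow> local_field (F i j) (N i j)"
  by (simp add: idx_def fields)

lemma normed_field_idx: "idx i j \<Longrightarrow> normed_field (F i j) (N i j)"
  using local_field_idx by (blast dest: local_field.axioms)

lemma field_idx: "idx i j \<Longrightarrow> field (F i j)"
  using normed_field_idx by (blast dest: normed_field.axioms)

lemma ring_idx: "idx i j \<Longrightarrow> ring (F i j)"
  using field_idx field.axioms domain.axioms cring.axioms by blast

lemma \<rho>_idx:
  assumes "idx i j" "a \<in> carrier A"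
  shows "\<rho> i j a \<in> carrier (F i j)" "\<rho> i j a \<noteq> \<zero>\<^bsub>F i j\<^esub>"
  using hom_in_carrier[OF \<rho>_hom, of i j a] assms by (auto simp: idx_def)

lemma \<rho>_mult:
  assumes "idx i j" "a \<in> carrier A" "b \<in> carrier A"
  shows "\<rho> i j (a \<otimes> b) = \<rho> i j a \<otimes>\<^bsub>F i j\<^esub> \<rho> i j b"
  using hom_mult[OF \<rho>_hom, of i j a b] assms by (simp add: idx_def)

lemma \<rho>_one:
  assumes "idx i j"
  shows "\<rho> i j \<one> = \<one>\<^bsub>F i j\<^esub>"
  using hom_one[OF \<rho>_hom A.is_group field.field_mult_group[OF field_idx[OF assms]]] assms
  by (simp add: idx_def)

lemma vectors_eqI:
  assumes "v \<in> vectors" "w \<in> vectors" "\<And>i j. idx i j \<Longrightarrow> v i j = w i j"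
  shows "v = w"
proof (rule PiE_ext[OF assms(1,2)[unfolded vectors_def]])
  fix i assume i: "i \<in> {1..m}"
  then have "v i \<in> (\<Pi>\<^sub>E j\<in>{1..k i}. carrier (F i j))" "w i \<in> (\<Pi>\<^sub>E j\<in>{1..k i}. carrier (F i j))"
    using assms(1,2) unfolding vectors_def by blast+
  then show "v i = w i" using assms(3) i by (intro PiE_ext) (auto simp: idx_def)
qed

lemma vectors_comp: "\<lbrakk>v \<in> vectors; idx i j\<rbrakk> \<Longrightarrow> v i j \<in> carrier (F i j)"
  unfolding vectors_def idx_def by (meson PiE_mem)

lemma vectorsI:
  assumes "\<And>i j. idx i j \<Longrightarrow> f i j \<in> carrier (F i j)"
  shows "(\<lambda>i\<in>{1..m}. \<lambda>j\<in>{1..k i}. f i j) \<in> vectors"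
  unfolding vectors_def using assms by (auto simp: idx_def)

abbreviation V where "V \<equiv> product_group {1..m} (summand k F)"

lemma carrier_V: "carrier V = vectors"
  by (simp add: vectors_def summand_def)

lemma mult_V: "idx i j \<Longrightarrow> (v \<otimes>\<^bsub>V\<^esub> w) i j = v i j \<oplus>\<^bsub>F i j\<^esub> w i j"
  by (simp add: summand_def idx_def)

lemma one_V: "idx i j \<Longrightarrow> \<one>\<^bsub>V\<^esub> i j = \<zero>\<^bsub>F i j\<^esub>"
  by (simp add: summand_def idx_def)

lemma group_V: "group V"
proof (rule product_group)
  fix i assume i: "i \<in> {1..m}"
  show "group (summand k F i)" unfolding summand_def
  proof (rule product_group)
    fix j assume "j \<in> {1..k i}"
    then have "ring (F i j)" using i by (intro ring_idx) (simp add: idx_def)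
    then show "group (add_monoid (F i j))" using abelian_group.a_group ring.is_abelian_group comm_group.axioms(2) by blast
  qed
qed

lemma scalar_action_comp: "idx i j \<Longrightarrow> scalar_action m k F \<rho> a v i j = \<rho> i j a \<otimes>\<^bsub>F i j\<^esub> v i j"
  by (simp add: scalar_action_def idx_def)

lemma scalar_action_vectors:
  assumes "a \<in> carrier A" "v \<in> vectors"
  shows "scalar_action m k F \<rho> a v \<in> vectors"
  unfolding scalar_action_def
proof (rule vectorsI)
  fix i j assume ij: "idx i j"
  interpret ring "F i j" by (rule ring_idx[OF ij])
  show "\<rho> i j a \<otimes>\<^bsub>F i j\<^esub> v i j \<in> carrier (F i j)" using \<rho>_idx[OF ij assms(1)] vectors_comp[OF assms(2) ij] by simp
qed

lemma group_G: "group G"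
  unfolding scalar_semidirect_def
proof (rule semidirect_product_group[OF group_V A.is_group])
  interpret V: group V by (rule group_V)
  have closed: "v \<otimes>\<^bsub>V\<^esub> w \<in> vectors" if "v \<in> vectors" "w \<in> vectors" for v w
    using V.m_closed that unfolding carrier_V by blast
  fix a assume a: "a \<in> carrier A"
  show "scalar_action m k F \<rho> a \<in> hom V V"
  proof (rule homI)
    show "scalar_action m k F \<rho> a v \<in> carrier V" if "v \<in> carrier V" for v
      using that scalar_action_vectors[OF a] unfolding carrier_V by blast
    fix v w assume vw: "v \<in> carrier V" "w \<in> carrier V"
    then have vw': "v \<in> vectors" "w \<in> vectors" unfolding carrier_V by auto
    show "scalar_action m k F \<rho> a (v \<otimes>\<^bsub>V\<^esub> w) = scalar_action m k F \<rho> a v \<otimes>\<^bsub>V\<^esub> scalar_action m k F \<rho> a w"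
    proof (rule vectors_eqI)
      fix i j assume ij: "idx i j"
      interpret ring "F i j" by (rule ring_idx[OF ij])
      show "scalar_action m k F \<rho> a (v \<otimes>\<^bsub>V\<^esub> w) i j =
          (scalar_action m k F \<rho> a v \<otimes>\<^bsub>V\<^esub> scalar_action m k F \<rho> a w) i j"
        unfolding scalar_action_comp[OF ij] mult_V[OF ij]
        using vectors_comp[OF vw'(1) ij] vectors_comp[OF vw'(2) ij] \<rho>_idx[OF ij a] by (simp add: r_distr)
    qed (use vw' closed scalar_action_vectors[OF a] in blast)+
  qed
next
  fix v assume "v \<in> carrier V"
  then have v: "v \<in> vectors" unfolding carrier_V .
  show "scalar_action m k F \<rho> \<one> v = v"
  proof (rule vectors_eqI[OF scalar_action_vectors[OF A.one_closed v] v])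
    fix i j assume ij: "idx i j"
    interpret ring "F i j" by (rule ring_idx[OF ij])
    show "scalar_action m k F \<rho> \<one> v i j = v i j"
      unfolding scalar_action_comp[OF ij] \<rho>_one[OF ij] using vectors_comp[OF v ij] by simp
  qed
next
  fix a b v assume ab: "a \<in> carrier A" "b \<in> carrier A" and "v \<in> carrier V"
  then have v: "v \<in> vectors" unfolding carrier_V by simp
  show "scalar_action m k F \<rho> (a \<otimes> b) v = scalar_action m k F \<rho> a (scalar_action m k F \<rho> b v)"
  proof (rule vectors_eqI)
    fix i j assume ij: "idx i j"
    interpret ring "F i j" by (rule ring_idx[OF ij])
    show "scalar_action m k F \<rho> (a \<otimes> b) v i j = scalar_action m k F \<rho> a (scalar_action m k F \<rho> b v) i j"
      unfolding scalar_action_comp[OF ij] \<rho>_mult[OF ij ab]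
      using vectors_comp[OF v ij] \<rho>_idx[OF ij] ab by (simp add: m_assoc)
  qed (use ab v scalar_action_vectors in auto)
qed

sublocale G: group G
  by (rule group_G)

lemma carrier_G: "x \<in> carrier G \<longleftrightarrow> fst x \<in> vectors \<and> snd x \<in> carrier A"
  unfolding scalar_semidirect_def semidirect_product_def by (cases x) (simp add: carrier_V del: carrier_product_group One_nat_def)

lemma snd_mult: "snd (x \<otimes>\<^bsub>G\<^esub> y) = snd x \<otimes> snd y"
  unfolding scalar_semidirect_def semidirect_product_def by (simp add: case_prod_beta)

lemma fst_mult: "idx i j \<Longrightarrow> fst (x \<otimes>\<^bsub>G\<^esub> y) i j = fst x i j \<oplus>\<^bsub>F i j\<^esub> \<rho> i j (snd x) \<otimes>\<^bsub>F i j\<^esub> fst y i j"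
  unfolding scalar_semidirect_def semidirect_product_def
  by (simp add: case_prod_beta mult_V scalar_action_comp del: mult_product_group One_nat_def)

lemma fst_one: "idx i j \<Longrightarrow> fst \<one>\<^bsub>G\<^esub> i j = \<zero>\<^bsub>F i j\<^esub>" and snd_one: "snd \<one>\<^bsub>G\<^esub> = \<one>"
  unfolding scalar_semidirect_def semidirect_product_def by (simp_all add: one_V del: one_product_group One_nat_def)

lemma fst_comp: "\<lbrakk>x \<in> carrier G; idx i j\<rbrakk> \<Longrightarrow> fst x i j \<in> carrier (F i j)"
  using carrier_G vectors_comp by blast

lemma snd_closed: "x \<in> carrier G \<Longrightarrow> snd x \<in> carrier A"
  using carrier_G by blast

lemma G_eqI:
  assumes "x \<in> carrier G" "y \<in> carrier G" "snd x = snd y" "\<And>i j. idx i j \<Longrightarrow> fst x i j = fst y i j"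
  shows "x = y"
  using vectors_eqI[of "fst x" "fst y"] assms carrier_G by (auto intro: prod_eqI)

lemma snd_inv: "x \<in> carrier G \<Longrightarrow> snd (inv\<^bsub>G\<^esub> x) = inv (snd x)"
proof -
  assume x: "x \<in> carrier G"
  have "snd (inv\<^bsub>G\<^esub> x) \<otimes> snd x = \<one>" using G.l_inv[OF x] snd_mult[of "inv\<^bsub>G\<^esub> x" x] snd_one by simp
  then show ?thesis using A.inv_equality x snd_closed by (metis G.inv_closed)
qed

lemma fst_inv:
  assumes x: "x \<in> carrier G" and ij: "idx i j"
  shows "fst (inv\<^bsub>G\<^esub> x) i j = \<ominus>\<^bsub>F i j\<^esub> (\<rho> i j (inv (snd x)) \<otimes>\<^bsub>F i j\<^esub> fst x i j)"
proof -
  interpret ring "F i j" by (rule ring_idx[OF ij])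
  have "fst (inv\<^bsub>G\<^esub> x) i j \<oplus>\<^bsub>F i j\<^esub> \<rho> i j (inv (snd x)) \<otimes>\<^bsub>F i j\<^esub> fst x i j = \<zero>\<^bsub>F i j\<^esub>"
    using G.l_inv[OF x] fst_mult[OF ij, of "inv\<^bsub>G\<^esub> x" x] fst_one[OF ij] snd_inv[OF x] by simp
  then show ?thesis
    using fst_comp[OF x ij] fst_comp[OF G.inv_closed[OF x] ij] \<rho>_idx[OF ij A.inv_closed[OF snd_closed[OF x]]]
    by (simp add: minus_equality)
qed

section \<open>The copy of A and its action by scaling\<close>

definition \<iota> :: "'a \<Rightarrow> (nat \<Rightarrow> nat \<Rightarrow> 'k) \<times> 'a" where
  "\<iota> a = (\<one>\<^bsub>V\<^esub>, a)"

lemma snd_\<iota> [simp]: "snd (\<iota> a) = a" and fst_\<iota>: "idx i j \<Longrightarrow> fst (\<iota> a) i j = \<zero>\<^bsub>F i j\<^esub>"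
  unfolding \<iota>_def by (simp_all add: one_V del: one_product_group One_nat_def)

lemma \<iota>_closed: "a \<in> carrier A \<Longrightarrow> \<iota> a \<in> carrier G"
  using group.is_monoid[OF group_V] monoid.one_closed[of V] carrier_V carrier_G by (simp add: \<iota>_def del: one_product_group One_nat_def)

lemma \<iota>_mult: "\<lbrakk>a \<in> carrier A; b \<in> carrier A\<rbrakk> \<Longrightarrow> \<iota> (a \<otimes> b) = \<iota> a \<otimes>\<^bsub>G\<^esub> \<iota> b"
proof (rule G_eqI)
  assume ab: "a \<in> carrier A" "b \<in> carrier A"
  fix i j assume ij: "idx i j"
  interpret ring "F i j" by (rule ring_idx[OF ij])
  show "fst (\<iota> (a \<otimes> b)) i j = fst (\<iota> a \<otimes>\<^bsub>G\<^esub> \<iota> b) i j"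
    using fst_mult[OF ij] fst_\<iota>[OF ij] \<rho>_idx[OF ij ab(1)] by simp
qed (auto simp: \<iota>_closed snd_mult)

lemma \<iota>_hom: "\<iota> \<in> hom A G"
  by (rule homI) (auto simp: \<iota>_closed \<iota>_mult)

lemma \<iota>_inv: "a \<in> carrier A \<Longrightarrow> inv\<^bsub>G\<^esub> (\<iota> a) = \<iota> (inv a)"
  using group_hom.hom_inv[of A G \<iota> a] \<iota>_hom A.is_group group_G
  by (simp add: group_hom_def group_hom_axioms_def)

lemma \<iota>_pow: "a \<in> carrier A \<Longrightarrow> \<iota> a [^]\<^bsub>G\<^esub> (n::nat) = \<iota> (a [^] n)"
  using group_hom.hom_nat_pow[of A G \<iota> a n] \<iota>_hom A.is_group group_G
  by (simp add: group_hom_def group_hom_axioms_def)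

lemma \<iota>_one: "\<iota> \<one> = \<one>\<^bsub>G\<^esub>"
  using hom_one[OF \<iota>_hom A.is_group group_G] .

lemma conj_comp:
  assumes a: "a \<in> carrier A" and x: "x \<in> carrier G" "snd x = \<one>"
  shows "snd (\<iota> a \<otimes>\<^bsub>G\<^esub> x \<otimes>\<^bsub>G\<^esub> inv\<^bsub>G\<^esub> (\<iota> a)) = \<one>"
    "idx i j \<Longrightarrow> fst (\<iota> a \<otimes>\<^bsub>G\<^esub> x \<otimes>\<^bsub>G\<^esub> inv\<^bsub>G\<^esub> (\<iota> a)) i j = \<rho> i j a \<otimes>\<^bsub>F i j\<^esub> fst x i j"
proof -
  show "snd (\<iota> a \<otimes>\<^bsub>G\<^esub> x \<otimes>\<^bsub>G\<^esub> inv\<^bsub>G\<^esub> (\<iota> a)) = \<one>"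
    using a x by (simp add: snd_mult \<iota>_inv)
  assume ij: "idx i j"
  interpret ring "F i j" by (rule ring_idx[OF ij])
  show "fst (\<iota> a \<otimes>\<^bsub>G\<^esub> x \<otimes>\<^bsub>G\<^esub> inv\<^bsub>G\<^esub> (\<iota> a)) i j = \<rho> i j a \<otimes>\<^bsub>F i j\<^esub> fst x i j"
    using a x \<rho>_idx[OF ij] fst_comp[OF x(1) ij] by (simp add: \<iota>_inv fst_mult[OF ij] fst_\<iota>[OF ij] snd_mult)
qed

lemma mult_pure:
  assumes x: "x \<in> carrier G" "snd x = \<one>" and y: "y \<in> carrier G"
  shows "idx i j \<Longrightarrow> fst (x \<otimes>\<^bsub>G\<^esub> y) i j = fst x i j \<oplus>\<^bsub>F i j\<^esub> fst y i j"
proof -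
  assume ij: "idx i j"
  interpret ring "F i j" by (rule ring_idx[OF ij])
  show ?thesis using x fst_comp[OF y ij] by (simp add: fst_mult[OF ij] \<rho>_one[OF ij])
qed

lemma pure_commute:
  assumes "x \<in> carrier G" "snd x = \<one>" "y \<in> carrier G" "snd y = \<one>"
  shows "x \<otimes>\<^bsub>G\<^esub> y = y \<otimes>\<^bsub>G\<^esub> x"
proof (rule G_eqI)
  fix i j assume ij: "idx i j"
  interpret ring "F i j" by (rule ring_idx[OF ij])
  show "fst (x \<otimes>\<^bsub>G\<^esub> y) i j = fst (y \<otimes>\<^bsub>G\<^esub> x) i j"
    using assms mult_pure[OF _ _ _ ij] fst_comp[OF _ ij] by (simp add: a_comm)
qed (use assms in \<open>simp_all add: snd_mult\<close>)

text \<open>The factor by which \<open>a\<close> stretches the field \<open>F i j\<close>; it is a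
  homomorphism from A to the positive reals.\<close>

definition nrm :: "nat \<Rightarrow> nat \<Rightarrow> 'a \<Rightarrow> real" where
  "nrm i j a = N i j (\<rho> i j a)"

lemma nrm_pos: "\<lbrakk>idx i j; a \<in> carrier A\<rbrakk> \<Longrightarrow> 0 < nrm i j a"
  unfolding nrm_def
  using normed_field.norm_nonneg[OF normed_field_idx] normed_field.norm_eq_zero_iff[OF normed_field_idx] \<rho>_idx
  by (metis order_le_less)

lemma nrm_mult: "\<lbrakk>idx i j; a \<in> carrier A; b \<in> carrier A\<rbrakk> \<Longrightarrow> nrm i j (a \<otimes> b) = nrm i j a * nrm i j b"
  unfolding nrm_def by (simp add: \<rho>_mult \<rho>_idx normed_field.norm_mult[OF normed_field_idx])

lemma nrm_one: "idx i j \<Longrightarrow> nrm i j \<one> = 1"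
  unfolding nrm_def by (simp add: \<rho>_one normed_field.norm_one[OF normed_field_idx])

lemma nrm_pow: "\<lbrakk>idx i j; a \<in> carrier A\<rbrakk> \<Longrightarrow> nrm i j (a [^] (n::nat)) = nrm i j a ^ n"
  by (induction n) (auto simp: nrm_one nrm_mult)

lemma nrm_inv: "\<lbrakk>idx i j; a \<in> carrier A\<rbrakk> \<Longrightarrow> nrm i j (inv a) = inverse (nrm i j a)"
  using nrm_mult[of i j a "inv a"] nrm_one[of i j] nrm_pos[of i j a] by (simp add: field_simps)

section \<open>Topology and compact sets\<close>

lemma topspace_Top: "topspace Top = carrier G"
proof -
  have "topspace (norm_topology (F i j) (N i j)) = carrier (F i j)" if "i \<in> {1..m}" "j \<in> {1..k i}" for i j
    using normed_field.topspace_norm_topology[OF normed_field_idx] that by (simp add: idx_def)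
  then have "(\<Pi>\<^sub>E i\<in>{1..m}. \<Pi>\<^sub>E j\<in>{1..k i}. topspace (norm_topology (F i j) (N i j))) = vectors"
    unfolding vectors_def by (intro PiE_cong) auto
  then show ?thesis
    unfolding scalar_semidirect_topology_def by (auto simp: carrier_G)
qed

lemma continuous_map_TopI:
  assumes "\<And>x. x \<in> topspace W \<Longrightarrow> f x \<in> carrier G"
    and "\<And>i j. idx i j \<Longrightarrow> continuous_map W (norm_topology (F i j) (N i j)) (\<lambda>x. fst (f x) i j)"
    and "continuous_map W (discrete_topology (carrier A)) (\<lambda>x. snd (f x))"
  shows "continuous_map W Top f"
proof -
  have vec: "fst (f x) \<in> vectors" if "x \<in> topspace W" for x using assms(1)[OF that] carrier_G by blast
  have ext: "fst (f x) \<in> extensional {1..m}" if "x \<in> topspace W" for x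
    using vec[OF that] unfolding vectors_def PiE_def by simp
  have ext': "fst (f x) i \<in> extensional {1..k i}" if "x \<in> topspace W" "i \<in> {1..m}" for x i
    using PiE_mem[OF vec[OF that(1), unfolded vectors_def] that(2)] unfolding PiE_def by simp
  show ?thesis unfolding scalar_semidirect_topology_def continuous_map_pairwise o_def
    continuous_map_componentwise
  proof (intro conjI ballI)
    fix i j assume "i \<in> {1..m}" "j \<in> {1..k i}"
    then show "continuous_map W (norm_topology (F i j) (N i j)) (\<lambda>x. fst (f x) i j)"
      by (intro assms(2)) (simp add: idx_def)
  qed (use ext ext' assms(3) in blast)+
qed

lemma continuous_map_TopD:
  assumes "continuous_map W Top f"
  shows "idx i j \<Longrightarrow> continuous_map W (norm_topology (F i j) (N i j)) (\<lambda>x. fst (f x) i j)"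
    and "continuous_map W (discrete_topology (carrier A)) (\<lambda>x. snd (f x))"
    and "x \<in> topspace W \<Longrightarrow> f x \<in> carrier G"
  using assms continuous_map_image_subset_topspace[OF assms] topspace_Top
  unfolding scalar_semidirect_topology_def continuous_map_pairwise o_def continuous_map_componentwise
  by (auto simp: idx_def)

lemma continuous_\<rho>:
  assumes ij: "idx i j" and "continuous_map W (discrete_topology (carrier A)) g"
  shows "continuous_map W (norm_topology (F i j) (N i j)) (\<lambda>x. \<rho> i j (g x))"
proof -
  have "continuous_map (discrete_topology (carrier A)) (norm_topology (F i j) (N i j)) (\<rho> i j)"
    using \<rho>_idx[OF ij] normed_field.topspace_norm_topology[OF normed_field_idx[OF ij]] by auto
  from continuous_map_compose[OF assms(2) this] show ?thesis by (simp add: o_def)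
qed

lemma locally_compact_group_G: "locally_compact_group G Top"
  unfolding locally_compact_group_def
proof (intro conjI)
  show "group G" by (rule group_G)
  show "topspace Top = carrier G" by (rule topspace_Top)
  have fst: "continuous_map (prod_topology Top Top) Top fst"
    and snd: "continuous_map (prod_topology Top Top) Top snd"
    by (rule continuous_map_fst, rule continuous_map_snd)
  have disc: "continuous_map (discrete_topology (carrier A)) (discrete_topology (carrier A)) (\<lambda>a. inv a)"
    by auto
  show "continuous_map (prod_topology Top Top) Top (\<lambda>(x, y). x \<otimes>\<^bsub>G\<^esub> y)"
  proof (rule continuous_map_TopI)
    fix i j assume ij: "idx i j"
    interpret normed_field "F i j" "N i j" by (rule normed_field_idx[OF ij])
    show "continuous_map (prod_topology Top Top) ntop (\<lambda>x. fst (case x of (x, y) \<Rightarrow> x \<otimes>\<^bsub>G\<^esub> y) i j)"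
      unfolding case_prod_beta fst_mult[OF ij]
      by (intro continuous_map_field_add continuous_map_field_mult continuous_\<rho>[OF ij]
        continuous_map_TopD(1)[OF fst ij] continuous_map_TopD(1)[OF snd ij] continuous_map_TopD(2)[OF fst])
  next
    have pair: "continuous_map (prod_topology Top Top)
        (prod_topology (discrete_topology (carrier A)) (discrete_topology (carrier A)))
        (\<lambda>x. (snd (fst x), snd (snd x)))"
      by (intro continuous_map_pairedI continuous_map_TopD(2)[OF fst] continuous_map_TopD(2)[OF snd])
    have "continuous_map (prod_topology (discrete_topology (carrier A)) (discrete_topology (carrier A)))
        (discrete_topology (carrier A)) (\<lambda>(a, b). a \<otimes> b)"
      unfolding prod_topology_discrete_topology[symmetric] by auto
    from continuous_map_compose[OF pair this]
    show "continuous_map (prod_topology Top Top) (discrete_topology (carrier A))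
        (\<lambda>x. snd (case x of (x, y) \<Rightarrow> x \<otimes>\<^bsub>G\<^esub> y))"
      by (simp add: o_def case_prod_beta snd_mult)
  qed (auto simp: topspace_Top)
  show "continuous_map Top Top (\<lambda>x. inv\<^bsub>G\<^esub> x)"
  proof (rule continuous_map_TopI)
    have id: "continuous_map Top Top (\<lambda>x. x)" by (rule continuous_map_id[unfolded id_def])
    have inv_A: "continuous_map Top (discrete_topology (carrier A)) (\<lambda>x. inv (snd x))"
      using continuous_map_compose[OF continuous_map_TopD(2)[OF id] disc] by (simp add: o_def)
    fix i j assume ij: "idx i j"
    interpret normed_field "F i j" "N i j" by (rule normed_field_idx[OF ij])
    \<comment> \<open>Negation is written as multiplication by minus one, so that continuity of
      products applies.\<close>
    have "continuous_map Top ntop (\<lambda>x. \<ominus>\<^bsub>F i j\<^esub> \<one>\<^bsub>F i j\<^esub> \<otimes>\<^bsub>F i j\<^esub> (\<rho> i j (inv (snd x)) \<otimes>\<^bsub>F i j\<^esub> fst x i j))"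
      by (intro continuous_map_field_mult continuous_\<rho>[OF ij inv_A] continuous_map_TopD(1)[OF id ij]) simp
    then show "continuous_map Top ntop (\<lambda>x. fst (inv\<^bsub>G\<^esub> x) i j)"
    proof (rule continuous_map_eq)
      fix x assume "x \<in> topspace Top"
      then have x: "x \<in> carrier G" by (simp add: topspace_Top)
      show "\<ominus>\<^bsub>F i j\<^esub> \<one>\<^bsub>F i j\<^esub> \<otimes>\<^bsub>F i j\<^esub> (\<rho> i j (inv (snd x)) \<otimes>\<^bsub>F i j\<^esub> fst x i j) = fst (inv\<^bsub>G\<^esub> x) i j"
        using fst_inv[OF x ij] \<rho>_idx[OF ij A.inv_closed[OF snd_closed[OF x]]] fst_comp[OF x ij]
        by (simp add: l_minus)
    qed
  next
    have id: "continuous_map Top Top (\<lambda>x. x)" by (rule continuous_map_id[unfolded id_def])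
    have "continuous_map Top (discrete_topology (carrier A)) (\<lambda>x. inv (snd x))"
      using continuous_map_compose[OF continuous_map_TopD(2)[OF id] disc] by (simp add: o_def)
    then show "continuous_map Top (discrete_topology (carrier A)) (\<lambda>x. snd (inv\<^bsub>G\<^esub> x))"
      by (rule continuous_map_eq) (simp add: snd_inv topspace_Top)
  qed (simp add: topspace_Top)
  have H: "Hausdorff_space (norm_topology (F i j) (N i j))" "locally_compact_space (norm_topology (F i j) (N i j))"
    if "i \<in> {1..m}" "j \<in> {1..k i}" for i j
    using normed_field.Hausdorff_norm_topology[OF normed_field_idx] local_field.locally_compact[OF local_field_idx] that
    by (auto simp: idx_def)
  show "Hausdorff_space Top"
    unfolding scalar_semidirect_topology_def Hausdorff_space_prod_topology Hausdorff_space_product_topology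
    using H(1) by simp
  show "locally_compact_space Top"
    unfolding scalar_semidirect_topology_def locally_compact_space_prod_topology locally_compact_space_product_topology
    using H(2) by (simp add: locally_compact_space_discrete_topology)
qed

lemma compactin_box:
  assumes C: "\<And>i j. idx i j \<Longrightarrow> compactin (norm_topology (F i j) (N i j)) (C i j)"
    and P: "finite P" "P \<subseteq> carrier A"
  shows "compactin Top {x \<in> carrier G. snd x \<in> P \<and> (\<forall>i j. idx i j \<longrightarrow> fst x i j \<in> C i j)}"
proof -
  have C_sub: "C i j \<subseteq> carrier (F i j)" if "idx i j" for i j
    using compactin_subset_topspace[OF C[OF that]] normed_field.topspace_norm_topology[OF normed_field_idx[OF that]] by simp
  have "{x \<in> carrier G. snd x \<in> P \<and> (\<forall>i j. idx i j \<longrightarrow> fst x i j \<in> C i j)} =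
      (\<Pi>\<^sub>E i\<in>{1..m}. \<Pi>\<^sub>E j\<in>{1..k i}. C i j) \<times> P" (is "?L = ?R")
  proof (rule subset_antisym; rule subsetI)
    fix x assume x: "x \<in> ?L"
    then have vec: "fst x \<in> (\<Pi>\<^sub>E i\<in>{1..m}. \<Pi>\<^sub>E j\<in>{1..k i}. carrier (F i j))"
      and mem: "\<And>i j. idx i j \<Longrightarrow> fst x i j \<in> C i j" and snd: "snd x \<in> P"
      using carrier_G[of x] unfolding vectors_def by simp_all
    have "fst x \<in> (\<Pi>\<^sub>E i\<in>{1..m}. \<Pi>\<^sub>E j\<in>{1..k i}. C i j)"
    proof (rule PiE_I)
      fix i assume i: "i \<in> {1..m}"
      show "fst x i \<in> (\<Pi>\<^sub>E j\<in>{1..k i}. C i j)"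
      proof (rule PiE_I)
        show "fst x i j \<in> C i j" if "j \<in> {1..k i}" for j using mem i that by (simp add: idx_def)
        show "fst x i j = undefined" if "j \<notin> {1..k i}" for j
          by (rule PiE_arb[OF PiE_mem[OF vec i] that])
      qed
    qed (rule PiE_arb[OF vec])
    then show "x \<in> ?R" using snd by (simp add: mem_Times_iff)
  next
    fix x assume "x \<in> ?R"
    then have x: "fst x \<in> (\<Pi>\<^sub>E i\<in>{1..m}. \<Pi>\<^sub>E j\<in>{1..k i}. C i j)" "snd x \<in> P"
      by (simp_all only: mem_Times_iff)
    have mem: "fst x i j \<in> C i j" if "idx i j" for i j
      using PiE_mem[OF PiE_mem[OF x(1)]] that unfolding idx_def by blast
    have "(\<Pi>\<^sub>E i\<in>{1..m}. \<Pi>\<^sub>E j\<in>{1..k i}. C i j) \<subseteq> vectors"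
      unfolding vectors_def using C_sub by (intro PiE_mono) (simp add: idx_def)
    then have "x \<in> carrier G" using x P(2) unfolding carrier_G by blast
    then show "x \<in> ?L" using x(2) mem by simp
  qed
  moreover have "compactin (product_topology (\<lambda>i. product_topology (\<lambda>j. norm_topology (F i j) (N i j)) {1..k i}) {1..m})
      (\<Pi>\<^sub>E i\<in>{1..m}. \<Pi>\<^sub>E j\<in>{1..k i}. C i j)"
    unfolding compactin_PiE using C by (simp add: idx_def)
  ultimately show ?thesis
    using P by (simp add: scalar_semidirect_topology_def compactin_Times compactin_discrete_topology)
qed

text \<open>The projection to A is continuous into a discrete space, where compact sets are
  finite.\<close>

lemma compactin_finite_snd: "compactin Top S \<Longrightarrow> finite (snd ` S)"
proof -
  assume S: "compactin Top S"
  have "continuous_map Top Top (\<lambda>x. x)" by (rule continuous_map_id[unfolded id_def])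
  from image_compactin[OF S continuous_map_TopD(2)[OF this]] show ?thesis
    by (simp add: compactin_discrete_topology)
qed

text \<open>The contraction hypothesis for the pair (i, i) yields a scalar of norm strictly between
  0 and 1, by which small compact balls are rescaled.\<close>

lemma compactin_field_ball:
  assumes ij: "idx i j"
  shows "compactin (norm_topology (F i j) (N i j)) {x \<in> carrier (F i j). N i j x \<le> r}"
proof -
  obtain a where a: "a \<in> carrier A" "\<forall>j\<in>{1..k i}. N i j (\<rho> i j a) < 1"
    using contraction[of i i] ij by (auto simp: idx_def)
  show ?thesis
  proof (rule normed_field.compactin_ball[OF normed_field_idx[OF ij]])
    show "locally_compact_space (norm_topology (F i j) (N i j))"
      using local_field.locally_compact[OF local_field_idx[OF ij]] .
    show "\<rho> i j a \<in> carrier (F i j)" using \<rho>_idx[OF ij a(1)] by simp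
    show "0 < N i j (\<rho> i j a)" using nrm_pos[OF ij a(1)] by (simp add: nrm_def)
    show "N i j (\<rho> i j a) < 1" using a(2) ij by (simp add: idx_def)
  qed
qed

text \<open>The closed unit ball of the sum of the V_i with i in \<open>I\<close>. For the quadratic
  filling \<open>I\<close> is a singleton, in rank one it is \<open>UNIV\<close>.\<close>

definition ball :: "nat set \<Rightarrow> ((nat \<Rightarrow> nat \<Rightarrow> 'k) \<times> 'a) set" where
  "ball I = {x \<in> carrier G. snd x = \<one> \<and>
     (\<forall>i j. idx i j \<longrightarrow> (if i \<in> I then N i j (fst x i j) \<le> 1 else fst x i j = \<zero>\<^bsub>F i j\<^esub>))}"

lemma compactin_ball: "compactin Top (ball I)"
proof -
  let ?C = "\<lambda>i j. if i \<in> I then {x \<in> carrier (F i j). N i j x \<le> 1} else {\<zero>\<^bsub>F i j\<^esub>}"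
  have "compactin (norm_topology (F i j) (N i j)) (?C i j)" if "idx i j" for i j
    using compactin_field_ball[OF that] normed_field.topspace_norm_topology[OF normed_field_idx[OF that]]
      ring.ring_simprules(2)[OF ring_idx[OF that]] by simp
  from compactin_box[of ?C "{\<one>}", OF this]
  have "compactin Top {x \<in> carrier G. snd x \<in> {\<one>} \<and> (\<forall>i j. idx i j \<longrightarrow> fst x i j \<in> ?C i j)}" by simp
  moreover have "ball I = {x \<in> carrier G. snd x \<in> {\<one>} \<and> (\<forall>i j. idx i j \<longrightarrow> fst x i j \<in> ?C i j)}"
  proof -
    have "(if i \<in> I then N i j (fst x i j) \<le> 1 else fst x i j = \<zero>\<^bsub>F i j\<^esub>) \<longleftrightarrow> fst x i j \<in> ?C i j"
      if "x \<in> carrier G" "idx i j" for x i j using fst_comp[OF that] by simp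
    then show ?thesis unfolding ball_def singleton_iff by (intro Collect_cong) blast
  qed
  ultimately show ?thesis by simp
qed

lemma compactin_\<iota>: "finite P \<Longrightarrow> P \<subseteq> carrier A \<Longrightarrow> compactin Top (\<iota> ` P)"
  by (rule finite_imp_compactin) (auto simp: topspace_Top \<iota>_closed)

end

section \<open>Contraction of unit balls\<close>

lemma eventually_power_le:
  fixes q r :: real
  assumes "0 \<le> q" "q < 1" "0 < r"
  shows "\<exists>n. \<forall>n'\<ge>n. q ^ n' \<le> r"
proof -
  obtain n where "q ^ n < r" using real_arch_pow_inv[OF assms(3,2)] by blast
  then have "q ^ n' \<le> r" if "n' \<ge> n" for n'
    using power_decreasing[OF that assms(1)] assms(2) by simp
  then show ?thesis by blast
qed

context scalar_semidirect_setup
begin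

lemma finite_idx: "finite {(i, j). idx i j}"
proof -
  have "{(i, j). idx i j} = (SIGMA i:{1..m}. {1..k i})" by (auto simp: idx_def)
  then show ?thesis by simp
qed

text \<open>The factor 1/2 is chosen because the sum of two elements of a unit ball has norm at most
  2. As there are finitely many coordinates, one exponent serves them all.\<close>

lemma contracting_power:
  assumes a: "a \<in> carrier A" and lt: "\<And>i j. \<lbrakk>idx i j; i \<in> I\<rbrakk> \<Longrightarrow> nrm i j a < 1"
  shows "\<exists>n. \<forall>i j. idx i j \<longrightarrow> i \<in> I \<longrightarrow> nrm i j (a [^] (n::nat)) \<le> 1 / 2"
proof -
  let ?J = "{(i, j). idx i j} \<inter> {(i, j). i \<in> I}"
  have "\<exists>n. \<forall>x\<in>?J. (\<lambda>(i, j) n. \<forall>n'\<ge>n. nrm i j a ^ n' \<le> 1 / 2) x n"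
  proof (rule finite_uniform_bound)
    show "finite ?J" using finite_idx by simp
    show "\<exists>n. (\<lambda>(i, j) n. \<forall>n'\<ge>n. nrm i j a ^ n' \<le> 1 / 2) x n" if x: "x \<in> ?J" for x
    proof -
      obtain i j where ij: "x = (i, j)" "idx i j" "i \<in> I" using x by auto
      show ?thesis
        using eventually_power_le[of "nrm i j a" "1 / 2"] lt[OF ij(2,3)] nrm_pos[OF ij(2) a] by (simp add: ij(1))
    qed
  qed (auto split: prod.splits)
  then obtain n where "\<forall>x\<in>?J. (\<lambda>(i, j) n. \<forall>n'\<ge>n. nrm i j a ^ n' \<le> 1 / 2) x n" by blast
  then show ?thesis using a by (intro exI[of _ n]) (auto simp: nrm_pow)
qed

text \<open>The origin of \<open>M\<close>: the \<open>M\<close>-th power of an element that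
  contracts by 1/2 outweighs the stretching by every letter of the finite set.\<close>

lemma uniform_multiplier:
  assumes "finite P" "P \<subseteq> carrier A"
  shows "\<exists>M. \<forall>a\<in>P. \<forall>i j. idx i j \<longrightarrow> (1 / 2) ^ M * nrm i j a \<le> 1"
proof -
  let ?J = "P \<times> {(i, j). idx i j}"
  have "\<exists>n. \<forall>x\<in>?J. (\<lambda>(a, i, j) n. \<forall>n'\<ge>n. (1 / 2) ^ n' * nrm i j a \<le> 1) x n"
  proof (rule finite_uniform_bound)
    show "finite ?J" using finite_idx assms by simp
    show "\<exists>n. (\<lambda>(a, i, j) n. \<forall>n'\<ge>n. (1 / 2) ^ n' * nrm i j a \<le> 1) x n" if x: "x \<in> ?J" for x
    proof -
      obtain a i j where ij: "x = (a, i, j)" "idx i j" "a \<in> carrier A" using x assms by auto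
      have pos: "0 < nrm i j a" using nrm_pos[OF ij(2,3)] .
      obtain n where n: "\<forall>n'\<ge>n. (1 / 2) ^ n' \<le> inverse (nrm i j a)"
        using eventually_power_le[of "1 / 2" "inverse (nrm i j a)"] pos by auto
      have "(1 / 2) ^ n' * nrm i j a \<le> 1" if "n' \<ge> n" for n'
        using mult_right_mono[OF n[rule_format, OF that], of "nrm i j a"] pos by simp
      then show ?thesis by (auto simp: ij(1))
    qed
  qed (auto split: prod.splits)
  then obtain n where n: "\<forall>x\<in>?J. (\<lambda>(a, i, j) n. \<forall>n'\<ge>n. (1 / 2) ^ n' * nrm i j a \<le> 1) x n" by blast
  have "(1 / 2) ^ n * nrm i j a \<le> 1" if "a \<in> P" "idx i j" for a i j
    using bspec[OF n, of "(a, i, j)"] that by simp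
  then show ?thesis by blast
qed

definition pure :: "nat set \<Rightarrow> ((nat \<Rightarrow> nat \<Rightarrow> 'k) \<times> 'a) set" where
  "pure I = {x \<in> carrier G. snd x = \<one> \<and> (\<forall>i j. idx i j \<longrightarrow> i \<notin> I \<longrightarrow> fst x i j = \<zero>\<^bsub>F i j\<^esub>)}"

lemma ball_pure: "ball I \<subseteq> pure I"
  by (auto simp: ball_def pure_def)

lemma in_ballI:
  assumes "x \<in> pure I" "\<And>i j. \<lbrakk>idx i j; i \<in> I\<rbrakk> \<Longrightarrow> N i j (fst x i j) \<le> 1"
  shows "x \<in> ball I"
  using assms by (auto simp: ball_def pure_def)

lemma in_ballD: "\<lbrakk>x \<in> ball I; idx i j; i \<in> I\<rbrakk> \<Longrightarrow> N i j (fst x i j) \<le> 1"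
  by (auto simp: ball_def)

lemma pure_carrier: "x \<in> pure I \<Longrightarrow> x \<in> carrier G" "x \<in> pure I \<Longrightarrow> snd x = \<one>"
  "x \<in> pure I \<Longrightarrow> idx i j \<Longrightarrow> i \<notin> I \<Longrightarrow> fst x i j = \<zero>\<^bsub>F i j\<^esub>"
  by (auto simp: pure_def)

lemma norm_scaled:
  assumes "idx i j" "a \<in> carrier A" "y \<in> carrier (F i j)"
  shows "N i j (\<rho> i j a \<otimes>\<^bsub>F i j\<^esub> y) = nrm i j a * N i j y"
  using normed_field.norm_mult[OF normed_field_idx[OF assms(1)]] \<rho>_idx[OF assms(1,2)] assms(3)
  by (simp add: nrm_def)

lemma conj_pure:
  assumes a: "a \<in> carrier A" and x: "x \<in> pure I"
  shows "\<iota> a \<otimes>\<^bsub>G\<^esub> x \<otimes>\<^bsub>G\<^esub> inv\<^bsub>G\<^esub> (\<iota> a) \<in> pure I"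
proof -
  note xp = pure_carrier[OF x]
  have "fst (\<iota> a \<otimes>\<^bsub>G\<^esub> x \<otimes>\<^bsub>G\<^esub> inv\<^bsub>G\<^esub> (\<iota> a)) i j = \<zero>\<^bsub>F i j\<^esub>" if ij: "idx i j" "i \<notin> I" for i j
  proof -
    interpret ring "F i j" by (rule ring_idx[OF ij(1)])
    show ?thesis using conj_comp(2)[OF a xp(1,2) ij(1)] xp(3)[OF ij] \<rho>_idx[OF ij(1) a] by simp
  qed
  then show ?thesis using conj_comp(1)[OF a xp(1,2)] \<iota>_closed[OF a] xp(1) by (simp add: pure_def)
qed

lemma mult_pure_closed:
  assumes "x \<in> pure I" "y \<in> pure I"
  shows "x \<otimes>\<^bsub>G\<^esub> y \<in> pure I"
proof -
  note xp = pure_carrier[OF assms(1)] and yp = pure_carrier[OF assms(2)]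
  have "fst (x \<otimes>\<^bsub>G\<^esub> y) i j = \<zero>\<^bsub>F i j\<^esub>" if ij: "idx i j" "i \<notin> I" for i j
  proof -
    interpret ring "F i j" by (rule ring_idx[OF ij(1)])
    show ?thesis using mult_pure[OF xp(1,2) yp(1) ij(1)] xp(3)[OF ij] yp(3)[OF ij] by simp
  qed
  then show ?thesis using xp yp by (simp add: pure_def snd_mult)
qed

lemma ball_conj:
  assumes a: "a \<in> carrier A" "\<And>i j. \<lbrakk>idx i j; i \<in> I\<rbrakk> \<Longrightarrow> nrm i j a \<le> 1" and x: "x \<in> ball I"
  shows "\<iota> a \<otimes>\<^bsub>G\<^esub> x \<otimes>\<^bsub>G\<^esub> inv\<^bsub>G\<^esub> (\<iota> a) \<in> ball I"
proof (rule in_ballI)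
  have xp: "x \<in> pure I" using x ball_pure by blast
  show "\<iota> a \<otimes>\<^bsub>G\<^esub> x \<otimes>\<^bsub>G\<^esub> inv\<^bsub>G\<^esub> (\<iota> a) \<in> pure I" using conj_pure[OF a(1) xp] .
  fix i j assume ij: "idx i j" "i \<in> I"
  have "nrm i j a * N i j (fst x i j) \<le> 1 * 1"
    using a(2)[OF ij] in_ballD[OF x ij] normed_field.norm_nonneg[OF normed_field_idx[OF ij(1)] fst_comp[OF pure_carrier(1)[OF xp] ij(1)]]
    by (intro mult_mono) auto
  then show "N i j (fst (\<iota> a \<otimes>\<^bsub>G\<^esub> x \<otimes>\<^bsub>G\<^esub> inv\<^bsub>G\<^esub> (\<iota> a)) i j) \<le> 1"
    using conj_comp(2)[OF a(1) pure_carrier(1,2)[OF xp] ij(1)]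
      norm_scaled[OF ij(1) a(1) fst_comp[OF pure_carrier(1)[OF xp] ij(1)]] by simp
qed

lemma ball_conj_mult:
  assumes a: "a \<in> carrier A" "\<And>i j. \<lbrakk>idx i j; i \<in> I\<rbrakk> \<Longrightarrow> nrm i j a \<le> 1 / 2"
    and x: "x \<in> ball I" and y: "y \<in> ball I"
  shows "\<iota> a \<otimes>\<^bsub>G\<^esub> (x \<otimes>\<^bsub>G\<^esub> y) \<otimes>\<^bsub>G\<^esub> inv\<^bsub>G\<^esub> (\<iota> a) \<in> ball I"
proof (rule in_ballI)
  have xp: "x \<in> pure I" and yp: "y \<in> pure I" using x y ball_pure by blast+
  have xyp: "x \<otimes>\<^bsub>G\<^esub> y \<in> pure I" using mult_pure_closed[OF xp yp] .
  show "\<iota> a \<otimes>\<^bsub>G\<^esub> (x \<otimes>\<^bsub>G\<^esub> y) \<otimes>\<^bsub>G\<^esub> inv\<^bsub>G\<^esub> (\<iota> a) \<in> pure I" using conj_pure[OF a(1) xyp] .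
  fix i j assume ij: "idx i j" "i \<in> I"
  interpret normed_field "F i j" "N i j" by (rule normed_field_idx[OF ij(1)])
  note c = fst_comp[OF pure_carrier(1)[OF xp] ij(1)] fst_comp[OF pure_carrier(1)[OF yp] ij(1)]
    fst_comp[OF pure_carrier(1)[OF xyp] ij(1)]
  have "N i j (fst (x \<otimes>\<^bsub>G\<^esub> y) i j) \<le> 2"
    using mult_pure[OF pure_carrier(1,2)[OF xp] pure_carrier(1)[OF yp] ij(1)] norm_triangle[OF c(1,2)]
      in_ballD[OF x ij] in_ballD[OF y ij] by simp
  then have "nrm i j a * N i j (fst (x \<otimes>\<^bsub>G\<^esub> y) i j) \<le> 1 / 2 * 2"
    using a(2)[OF ij] norm_nonneg[OF c(3)] by (intro mult_mono) auto
  then show "N i j (fst (\<iota> a \<otimes>\<^bsub>G\<^esub> (x \<otimes>\<^bsub>G\<^esub> y) \<otimes>\<^bsub>G\<^esub> inv\<^bsub>G\<^esub> (\<iota> a)) i j) \<le> 1"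
    using conj_comp(2)[OF a(1) pure_carrier(1,2)[OF xyp] ij(1)] norm_scaled[OF ij(1) a(1) c(3)] by simp
qed

lemma one_in_ball: "\<one>\<^bsub>G\<^esub> \<in> ball I"
  by (auto simp: ball_def fst_one snd_one normed_field.norm_zero[OF normed_field_idx])

lemma inv_in_ball:
  assumes x: "x \<in> ball I"
  shows "inv\<^bsub>G\<^esub> x \<in> ball I"
proof (rule in_ballI)
  have xp: "x \<in> pure I" using x ball_pure by blast
  have inv: "fst (inv\<^bsub>G\<^esub> x) i j = \<ominus>\<^bsub>F i j\<^esub> (fst x i j)" if ij: "idx i j" for i j
  proof -
    interpret ring "F i j" by (rule ring_idx[OF ij])
    show ?thesis using fst_inv[OF pure_carrier(1)[OF xp] ij] pure_carrier(2)[OF xp]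
      fst_comp[OF pure_carrier(1)[OF xp] ij] by (simp add: \<rho>_one[OF ij])
  qed
  have "fst (inv\<^bsub>G\<^esub> x) i j = \<zero>\<^bsub>F i j\<^esub>" if ij: "idx i j" "i \<notin> I" for i j
  proof -
    interpret ring "F i j" by (rule ring_idx[OF ij(1)])
    show ?thesis using inv[OF ij(1)] pure_carrier(3)[OF xp ij] by simp
  qed
  then show "inv\<^bsub>G\<^esub> x \<in> pure I" using pure_carrier(1,2)[OF xp] by (simp add: pure_def snd_inv)
  fix i j assume ij: "idx i j" "i \<in> I"
  show "N i j (fst (inv\<^bsub>G\<^esub> x) i j) \<le> 1"
    using inv[OF ij(1)] in_ballD[OF x ij] normed_field.norm_minus[OF normed_field_idx[OF ij(1)] fst_comp[OF pure_carrier(1)[OF xp] ij(1)]]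
    by simp
qed

text \<open>Powers of a contraction pull any given vector into the unit ball, so the ball together
  with A generates all vectors.\<close>

lemma absorb_pure:
  assumes t: "t \<in> carrier A" "\<And>i j. \<lbrakk>idx i j; i \<in> I\<rbrakk> \<Longrightarrow> nrm i j t \<le> 1 / 2" and x: "x \<in> pure I"
  shows "\<exists>n. \<iota> (t [^] (n::nat)) \<otimes>\<^bsub>G\<^esub> x \<otimes>\<^bsub>G\<^esub> inv\<^bsub>G\<^esub> (\<iota> (t [^] n)) \<in> ball I"
proof -
  note xp = pure_carrier[OF x]
  let ?Q = "\<lambda>(i, j) n. \<forall>n'\<ge>n. (1 / 2) ^ n' * N i j (fst x i j) \<le> 1"
  have "\<exists>n. \<forall>y\<in>{(i, j). idx i j}. ?Q y n"
  proof (rule finite_uniform_bound[OF finite_idx])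
    fix y assume "y \<in> {(i, j). idx i j}"
    then obtain i j where ij: "y = (i, j)" "idx i j" by auto
    have nn: "0 \<le> N i j (fst x i j)"
      using normed_field.norm_nonneg[OF normed_field_idx[OF ij(2)] fst_comp[OF xp(1) ij(2)]] .
    \<comment> \<open>The added one keeps the bound positive when the coordinate vanishes.\<close>
    obtain n where n: "\<forall>n'\<ge>n. (1 / 2) ^ n' \<le> inverse (N i j (fst x i j) + 1)"
      using eventually_power_le[of "1 / 2" "inverse (N i j (fst x i j) + 1)"] nn by auto
    have "(1 / 2) ^ n' * N i j (fst x i j) \<le> 1" if "n' \<ge> n" for n'
    proof -
      have "(1 / 2) ^ n' * N i j (fst x i j) \<le> inverse (N i j (fst x i j) + 1) * (N i j (fst x i j) + 1)"
        using n that nn by (intro mult_mono) auto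
      also have "\<dots> = 1" using nn by simp
      finally show ?thesis .
    qed
    then show "\<exists>n. ?Q y n" by (auto simp: ij(1))
  qed (auto split: prod.splits)
  then obtain n where n: "\<forall>y\<in>{(i, j). idx i j}. ?Q y n" by blast
  have tn: "t [^] n \<in> carrier A" using t by simp
  have "\<iota> (t [^] n) \<otimes>\<^bsub>G\<^esub> x \<otimes>\<^bsub>G\<^esub> inv\<^bsub>G\<^esub> (\<iota> (t [^] n)) \<in> ball I"
  proof (rule in_ballI[OF conj_pure[OF tn x]])
    fix i j assume ij: "idx i j" "i \<in> I"
    have nn: "0 \<le> N i j (fst x i j)"
      using normed_field.norm_nonneg[OF normed_field_idx[OF ij(1)] fst_comp[OF xp(1) ij(1)]] .
    have "nrm i j (t [^] n) \<le> (1 / 2) ^ n"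
      using nrm_pow[OF ij(1) t(1)] t(2)[OF ij] nrm_pos[OF ij(1) t(1)] by (simp add: power_mono less_imp_le)
    then have "nrm i j (t [^] n) * N i j (fst x i j) \<le> (1 / 2) ^ n * N i j (fst x i j)"
      using nn by (rule mult_right_mono)
    also have "\<dots> \<le> 1" using bspec[OF n, of "(i, j)"] ij(1) by simp
    finally show "N i j (fst (\<iota> (t [^] n) \<otimes>\<^bsub>G\<^esub> x \<otimes>\<^bsub>G\<^esub> inv\<^bsub>G\<^esub> (\<iota> (t [^] n))) i j) \<le> 1"
      using conj_comp(2)[OF tn xp(1,2) ij(1)] norm_scaled[OF ij(1) tn fst_comp[OF xp(1) ij(1)]] by simp
  qed
  then show ?thesis by blast
qed

section \<open>Generating sets made of unit balls and elements of A\<close>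

lemma generate_\<iota>:
  assumes "\<iota> ` Y \<subseteq> S" "S \<subseteq> carrier G" "Y \<subseteq> carrier A" "generate A Y = carrier A" "a \<in> carrier A"
  shows "\<iota> a \<in> generate G S"
proof -
  have "a \<in> generate A Y" using assms by simp
  then show ?thesis
  proof (induction rule: generate.induct)
    case one
    then show ?case using generate.one[of G S] \<iota>_one by simp
  next
    case (incl h)
    then show ?case using assms(1) by (intro generate.incl) auto
  next
    case (inv h)
    then have "\<iota> h \<in> S" "h \<in> carrier A" using assms by auto
    then show ?case using generate.inv[of "\<iota> h" S G] \<iota>_inv by simp
  next
    case (eng h1 h2)
    then have "h1 \<in> carrier A" "h2 \<in> carrier A" using assms(3) A.generate_in_carrier by blast+
    then show ?case using generate.eng[OF eng.IH] \<iota>_mult by simp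
  qed
qed

lemma generate_pure:
  assumes S: "S \<subseteq> carrier G" "ball I \<subseteq> S" "\<iota> ` carrier A \<subseteq> generate G S"
    and t: "t \<in> carrier A" "\<And>i j. \<lbrakk>idx i j; i \<in> I\<rbrakk> \<Longrightarrow> nrm i j t \<le> 1 / 2" and x: "x \<in> pure I"
  shows "x \<in> generate G S"
proof -
  obtain n where n: "\<iota> (t [^] (n::nat)) \<otimes>\<^bsub>G\<^esub> x \<otimes>\<^bsub>G\<^esub> inv\<^bsub>G\<^esub> (\<iota> (t [^] n)) \<in> ball I"
    using absorb_pure[OF t x] by blast
  let ?g = "\<iota> (t [^] n)"
  let ?y = "?g \<otimes>\<^bsub>G\<^esub> x \<otimes>\<^bsub>G\<^esub> inv\<^bsub>G\<^esub> ?g"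
  have g: "?g \<in> carrier G" "x \<in> carrier G" using t \<iota>_closed pure_carrier[OF x] by auto
  have gen: "?g \<in> generate G S" "inv\<^bsub>G\<^esub> ?g \<in> generate G S" "?y \<in> generate G S"
    using S(2,3) t n by (auto simp: \<iota>_inv intro: generate.incl)
  have "inv\<^bsub>G\<^esub> ?g \<otimes>\<^bsub>G\<^esub> ?y \<otimes>\<^bsub>G\<^esub> ?g = (inv\<^bsub>G\<^esub> ?g \<otimes>\<^bsub>G\<^esub> ?g) \<otimes>\<^bsub>G\<^esub> x \<otimes>\<^bsub>G\<^esub> (inv\<^bsub>G\<^esub> ?g \<otimes>\<^bsub>G\<^esub> ?g)"
    using g by (simp only: G.m_assoc G.m_closed G.inv_closed)
  also have "\<dots> = x" using g by simp
  finally have "inv\<^bsub>G\<^esub> ?g \<otimes>\<^bsub>G\<^esub> ?y \<otimes>\<^bsub>G\<^esub> ?g = x" .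
  moreover have "inv\<^bsub>G\<^esub> ?g \<otimes>\<^bsub>G\<^esub> ?y \<otimes>\<^bsub>G\<^esub> ?g \<in> generate G S"
    by (intro generate.eng gen)
  ultimately show ?thesis by simp
qed

lemma pure_times_\<iota>:
  assumes x: "x \<in> carrier G"
  shows "(fst x, \<one>) \<in> pure UNIV" "x = (fst x, \<one>) \<otimes>\<^bsub>G\<^esub> \<iota> (snd x)"
proof -
  show p: "(fst x, \<one>) \<in> pure UNIV" using x by (simp add: pure_def carrier_G)
  show "x = (fst x, \<one>) \<otimes>\<^bsub>G\<^esub> \<iota> (snd x)"
  proof (rule G_eqI)
    show "x \<in> carrier G" by fact
    show "(fst x, \<one>) \<otimes>\<^bsub>G\<^esub> \<iota> (snd x) \<in> carrier G"
      using pure_carrier(1)[OF p] \<iota>_closed[OF snd_closed[OF x]] by simp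
    show "snd x = snd ((fst x, \<one>) \<otimes>\<^bsub>G\<^esub> \<iota> (snd x))" using snd_closed[OF x] by (simp add: snd_mult)
    fix i j assume ij: "idx i j"
    interpret ring "F i j" by (rule ring_idx[OF ij])
    show "fst x i j = fst ((fst x, \<one>) \<otimes>\<^bsub>G\<^esub> \<iota> (snd x)) i j"
      using fst_comp[OF x ij] by (simp add: fst_mult[OF ij] fst_\<iota>[OF ij] \<rho>_one[OF ij])
  qed
qed

lemma list_prod_\<iota>: "u \<in> lists (carrier A) \<Longrightarrow> list_prod G (map \<iota> u) = \<iota> (list_prod A u)"
  by (induction u) (auto simp: \<iota>_one \<iota>_mult intro!: A.list_prod_closed)

lemma lists_\<iota>: "u \<in> lists (\<iota> ` P) \<Longrightarrow> \<exists>u0\<in>lists P. u = map \<iota> u0"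
proof (induction u)
  case (Cons x u)
  then obtain u0 p where "u0 \<in> lists P" "u = map \<iota> u0" "p \<in> P" "x = \<iota> p" by auto
  then show ?case by (intro bexI[of _ "p # u0"]) auto
qed simp

lemma \<iota>_inj: "\<iota> a = \<iota> b \<longleftrightarrow> a = b"
  by (metis snd_\<iota>)

lemma generating_set_symmetric:
  assumes "P \<subseteq> carrier A" "\<And>s. s \<in> P \<Longrightarrow> inv s \<in> P" "s \<in> \<iota> ` P \<union> (\<Union>I\<in>\<I>. ball I)"
  shows "inv\<^bsub>G\<^esub> s \<in> \<iota> ` P \<union> (\<Union>I\<in>\<I>. ball I)"
proof (cases "s \<in> \<iota> ` P")
  case True
  then obtain p where "p \<in> P" "s = \<iota> p" by blast
  then show ?thesis using assms(1,2) \<iota>_inv by auto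
next
  case False
  then show ?thesis using assms(3) inv_in_ball by blast
qed

text \<open>How the vectors are generated differs between one ball for all summands and one ball for
  each summand; this is left to the premise \<open>gen\<close>.\<close>

lemma compact_symmetric_generatingI:
  assumes P: "finite P" "P \<subseteq> carrier A" "\<And>s. s \<in> P \<Longrightarrow> inv s \<in> P" "generate A P = carrier A"
    and \<I>: "finite \<I>"
    and gen: "\<And>S. \<lbrakk>S = \<iota> ` P \<union> (\<Union>I\<in>\<I>. ball I); S \<subseteq> carrier G; \<iota> ` carrier A \<subseteq> generate G S\<rbrakk> \<Longrightarrow>
      pure UNIV \<subseteq> generate G S"
  shows "compact_symmetric_generating G Top (\<iota> ` P \<union> (\<Union>I\<in>\<I>. ball I))"
  unfolding compact_symmetric_generating_def
proof (intro conjI ballI)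
  let ?S = "\<iota> ` P \<union> (\<Union>I\<in>\<I>. ball I)"
  show "compactin Top ?S"
    using P \<I> by (intro compactin_Un compactin_\<iota> compactin_Union) (auto simp: compactin_ball)
  then show sub: "?S \<subseteq> carrier G" using compactin_subset_topspace topspace_Top by metis
  show "inv\<^bsub>G\<^esub> s \<in> ?S" if "s \<in> ?S" for s using generating_set_symmetric[OF P(2,3)] that by blast
  have \<iota>_gen: "\<iota> ` carrier A \<subseteq> generate G ?S"
    using generate_\<iota>[OF _ sub P(2,4)] by blast
  have "x \<in> generate G ?S" if x: "x \<in> carrier G" for x
  proof -
    have "(fst x, \<one>) \<otimes>\<^bsub>G\<^esub> \<iota> (snd x) \<in> generate G ?S"
      using pure_times_\<iota>(1)[OF x] gen[OF HOL.refl sub \<iota>_gen] \<iota>_gen snd_closed[OF x]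
      by (intro generate.eng) blast+
    then show ?thesis using pure_times_\<iota>(2)[OF x] by simp
  qed
  then show "generate G ?S = carrier G" using G.generate_in_carrier[OF sub] by blast
qed

lemma pure_list_prod:
  assumes "distinct J" "\<And>i. i \<in> set J \<Longrightarrow> z i \<in> pure {i}"
  shows "list_prod G (map z J) \<in> carrier G \<and> snd (list_prod G (map z J)) = \<one> \<and>
    (\<forall>i j. idx i j \<longrightarrow> fst (list_prod G (map z J)) i j = (if i \<in> set J then fst (z i) i j else \<zero>\<^bsub>F i j\<^esub>))"
  using assms
proof (induction J)
  case Nil
  then show ?case by (simp add: fst_one snd_one)
next
  case (Cons l J)
  let ?y = "list_prod G (map z J)"
  have IH: "?y \<in> carrier G" "snd ?y = \<one>"
    "\<And>i j. idx i j \<Longrightarrow> fst ?y i j = (if i \<in> set J then fst (z i) i j else \<zero>\<^bsub>F i j\<^esub>)"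
    using Cons by auto
  have zl: "z l \<in> pure {l}" using Cons by simp
  note zc = pure_carrier[OF zl]
  have "fst (z l \<otimes>\<^bsub>G\<^esub> ?y) i j = (if i \<in> set (l # J) then fst (z i) i j else \<zero>\<^bsub>F i j\<^esub>)" if ij: "idx i j" for i j
  proof -
    interpret ring "F i j" by (rule ring_idx[OF ij])
    have "fst (z l \<otimes>\<^bsub>G\<^esub> ?y) i j = fst (z l) i j \<oplus>\<^bsub>F i j\<^esub> fst ?y i j" by (rule mult_pure[OF zc(1,2) IH(1) ij])
    moreover have "fst (z l) i j = \<zero>\<^bsub>F i j\<^esub>" if "i \<noteq> l" using zc(3)[OF ij] that by simp
    moreover have "l \<notin> set J" using Cons.prems by simp
    ultimately show ?thesis
      using IH(3)[OF ij] r_zero[OF fst_comp[OF zc(1) ij]] l_zero[OF fst_comp[OF IH(1) ij]]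
      by (cases "i = l") simp_all
  qed
  then show ?case using IH zc by (simp add: snd_mult)
qed

lemma restrict_pure:
  assumes "x \<in> carrier G"
  shows "(\<lambda>i\<in>{1..m}. \<lambda>j\<in>{1..k i}. if i = l then fst x i j else \<zero>\<^bsub>F i j\<^esub>, \<one>) \<in> pure {l}"
proof -
  have "(\<lambda>i\<in>{1..m}. \<lambda>j\<in>{1..k i}. if i = l then fst x i j else \<zero>\<^bsub>F i j\<^esub>) \<in> vectors"
    using fst_comp[OF assms] ring.ring_simprules(2)[OF ring_idx] by (intro vectorsI) auto
  then show ?thesis unfolding pure_def by (auto simp: carrier_G idx_def)
qed

lemma pure_decompose:
  assumes x: "x \<in> pure UNIV"
  shows "\<exists>z. (\<forall>i\<in>{1..m}. z i \<in> pure {i}) \<and> x = list_prod G (map z [1..<m+1])"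
proof -
  define z where "z = (\<lambda>l. (\<lambda>i\<in>{1..m}. \<lambda>j\<in>{1..k i}. if i = l then fst x i j else \<zero>\<^bsub>F i j\<^esub>, \<one>))"
  have z: "z l \<in> pure {l}" for l unfolding z_def by (rule restrict_pure[OF pure_carrier(1)[OF x]])
  have prod: "list_prod G (map z [1..<m+1]) \<in> carrier G" "snd (list_prod G (map z [1..<m+1])) = \<one>"
    "\<And>i j. idx i j \<Longrightarrow> fst (list_prod G (map z [1..<m+1])) i j =
      (if i \<in> set [1..<m+1] then fst (z i) i j else \<zero>\<^bsub>F i j\<^esub>)"
    using pure_list_prod[of "[1..<m+1]" z] z by auto
  have "x = list_prod G (map z [1..<m+1])"
  proof (rule G_eqI[OF pure_carrier(1)[OF x] prod(1)])
    show "snd x = snd (list_prod G (map z [1..<m+1]))" using prod(2) pure_carrier(2)[OF x] by simp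
    fix i j assume ij: "idx i j"
    have "fst (z i) i j = fst x i j" using ij by (simp add: z_def idx_def)
    moreover have "i \<in> set [1..<m+1]" using ij by (auto simp: idx_def)
    ultimately show "fst x i j = fst (list_prod G (map z [1..<m+1])) i j"
      using prod(3)[OF ij] by (simp only: if_True)
  qed
  then show ?thesis using z by blast
qed

text \<open>\<open>T\<close> collects all elements of A that the filling refers to: an independent
  set and a transversal for \<open>abelian_filling\<close>, generators, the contractions of pairs,
  and the inverses. Only then is \<open>M\<close> chosen, as it depends on all of \<open>T\<close>.
  The contraction for the pair (i, i) serves as \<open>\<tau> i\<close>.\<close>

lemma quadratically_filled_generating_set:
  "\<exists>S. compact_symmetric_generating G Top S \<and> G.polynomially_filled 2 S"
proof -
  obtain Y where Y: "finite Y" "Y \<subseteq> carrier A" "generate A Y = carrier A"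
    using fg unfolding finitely_generated_def by blast
  obtain B0 where B0: "int_independent A B0" "card B0 = abelian_rank A"
    using A.abelian_rank_props(1)[OF fg] by blast
  obtain P where P: "finite P" "P \<subseteq> carrier A" "\<one> \<in> P"
    "\<And>a. a \<in> carrier A \<Longrightarrow> \<exists>p\<in>P. \<exists>c. a = A.int_comb B0 c \<otimes> p"
    using A.finite_transversal[OF fg B0] by blast
  have B0': "finite B0" "B0 \<subseteq> carrier A" using B0 by (auto simp: A.int_independent_iff)
  let ?I = "{1..m} \<times> {1..m}"
  have "\<forall>p\<in>?I. \<exists>t. t \<in> carrier A \<and> (\<forall>i j. idx i j \<longrightarrow> i \<in> {fst p, snd p} \<longrightarrow> nrm i j t \<le> 1 / 2)"
  proof
    fix p assume p: "p \<in> ?I"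
    then obtain a where a: "a \<in> carrier A" "\<forall>j\<in>{1..k (fst p)}. N (fst p) j (\<rho> (fst p) j a) < 1"
      "\<forall>j\<in>{1..k (snd p)}. N (snd p) j (\<rho> (snd p) j a) < 1"
      using contraction[of "fst p" "snd p"] by auto
    have "nrm i j a < 1" if "idx i j" "i \<in> {fst p, snd p}" for i j
      using a(2,3) that by (auto simp: nrm_def idx_def)
    from contracting_power[OF a(1) this] obtain n where
      "\<forall>i j. idx i j \<longrightarrow> i \<in> {fst p, snd p} \<longrightarrow> nrm i j (a [^] (n::nat)) \<le> 1 / 2" by blast
    then show "\<exists>t. t \<in> carrier A \<and> (\<forall>i j. idx i j \<longrightarrow> i \<in> {fst p, snd p} \<longrightarrow> nrm i j t \<le> 1 / 2)"
      using a(1) by (intro exI[of _ "a [^] n"]) simp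
  qed
  from bchoice[OF this] obtain t where t: "\<forall>p\<in>?I. t p \<in> carrier A \<and>
      (\<forall>i j. idx i j \<longrightarrow> i \<in> {fst p, snd p} \<longrightarrow> nrm i j (t p) \<le> 1 / 2)" by blast
  have t1: "t (i, i') \<in> carrier A" if "i \<in> {1..m}" "i' \<in> {1..m}" for i i' using t that by auto
  have t2: "nrm l j (t (i, i')) \<le> 1 / 2" if "i \<in> {1..m}" "i' \<in> {1..m}" "idx l j" "l = i \<or> l = i'" for i i' l j
    using bspec[OF t, of "(i, i')"] that by auto
  define T0 where "T0 = B0 \<union> P \<union> Y \<union> t ` ?I"
  define T where "T = T0 \<union> m_inv A ` T0"
  have T0: "finite T0" "T0 \<subseteq> carrier A" unfolding T0_def using B0' P Y t by auto
  have T: "finite T" "T \<subseteq> carrier A" unfolding T_def using T0 by auto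
  have T_inv: "inv s \<in> T" if "s \<in> T" for s
    using that T0 unfolding T_def by (auto simp: subset_iff)
  have T_sub: "B0 \<subseteq> T" "P \<subseteq> T" "Y \<subseteq> T" and tT: "\<And>i i'. \<lbrakk>i \<in> {1..m}; i' \<in> {1..m}\<rbrakk> \<Longrightarrow> t (i, i') \<in> T"
    unfolding T_def T0_def by auto
  have T_gen: "generate A T = carrier A"
    using A.mono_generate[OF T_sub(3)] A.generate_in_carrier[OF T(2)] Y(3) by blast
  obtain M where M: "\<forall>a\<in>T. \<forall>i j. idx i j \<longrightarrow> (1 / 2) ^ M * nrm i j a \<le> 1"
    using uniform_multiplier[OF T] by blast
  obtain l1 Q where fill: "\<forall>u v n. u \<in> lists T \<longrightarrow> v \<in> lists T \<longrightarrow> length u \<le> n \<longrightarrow> length v \<le> n \<longrightarrow>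
      list_prod A u = list_prod A v \<longrightarrow> rewr A T l1 (Q * (n + 1)\<^sup>2) u v"
    using A.abelian_filling[OF B0(1) P T T_inv T_sub(1,2)] by blast
  \<comment> \<open>\<open>l1\<close> covers the relations inside A, \<open>2 * M + 3\<close> those
    of \<open>contracting_family\<close>.\<close>
  define l where "l = max l1 (2 * M + 3)"
  have I_set: "set [1..<m+1] = {1..m}" unfolding set_upt by auto
  define S where "S = \<iota> ` T \<union> (\<Union>I\<in>(\<lambda>i. {i}) ` {1..m}. ball I)"
  have S_gen: "compact_symmetric_generating G Top S"
    unfolding S_def
  proof (rule compact_symmetric_generatingI[OF T T_inv T_gen])
    fix S assume S: "S = \<iota> ` T \<union> (\<Union>I\<in>(\<lambda>i. {i}) ` {1..m}. ball I)" "S \<subseteq> carrier G"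
      "\<iota> ` carrier A \<subseteq> generate G S"
    show "pure UNIV \<subseteq> generate G S"
    proof
      fix x assume "x \<in> pure UNIV"
      then obtain z where z: "\<And>i. i \<in> {1..m} \<Longrightarrow> z i \<in> pure {i}" "x = list_prod G (map z [1..<m+1])"
        using pure_decompose by blast
      have zg: "z i \<in> generate G S" if i: "i \<in> {1..m}" for i
        by (rule generate_pure[OF S(2) _ S(3) t1[OF i i] _ z(1)[OF i]]) (use S(1) i t2[OF i i] in auto)
      have "list_prod G (map z J) \<in> generate G S" if "set J \<subseteq> {1..m}" for J
        using that by (induction J) (simp_all add: generate.one generate.eng zg del: One_nat_def)
      then show "x \<in> generate G S" unfolding z(2) by (simp only: I_set order_refl)
    qed
  qed auto
  note Sp = compact_symmetric_generating_props[OF S_gen]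
  have H: "subgroup (\<iota> ` carrier A) G"
    using group_hom.img_is_subgroup[of A G \<iota>] \<iota>_hom A.is_group group_G
    by (simp add: group_hom_def group_hom_axioms_def)
  have contr: "contracting_on G (\<iota> ` T) M (ball {l}) (\<iota> (t (i, i')))"
    if i: "i \<in> {1..m}" "i' \<in> {1..m}" "l = i \<or> l = i'" for l i i'
    unfolding contracting_on_def
  proof (intro conjI ballI)
    let ?t = "t (i, i')"
    have tc: "?t \<in> carrier A" using t1 i by blast
    have tn: "nrm l' j ?t \<le> 1 / 2" if "idx l' j" "l' \<in> {l}" for l' j using t2[OF i(1,2) that(1)] that i by auto
    show "\<iota> ?t \<in> \<iota> ` T" using tT i by blast
    show "\<iota> ?t \<otimes>\<^bsub>G\<^esub> x \<otimes>\<^bsub>G\<^esub> inv\<^bsub>G\<^esub> (\<iota> ?t) \<in> ball {l}" if "x \<in> ball {l}" for x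
      using tn by (intro ball_conj[OF tc _ that]) force
    fix a x assume "a \<in> \<iota> ` T" and x: "x \<in> ball {l}"
    then obtain b where b: "b \<in> T" "a = \<iota> b" by blast
    have bc: "b \<in> carrier A" using b T by blast
    let ?c = "?t [^] M \<otimes> b"
    have c: "?c \<in> carrier A" using tc bc by simp
    have eq: "\<iota> ?t [^]\<^bsub>G\<^esub> M \<otimes>\<^bsub>G\<^esub> a = \<iota> ?c" using tc bc b(2) by (simp add: \<iota>_pow \<iota>_mult)
    have "nrm l' j ?c \<le> 1" if "idx l' j" "l' \<in> {l}" for l' j
    proof -
      have "nrm l' j ?c = nrm l' j ?t ^ M * nrm l' j b" using that tc bc by (simp add: nrm_mult nrm_pow)
      also have "\<dots> \<le> (1 / 2) ^ M * nrm l' j b"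
        using tn[OF that] nrm_pos[OF that(1) tc] nrm_pos[OF that(1) bc]
        by (intro mult_right_mono power_mono) auto
      also have "\<dots> \<le> 1" using M b(1) that by blast
      finally show ?thesis .
    qed
    then show "\<iota> ?t [^]\<^bsub>G\<^esub> M \<otimes>\<^bsub>G\<^esub> a \<otimes>\<^bsub>G\<^esub> x \<otimes>\<^bsub>G\<^esub> inv\<^bsub>G\<^esub> (\<iota> ?t [^]\<^bsub>G\<^esub> M \<otimes>\<^bsub>G\<^esub> a) \<in> ball {l}"
      unfolding eq by (intro ball_conj[OF c _ x])
  qed
  interpret CF: contracting_family G S "\<iota> ` T" "\<iota> ` carrier A" "[1..<m+1]" "\<lambda>i. ball {i}"
    "\<lambda>i. \<iota> (t (i, i))" M l Q
  proof (intro contracting_family.intro contracting_family_axioms.intro)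
    show "group G" by (rule group_G)
    show "S \<subseteq> carrier G" "\<And>s. s \<in> S \<Longrightarrow> inv\<^bsub>G\<^esub> s \<in> S" by (rule Sp(1), rule Sp(2))
    show "S \<subseteq> \<iota> ` T \<union> (\<Union>i\<in>set [1..<m+1]. ball {i})" unfolding I_set S_def by auto
    show "\<iota> ` T \<subseteq> S" unfolding S_def by blast
    show "\<iota> ` T \<subseteq> \<iota> ` carrier A" using T by blast
    show "inv\<^bsub>G\<^esub> s \<in> \<iota> ` T" if "s \<in> \<iota> ` T" for s using that T(2) T_inv by (auto simp: \<iota>_inv)
    show "subgroup (\<iota> ` carrier A) G" by (rule H)
    show "x \<otimes>\<^bsub>G\<^esub> y = y \<otimes>\<^bsub>G\<^esub> x" if xy: "x \<in> \<iota> ` carrier A" "y \<in> \<iota> ` carrier A" for x y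
    proof -
      obtain a b where ab: "a \<in> carrier A" "b \<in> carrier A" "x = \<iota> a" "y = \<iota> b" using xy by blast
      then show ?thesis using \<iota>_mult[OF ab(1,2)] \<iota>_mult[OF ab(2,1)] A.m_comm[OF ab(1,2)] by simp
    qed
    show "distinct [1..<m+1]" by simp
    show "ball {i} \<subseteq> S" if "i \<in> set [1..<m+1]" for i using that unfolding I_set S_def by blast
    show "\<one>\<^bsub>G\<^esub> \<in> ball {i}" for i by (rule one_in_ball)
    show "2 * M + 3 \<le> l" by (simp add: l_def)
    show "rewr G S l (Q * (n + 1)\<^sup>2) u v" if uv: "u \<in> lists (\<iota> ` T)" "v \<in> lists (\<iota> ` T)" "length u \<le> n"
      "length v \<le> n" "list_prod G u = list_prod G v" for u v n
    proof -
      obtain u0 v0 where u0: "u0 \<in> lists T" "u = map \<iota> u0" "v0 \<in> lists T" "v = map \<iota> v0"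
        using lists_\<iota>[OF uv(1)] lists_\<iota>[OF uv(2)] by blast
      have "u0 \<in> lists (carrier A)" "v0 \<in> lists (carrier A)" using u0 lists_mono[OF T(2)] by blast+
      then have "list_prod A u0 = list_prod A v0" using uv(5) list_prod_\<iota> u0 \<iota>_inj by simp
      then have "rewr A T l1 (Q * (n + 1)\<^sup>2) u0 v0" using fill u0(1,3) uv(3,4) u0(2,4) by simp
      then have "rewr G S l1 (Q * (n + 1)\<^sup>2) u v" unfolding u0(2,4)
        using \<iota>_hom T(2) by (intro rewr_hom[OF _ A.is_group group_G]) (auto simp: S_def)
      then show ?thesis by (rule rewr_mono_length) (simp add: l_def)
    qed
    show "x \<otimes>\<^bsub>G\<^esub> y = y \<otimes>\<^bsub>G\<^esub> x" if "x \<in> ball {i}" "y \<in> ball {j}" for i j x y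
      using that pure_commute by (simp add: ball_def)
    show "\<exists>s. contracting_on G (\<iota> ` T) M (ball {i}) s \<and> contracting_on G (\<iota> ` T) M (ball {i'}) s"
      if "i \<in> set [1..<m+1]" "i' \<in> set [1..<m+1]" for i i'
      using contr[of i i' i] contr[of i i' i'] that unfolding I_set by blast
    show "contracting_on G (\<iota> ` T) M (ball {i}) (\<iota> (t (i, i)))" if "i \<in> set [1..<m+1]" for i
      using contr[of i i i] that unfolding I_set by blast
    show "\<iota> (t (i, i)) \<otimes>\<^bsub>G\<^esub> (x \<otimes>\<^bsub>G\<^esub> y) \<otimes>\<^bsub>G\<^esub> inv\<^bsub>G\<^esub> (\<iota> (t (i, i))) \<in> ball {i}"
      if i: "i \<in> set [1..<m+1]" "x \<in> ball {i}" "y \<in> ball {i}" for i x y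
    proof -
      have "i \<in> {1..m}" using i(1) unfolding I_set .
      then show ?thesis using t1[of i i] t2[of i i] i(2,3) by (intro ball_conj_mult) auto
    qed
  qed
  have "\<exists>C. \<forall>w\<in>lists S. list_prod G w = \<one>\<^bsub>G\<^esub> \<longrightarrow> rewr G S l (C * (length w + 1)\<^sup>2) w []"
  proof (rule CF.quadratic_filling[of "\<lambda>i. pure {i}"])
    show "ball {i} \<subseteq> pure {i}" for i by (rule ball_pure)
    show "a \<otimes>\<^bsub>G\<^esub> x \<otimes>\<^bsub>G\<^esub> inv\<^bsub>G\<^esub> a \<in> pure {i}" if "a \<in> \<iota> ` T" "x \<in> pure {i}" for i a x
      using that T(2) conj_pure by blast
    fix z a assume z: "\<And>i. i \<in> set [1..<m+1] \<Longrightarrow> z i \<in> pure {i}" and a: "a \<in> \<iota> ` carrier A"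
      and prod: "list_prod G (map z [1..<m+1]) \<otimes>\<^bsub>G\<^esub> a = \<one>\<^bsub>G\<^esub>"
    let ?y = "list_prod G (map z [1..<m+1])"
    have y: "?y \<in> carrier G" "snd ?y = \<one>" "\<And>i j. idx i j \<Longrightarrow>
        fst ?y i j = (if i \<in> set [1..<m+1] then fst (z i) i j else \<zero>\<^bsub>F i j\<^esub>)"
      using pure_list_prod[OF _ z, of "[1..<m+1]"] by auto
    obtain b where b: "b \<in> carrier A" "a = \<iota> b" using a by blast
    have "snd (?y \<otimes>\<^bsub>G\<^esub> a) = b" using y(2) b by (simp add: snd_mult)
    then have "b = \<one>" using prod snd_one by simp
    then have a1: "a = \<one>\<^bsub>G\<^esub>" using b \<iota>_one by simp
    then have y1: "?y = \<one>\<^bsub>G\<^esub>" using prod y(1) by simp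
    have "z i = \<one>\<^bsub>G\<^esub>" if i: "i \<in> set [1..<m+1]" for i
    proof (rule G_eqI)
      show "z i \<in> carrier G" "snd (z i) = snd \<one>\<^bsub>G\<^esub>" using pure_carrier[OF z[OF i]] snd_one by simp_all
      fix i' j assume ij: "idx i' j"
      show "fst (z i) i' j = fst \<one>\<^bsub>G\<^esub> i' j"
      proof (cases "i' = i")
        case True
        then show ?thesis using y(3)[OF ij] i unfolding y1 by simp
      next
        case False
        then show ?thesis using pure_carrier(3)[OF z[OF i] ij] fst_one[OF ij] by simp
      qed
    qed simp
    then show "a = \<one>\<^bsub>G\<^esub> \<and> (\<forall>i\<in>set [1..<m+1]. z i = \<one>\<^bsub>G\<^esub>)" using a1 by blast
  qed
  then have "G.polynomially_filled 2 S" unfolding G.polynomially_filled_def by blast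
  then show ?thesis using S_gen by blast
qed

section \<open>The case of rank one\<close>

lemma ln_nrm_int_pow:
  assumes "idx i j" "a \<in> carrier A"
  shows "ln (nrm i j (a [^] (c::int))) = of_int c * ln (nrm i j a)"
proof (cases c)
  case (nonneg n)
  then show ?thesis using assms nrm_pos[OF assms] by (simp add: int_pow_int nrm_pow ln_realpow)
next
  case (neg n)
  have "a [^] c = inv (a [^] Suc n)" unfolding neg using assms(2) by (simp only: A.int_pow_neg int_pow_int)
  then have "nrm i j (a [^] c) = inverse (nrm i j a ^ Suc n)"
    using assms by (simp only: nrm_inv nrm_pow A.nat_pow_closed)
  then show ?thesis using nrm_pos[OF assms] unfolding neg by (simp add: ln_inverse ln_realpow algebra_simps del: power_Suc)
qed

lemma int_independent_singleton:
  "int_independent A {t} \<longleftrightarrow> t \<in> carrier A \<and> (\<forall>c::int. t [^] c = \<one> \<longrightarrow> c = 0)"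
proof (cases "t \<in> carrier A")
  case True
  have eq: "A.int_comb {t} c = t [^] c t" for c using True by (simp add: A.int_comb_def)
  show ?thesis
  proof
    assume ind: "int_independent A {t}"
    have "c = 0" if "t [^] c = \<one>" for c :: int
    proof -
      have "A.int_comb {t} (\<lambda>_. c) = \<one>" unfolding eq by (rule that)
      then show ?thesis using ind unfolding A.int_independent_iff by blast
    qed
    then show "t \<in> carrier A \<and> (\<forall>c::int. t [^] c = \<one> \<longrightarrow> c = 0)" using True by blast
  next
    assume "t \<in> carrier A \<and> (\<forall>c::int. t [^] c = \<one> \<longrightarrow> c = 0)"
    then show "int_independent A {t}" unfolding A.int_independent_iff eq using True by blast
  qed
qed (auto simp only: A.int_independent_iff insert_subset)

text \<open>In rank one a fixed power of each element is a power of a single \<open>b\<close>, so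
  the logarithms of its norms are proportional to those of \<open>b\<close>, with one factor for all
  fields. An element contracting two fields therefore forces the logarithms of \<open>b\<close> to
  have the same sign at both. Comparing with one fixed field, \<open>b\<close> or its inverse
  contracts everything.\<close>

lemma rank_one_contracting:
  assumes rank: "abelian_rank A = 1"
  shows "\<exists>t. int_independent A {t} \<and> (\<forall>i j. idx i j \<longrightarrow> nrm i j t \<le> 1 / 2)"
proof -
  obtain B where B: "int_independent A B" "card B = abelian_rank A" using A.abelian_rank_props(1)[OF fg] by blast
  obtain b where b: "B = {b}" using B(2) rank by (auto simp: card_1_singleton_iff)
  have bc: "b \<in> carrier A" and b0: "\<And>c::int. b [^] c = \<one> \<Longrightarrow> c = 0"
    using B(1) unfolding b int_independent_singleton by auto
  show ?thesis
  proof (cases "\<exists>i j. idx i j")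
    case False
    \<comment> \<open>Without any field the norm condition is empty, and \<open>b\<close> itself
      will do.\<close>
    then show ?thesis using B(1) b by blast
  next
    case True
    then obtain i0 j0 where ij0: "idx i0 j0" by blast
    obtain n where n: "n > 0" "\<forall>x\<in>carrier A. \<exists>c. x [^] (n::int) = A.int_comb B c"
      using A.uniform_power_in_int_comb[OF fg B] by blast
    define L where "L = (\<lambda>i j a. ln (nrm i j a))"
    have L: "\<exists>c::int. \<forall>i j. idx i j \<longrightarrow> of_int n * L i j a = of_int c * L i j b" if a: "a \<in> carrier A" for a
    proof -
      obtain c where "a [^] n = A.int_comb B c" using n(2) a by blast
      then have "a [^] n = b [^] c b" using bc by (simp add: b A.int_comb_def)
      then have "of_int n * L i j a = of_int (c b) * L i j b" if "idx i j" for i j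
        using ln_nrm_int_pow[OF that a, of n] ln_nrm_int_pow[OF that bc, of "c b"] unfolding L_def by simp
      then show ?thesis by blast
    qed
    \<comment> \<open>Both logarithms become negative when multiplied by the same integer
      \<open>c\<close>.\<close>
    have sign: "L i j b * L i0 j0 b > 0" if ij: "idx i j" for i j
    proof -
      obtain a where a: "a \<in> carrier A" "\<forall>j\<in>{1..k i}. N i j (\<rho> i j a) < 1" "\<forall>j\<in>{1..k i0}. N i0 j (\<rho> i0 j a) < 1"
        using contraction[of i i0] ij ij0 by (auto simp: idx_def)
      obtain c :: int where c: "\<forall>i j. idx i j \<longrightarrow> of_int n * L i j a = of_int c * L i j b" using L[OF a(1)] by blast
      have "L i j a < 0" "L i0 j0 a < 0"
        using a(2,3) ij ij0 nrm_pos[OF ij a(1)] nrm_pos[OF ij0 a(1)] by (auto simp: L_def nrm_def idx_def)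
      then have "of_int n * L i j a < 0" "of_int n * L i0 j0 a < 0" using n(1) by (simp_all add: mult_pos_neg)
      then have "of_int c * L i j b < 0" "of_int c * L i0 j0 b < 0" using c ij ij0 by auto
      then show ?thesis by (auto simp: mult_less_0_iff zero_less_mult_iff)
    qed
    define s where "s = (if L i0 j0 b < 0 then b else inv b)"
    have sc: "s \<in> carrier A" using bc by (simp add: s_def)
    have s_lt: "nrm i j s < 1" if ij: "idx i j" for i j
    proof (cases "L i0 j0 b < 0")
      case True
      then have "L i j b < 0" using sign[OF ij] by (auto simp: zero_less_mult_iff)
      then show ?thesis using True nrm_pos[OF ij bc] by (simp add: L_def s_def)
    next
      case False
      then have "L i j b > 0" using sign[OF ij] by (auto simp: zero_less_mult_iff)
      then have "nrm i j b > 1" using nrm_pos[OF ij bc] by (simp add: L_def)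
      then show ?thesis using False nrm_inv[OF ij bc] by (simp add: s_def inverse_less_1_iff)
    qed
    obtain p :: nat where p: "\<forall>i j. idx i j \<longrightarrow> i \<in> UNIV \<longrightarrow> nrm i j (s [^] p) \<le> 1 / 2"
      using contracting_power[OF sc, of UNIV] s_lt by blast
    \<comment> \<open>The zeroth power would be \<open>\<one>\<close>, which is not independent; the
      bound 1/2 at one field excludes it.\<close>
    have p0: "p \<noteq> 0"
    proof
      assume "p = 0"
      then have "nrm i0 j0 \<one> \<le> 1 / 2" using p ij0 by auto
      then show False using nrm_one[OF ij0] by simp
    qed
    have "c = 0" if c: "(s [^] p) [^] (c::int) = \<one>" for c
    proof -
      have "s [^] (int p * c) = \<one>" using c sc by (simp add: A.int_pow_pow flip: int_pow_int)
      then have "b [^] (int p * c) = \<one>" using bc by (auto simp: s_def A.int_pow_inv split: if_splits)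
      then have "int p * c = 0" by (rule b0)
      then show ?thesis using p0 by simp
    qed
    then have "int_independent A {s [^] p}" using sc unfolding int_independent_singleton by simp
    then show ?thesis using p by blast
  qed
qed

lemma power_word:
  assumes t: "t \<in> carrier A"
  shows "\<exists>w. w \<in> lists {\<iota> t, inv\<^bsub>G\<^esub> (\<iota> t)} \<and> list_prod G w = \<iota> (t [^] (c::int))"
proof (cases c)
  case (nonneg n)
  then show ?thesis using t \<iota>_closed[OF t]
    by (intro exI[of _ "replicate n (\<iota> t)"]) (simp add: G.list_prod_replicate \<iota>_pow int_pow_int)
next
  case (neg n)
  have "t [^] c = (inv t) [^] Suc n"
    unfolding neg using t by (simp only: A.int_pow_neg int_pow_int A.nat_pow_inv)
  then have "list_prod G (replicate (Suc n) (inv\<^bsub>G\<^esub> (\<iota> t))) = \<iota> (t [^] c)"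
    using t \<iota>_closed[OF A.inv_closed[OF t]] by (simp only: G.list_prod_replicate \<iota>_pow \<iota>_inv A.inv_closed)
  moreover have "replicate (Suc n) (inv\<^bsub>G\<^esub> (\<iota> t)) \<in> lists {\<iota> t, inv\<^bsub>G\<^esub> (\<iota> t)}" by auto
  ultimately show ?thesis by blast
qed

text \<open>Modulo powers of \<open>t\<close> the group A is covered by the finite set
  \<open>P\<close>. A letter following a representative is absorbed in one of two ways: a letter
  from A by choosing a new representative, a ball element by keeping the representative
  \<open>p\<close> and conjugating with \<open>M\<close> powers of \<open>t\<close> and
  \<open>p\<close>, which together contract.\<close>

lemma linearly_filled_generating_set:
  assumes rank: "abelian_rank A = 1"
  shows "\<exists>S. compact_symmetric_generating G Top S \<and> G.polynomially_filled 1 S"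
proof -
  obtain t where t: "int_independent A {t}" "\<And>i j. idx i j \<Longrightarrow> nrm i j t \<le> 1 / 2"
    using rank_one_contracting[OF rank] by blast
  have tc: "t \<in> carrier A" and t0: "\<And>c::int. t [^] c = \<one> \<Longrightarrow> c = 0"
    using t(1) unfolding int_independent_singleton by auto
  obtain Y where Y: "finite Y" "Y \<subseteq> carrier A" "generate A Y = carrier A"
    using fg unfolding finitely_generated_def by blast
  obtain P where P: "finite P" "P \<subseteq> carrier A" "\<one> \<in> P"
    "\<And>a. a \<in> carrier A \<Longrightarrow> \<exists>p\<in>P. \<exists>c. a = A.int_comb {t} c \<otimes> p"
    using A.finite_transversal[OF fg t(1)] rank by auto
  have P4: "\<exists>p\<in>P. \<exists>c::int. a = t [^] c \<otimes> p" if "a \<in> carrier A" for a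
    using P(4)[OF that] tc by (auto simp: A.int_comb_def)
  define T0 where "T0 = P \<union> Y \<union> {t}"
  define T where "T = T0 \<union> m_inv A ` T0"
  have T0: "finite T0" "T0 \<subseteq> carrier A" unfolding T0_def using P Y tc by auto
  have T: "finite T" "T \<subseteq> carrier A" unfolding T_def using T0 by auto
  have T_inv: "inv s \<in> T" if "s \<in> T" for s using that T0 unfolding T_def by (auto simp: subset_iff)
  have T_sub: "P \<subseteq> T" "Y \<subseteq> T" "t \<in> T" unfolding T_def T0_def by auto
  have T_gen: "generate A T = carrier A"
    using A.mono_generate[OF T_sub(2)] A.generate_in_carrier[OF T(2)] Y(3) by blast
  obtain M where M: "\<forall>a\<in>T. \<forall>i j. idx i j \<longrightarrow> (1 / 2) ^ M * nrm i j a \<le> 1"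
    using uniform_multiplier[OF T] by blast
  let ?t = "\<iota> t" and ?K = "ball UNIV"
  let ?D = "?K \<union> {?t, inv\<^bsub>G\<^esub> ?t}"
  have tG: "?t \<in> carrier G" using \<iota>_closed[OF tc] .
  define S where "S = \<iota> ` T \<union> (\<Union>I\<in>{UNIV}. ball I)"
  have S_eq: "S = \<iota> ` T \<union> ?K" by (simp add: S_def)
  have S_gen: "compact_symmetric_generating G Top S" unfolding S_def
  proof (rule compact_symmetric_generatingI[OF T T_inv T_gen])
    fix S assume S: "S = \<iota> ` T \<union> (\<Union>I\<in>{UNIV}. ball I)" "S \<subseteq> carrier G" "\<iota> ` carrier A \<subseteq> generate G S"
    have "ball UNIV \<subseteq> S" using S(1) by auto
    from generate_pure[OF S(2) this S(3) tc] t(2) show "pure UNIV \<subseteq> generate G S" by blast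
  qed auto
  note Sp = compact_symmetric_generating_props[OF S_gen]
  define absorbs where "absorbs = (\<lambda>(p, s) n. \<exists>\<beta> p'. \<beta> \<in> lists ?D \<and> length \<beta> \<le> n \<and> p' \<in> P \<and>
      \<iota> p \<otimes>\<^bsub>G\<^esub> \<iota> s = list_prod G \<beta> \<otimes>\<^bsub>G\<^esub> \<iota> p')"
  have "\<exists>n. \<forall>x\<in>P \<times> T. absorbs x n"
  proof (rule finite_uniform_bound)
    show "finite (P \<times> T)" using P T by simp
    fix x assume x: "x \<in> P \<times> T"
    obtain p s where ps: "x = (p, s)" "p \<in> carrier A" "s \<in> carrier A"
      using x subsetD[OF P(2)] subsetD[OF T(2)] by (cases x) auto
    obtain p' c where p': "p' \<in> P" "p \<otimes> s = t [^] (c::int) \<otimes> p'" using P4[of "p \<otimes> s"] ps by auto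
    obtain w where w: "w \<in> lists {?t, inv\<^bsub>G\<^esub> ?t}" "list_prod G w = \<iota> (t [^] c)" using power_word[OF tc] by blast
    have "\<iota> p \<otimes>\<^bsub>G\<^esub> \<iota> s = list_prod G w \<otimes>\<^bsub>G\<^esub> \<iota> p'"
      using \<iota>_mult[OF ps(2,3)] \<iota>_mult[of "t [^] c" p'] p' w(2) tc P(2) by auto
    moreover have "w \<in> lists ?D" using w(1) by auto
    ultimately have "absorbs x (length w)" unfolding absorbs_def ps prod.case using p'(1) by blast
    then show "\<exists>n. absorbs x n" by blast
  next
    show "absorbs x n" if ab: "absorbs x m" and le: "m \<le> n" for x m n
    proof -
      obtain p s where x: "x = (p, s)" by (cases x)
      obtain \<beta> p' where "\<beta> \<in> lists ?D" "length \<beta> \<le> m" "p' \<in> P" "\<iota> p \<otimes>\<^bsub>G\<^esub> \<iota> s = list_prod G \<beta> \<otimes>\<^bsub>G\<^esub> \<iota> p'"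
        using ab unfolding absorbs_def x prod.case by blast
      then show ?thesis using le unfolding absorbs_def x prod.case by (intro exI[of _ \<beta>] exI[of _ p']) simp
    qed
  qed
  then obtain c1 where c1: "\<forall>x\<in>P \<times> T. absorbs x c1" by blast
  \<comment> \<open>The representative left at the end of a relation is a power of \<open>t\<close>.
    Only finitely many representatives occur, so words of bounded length express them.\<close>
  define short where "short = (\<lambda>p n. (\<exists>c::int. p = t [^] c) \<longrightarrow>
      (\<exists>\<gamma>. \<gamma> \<in> lists ?D \<and> length \<gamma> \<le> n \<and> list_prod G \<gamma> = \<iota> p))"
  have "\<exists>n. \<forall>p\<in>P. short p n"
  proof (rule finite_uniform_bound[OF P(1)])
    fix p show "\<exists>n. short p n"
    proof (cases "\<exists>c::int. p = t [^] c")
      case True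
      then obtain c :: int where c: "p = t [^] c" by blast
      obtain w where w: "w \<in> lists {?t, inv\<^bsub>G\<^esub> ?t}" "list_prod G w = \<iota> (t [^] c)" using power_word[OF tc] by blast
      have "w \<in> lists ?D" using w(1) by auto
      then have "short p (length w)" unfolding short_def using w(2) c by (intro impI exI[of _ w]) simp
      then show ?thesis by blast
    qed (simp add: short_def)
  next
    show "short p n" if sh: "short p m" and le: "m \<le> n" for p m n
      unfolding short_def
    proof
      assume "\<exists>c::int. p = t [^] c"
      then obtain \<gamma> where "\<gamma> \<in> lists ?D" "length \<gamma> \<le> m" "list_prod G \<gamma> = \<iota> p"
        using sh unfolding short_def by blast
      then show "\<exists>\<gamma>. \<gamma> \<in> lists ?D \<and> length \<gamma> \<le> n \<and> list_prod G \<gamma> = \<iota> p" using le by (intro exI[of _ \<gamma>]) simp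
    qed
  qed
  then obtain c2 where c2: "\<forall>p\<in>P. short p c2" by blast
  \<comment> \<open>\<open>c1\<close> is for absorbing letters of \<open>T\<close>,
    \<open>c2\<close> for the final representative, and \<open>2 * M + 1\<close> for absorbing a
    ball element.\<close>
  define c where "c = c1 + c2 + 2 * M + 1"
  define l where "l = c + 3"
  \<comment> \<open>Infinite order of \<open>t\<close> separates the letters as
    \<open>halving_element\<close> requires.\<close>
  have t_ne: "t \<noteq> \<one>" "inv t \<noteq> \<one>" "t \<noteq> inv t"
  proof -
    show t1: "t \<noteq> \<one>" using t0[of 1] tc by auto
    then show "inv t \<noteq> \<one>" using tc by (simp add: A.inv_eq_1_iff)
    show "t \<noteq> inv t"
    proof
      assume "t = inv t"
      then have "t \<otimes> t = t \<otimes> inv t" by (rule arg_cong)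
      then have "t \<otimes> t = \<one>" by (simp only: A.r_inv[OF tc])
      then have "t [^] (2::int) = \<one>" using A.int_pow_mult[OF tc, of 1 1] tc by simp
      then show False using t0[of 2] by simp
    qed
  qed
  interpret HE: halving_element G ?K ?t S l
  proof (intro halving_element.intro halving_element_axioms.intro)
    show "group G" by (rule group_G)
    show "S \<subseteq> carrier G" "\<And>s. s \<in> S \<Longrightarrow> inv\<^bsub>G\<^esub> s \<in> S" by (rule Sp(1), rule Sp(2))
    show "?K \<subseteq> S" unfolding S_eq by blast
    show "\<one>\<^bsub>G\<^esub> \<in> ?K" by (rule one_in_ball)
    show "?t \<in> S" unfolding S_eq using T_sub(3) by blast
    show "?t \<notin> ?K" using t_ne(1) by (auto simp: ball_def)
    show "inv\<^bsub>G\<^esub> ?t \<notin> ?K" using t_ne(2) by (auto simp: ball_def \<iota>_inv[OF tc])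
    show "?t \<noteq> inv\<^bsub>G\<^esub> ?t" using t_ne(3) by (simp add: \<iota>_inv[OF tc] \<iota>_inj)
    show "?t \<otimes>\<^bsub>G\<^esub> (x \<otimes>\<^bsub>G\<^esub> y) \<otimes>\<^bsub>G\<^esub> inv\<^bsub>G\<^esub> ?t \<in> ?K" if "x \<in> ?K" "y \<in> ?K" for x y
      using ball_conj_mult[OF tc _ that] t(2) by blast
    show "3 \<le> l" by (simp add: l_def)
  qed
  have D_carrier: "?D \<subseteq> carrier G" using tG by (auto simp: ball_def)
  \<comment> \<open>The projection to A sees only the powers of \<open>t\<close>; as
    \<open>t\<close> has infinite order, a trivial word has height zero.\<close>
  have snd_height: "snd (list_prod G w) = t [^] HE.height w" if "w \<in> lists ?D" for w
    using that
  proof (induction w)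
    case Nil
    show ?case by (simp add: snd_one)
  next
    case (Cons x w)
    have "snd x = t [^] (if x = ?t then 1 else if x = inv\<^bsub>G\<^esub> ?t then -1 else 0 :: int)"
    proof -
      consider "x = ?t" | "x = inv\<^bsub>G\<^esub> ?t" "x \<noteq> ?t" | "x \<in> ?K" "x \<noteq> ?t" "x \<noteq> inv\<^bsub>G\<^esub> ?t" using Cons(1) by blast
      then show ?thesis
      proof cases
        case 1
        then show ?thesis using tc by simp
      next
        case 2
        then show ?thesis using tc by (simp add: \<iota>_inv A.int_pow_neg)
      next
        case 3
        then show ?thesis by (simp add: ball_def)
      qed
    qed
    then show ?case using Cons.IH tc by (simp only: list_prod_Cons snd_mult HE.height_simps A.int_pow_mult)
  qed
  have fill: "rewr G S l ((36 * c + 2) * (length w + 1)) w []" if w: "w \<in> lists S" "list_prod G w = \<one>\<^bsub>G\<^esub>" for w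
  proof (rule HE.linear_filling[of "\<iota> ` P"])
    show "\<iota> ` P \<subseteq> S" unfolding S_eq using T_sub(1) by blast
    show "\<one>\<^bsub>G\<^esub> \<in> \<iota> ` P" using imageI[OF P(3), of \<iota>] by (simp only: \<iota>_one)
    show "c + 2 \<le> l" by (simp add: l_def)
    show "HE.height w = 0" if "w \<in> lists ?D" "list_prod G w = \<one>\<^bsub>G\<^esub>" for w
    proof (rule t0)
      show "t [^] HE.height w = \<one>" using snd_height[OF that(1)] that(2) snd_one by simp
    qed
    show "\<exists>\<gamma>. \<gamma> \<in> lists ?D \<and> length \<gamma> \<le> c \<and> list_prod G \<gamma> = q"
      if q: "q \<in> \<iota> ` P" "\<beta> \<in> lists ?D" "list_prod G \<beta> \<otimes>\<^bsub>G\<^esub> q = \<one>\<^bsub>G\<^esub>" for q \<beta>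
    proof -
      obtain p where p: "p \<in> P" "q = \<iota> p" using q(1) by blast
      have pc: "p \<in> carrier A" using p P(2) by blast
      have "t [^] HE.height \<beta> \<otimes> p = \<one>"
        using arg_cong[OF q(3), of snd] snd_height[OF q(2)] by (simp add: snd_mult snd_one p(2))
      then have "p \<otimes> t [^] HE.height \<beta> = \<one>" using A.m_comm[OF pc A.int_pow_closed[OF tc]] by simp
      then have "inv (t [^] HE.height \<beta>) = p" using A.int_pow_closed[OF tc] pc by (rule A.inv_equality)
      then have "p = t [^] (- HE.height \<beta>)" using tc by (simp add: A.int_pow_neg)
      then obtain \<gamma> where "\<gamma> \<in> lists ?D" "length \<gamma> \<le> c2" "list_prod G \<gamma> = \<iota> p"
        using c2 p(1) unfolding short_def by blast
      then show ?thesis using p(2) by (intro exI[of _ \<gamma>]) (simp add: c_def)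
    qed
    show "\<exists>\<beta> p'. \<beta> \<in> lists ?D \<and> length \<beta> \<le> c \<and> p' \<in> \<iota> ` P \<and> q \<otimes>\<^bsub>G\<^esub> s = list_prod G \<beta> \<otimes>\<^bsub>G\<^esub> p'"
      if q: "q \<in> \<iota> ` P" and s: "s \<in> S" for q s
    proof -
      obtain p where p: "p \<in> P" "q = \<iota> p" using q by blast
      have pc: "p \<in> carrier A" and pT: "p \<in> T" using p P(2) T_sub(1) by blast+
      show ?thesis
      proof (cases "s \<in> \<iota> ` T")
        case True
        then obtain a where a: "a \<in> T" "s = \<iota> a" by blast
        have "absorbs (p, a) c1" using c1 p(1) a(1) by blast
        then obtain \<beta> p' where "\<beta> \<in> lists ?D" "length \<beta> \<le> c1" "p' \<in> P" "\<iota> p \<otimes>\<^bsub>G\<^esub> \<iota> a = list_prod G \<beta> \<otimes>\<^bsub>G\<^esub> \<iota> p'"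
          unfolding absorbs_def prod.case by blast
        then show ?thesis using p(2) a(2) by (intro exI[of _ \<beta>] exI[of _ "\<iota> p'"]) (simp add: c_def)
      next
        case False
        then have sK: "s \<in> ?K" using s unfolding S_eq by blast
        then have sG: "s \<in> carrier G" by (simp add: ball_def)
        \<comment> \<open>If y is the conjugate of \<open>s\<close> by \<open>?u\<close>, then p s
          is the conjugate of y by the power -M of \<open>t\<close>, followed by p. The element y
          stays in the ball because \<open>M\<close> powers of \<open>t\<close> outweigh p.\<close>
        let ?u = "t [^] M \<otimes> p"
        have uc: "?u \<in> carrier A" using tc pc by simp
        have "nrm i j ?u \<le> 1" if ij: "idx i j" for i j
        proof -
          have "nrm i j ?u = nrm i j t ^ M * nrm i j p" using ij tc pc by (simp add: nrm_mult nrm_pow)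
          also have "\<dots> \<le> (1 / 2) ^ M * nrm i j p"
            using t(2)[OF ij] nrm_pos[OF ij tc] nrm_pos[OF ij pc] by (intro mult_right_mono power_mono) auto
          also have "\<dots> \<le> 1" using M pT ij by blast
          finally show ?thesis .
        qed
        then have y: "\<iota> ?u \<otimes>\<^bsub>G\<^esub> s \<otimes>\<^bsub>G\<^esub> inv\<^bsub>G\<^esub> (\<iota> ?u) \<in> ?K" (is "?y \<in> _") by (intro ball_conj[OF uc _ sK])
        let ?\<beta> = "replicate M (inv\<^bsub>G\<^esub> ?t) @ [?y] @ replicate M ?t"
        have yG: "?y \<in> carrier G" using y by (simp add: ball_def)
        have \<beta>D: "?\<beta> \<in> lists ?D" using y by simp
        have tM: "?t [^]\<^bsub>G\<^esub> M = \<iota> (t [^] M)" "inv\<^bsub>G\<^esub> ?t [^]\<^bsub>G\<^esub> M = inv\<^bsub>G\<^esub> (\<iota> (t [^] M))"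
          using tc by (simp_all add: \<iota>_pow G.nat_pow_inv[OF tG])
        have g: "\<iota> (t [^] M) \<in> carrier G" "\<iota> p \<in> carrier G" "\<iota> ?u = \<iota> (t [^] M) \<otimes>\<^bsub>G\<^esub> \<iota> p"
          using tc pc by (simp_all add: \<iota>_closed \<iota>_mult)
        have "list_prod G ?\<beta> = inv\<^bsub>G\<^esub> (\<iota> (t [^] M)) \<otimes>\<^bsub>G\<^esub> (?y \<otimes>\<^bsub>G\<^esub> \<iota> (t [^] M))"
          using tG yG tM by (simp add: G.list_prod_append G.list_prod_replicate)
        then have "list_prod G ?\<beta> \<otimes>\<^bsub>G\<^esub> \<iota> p = inv\<^bsub>G\<^esub> (\<iota> (t [^] M)) \<otimes>\<^bsub>G\<^esub> (?y \<otimes>\<^bsub>G\<^esub> \<iota> ?u)"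
          using g yG by (simp add: G.m_assoc)
        also have "?y \<otimes>\<^bsub>G\<^esub> \<iota> ?u = \<iota> ?u \<otimes>\<^bsub>G\<^esub> s"
          using \<iota>_closed[OF uc] sG by (simp add: G.m_assoc)
        also have "inv\<^bsub>G\<^esub> (\<iota> (t [^] M)) \<otimes>\<^bsub>G\<^esub> (\<iota> ?u \<otimes>\<^bsub>G\<^esub> s) = \<iota> p \<otimes>\<^bsub>G\<^esub> s"
        proof -
          have "inv\<^bsub>G\<^esub> (\<iota> (t [^] M)) \<otimes>\<^bsub>G\<^esub> (\<iota> ?u \<otimes>\<^bsub>G\<^esub> s)
              = (inv\<^bsub>G\<^esub> (\<iota> (t [^] M)) \<otimes>\<^bsub>G\<^esub> \<iota> (t [^] M)) \<otimes>\<^bsub>G\<^esub> (\<iota> p \<otimes>\<^bsub>G\<^esub> s)"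
            unfolding g(3) using g(1,2) sG by (simp only: G.m_assoc G.m_closed G.inv_closed)
          then show ?thesis using g(1,2) sG by simp
        qed
        finally have "q \<otimes>\<^bsub>G\<^esub> s = list_prod G ?\<beta> \<otimes>\<^bsub>G\<^esub> \<iota> p" using p(2) by simp
        moreover have "length ?\<beta> \<le> c" by (simp add: c_def)
        ultimately show ?thesis using \<beta>D p(1) by blast
      qed
    qed
  qed (rule w)+
  then have "G.polynomially_filled 1 S" unfolding G.polynomially_filled_def
    by (intro exI[of _ l] exI[of _ "36 * c + 2"]) simp
  then show ?thesis using S_gen by blast
qed

text \<open>Two coordinate homomorphisms of A, composed with the projection, are the plane
  coordinates; they are bounded on compact sets since these have finite projection. At two members
  of an independent set of maximal size their determinant is the nonzero square of n.\<close>

lemma quadratic_dehn_function_G: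
  assumes rank: "abelian_rank A \<ge> 2"
  shows "quadratic_dehn_function G Top"
proof -
  obtain B where B: "int_independent A B" "card B = abelian_rank A" using A.abelian_rank_props(1)[OF fg] by blast
  have "finite B" using rank B(2) by (intro card_ge_0_finite) simp
  moreover have "\<not> card B \<le> Suc 0" using rank B(2) by simp
  ultimately obtain b b' where b: "b \<in> B" "b' \<in> B" "b \<noteq> b'" using card_le_Suc0_iff_eq by blast
  have bc: "b \<in> carrier A" "b' \<in> carrier A" using B(1) b by (auto simp: A.int_independent_iff)
  obtain n h where n: "n > 0"
    and h: "\<forall>b\<in>B. \<forall>x\<in>carrier A. \<forall>y\<in>carrier A. h b (x \<otimes> y) = h b x + (h b y :: int)"
    and h': "\<forall>b\<in>B. \<forall>b'\<in>B. h b b' = (if b' = b then n else 0)"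
    using A.additive_coordinates[OF fg B] by blast
  obtain S where S: "compact_symmetric_generating G Top S" "G.polynomially_filled 2 S"
    using quadratically_filled_generating_set by blast
  show ?thesis
  proof (rule quadratic_dehn_function_if_filled[OF locally_compact_group_G S])
    show "h b (snd (x \<otimes>\<^bsub>G\<^esub> y)) = h b (snd x) + h b (snd y)" "h b' (snd (x \<otimes>\<^bsub>G\<^esub> y)) = h b' (snd x) + h b' (snd y)"
      if "x \<in> carrier G" "y \<in> carrier G" for x y
      using h b snd_closed that by (simp_all add: snd_mult)
    show "\<exists>c. \<forall>s\<in>S. \<bar>h b (snd s)\<bar> \<le> c \<and> \<bar>h b' (snd s)\<bar> \<le> c" if S: "compactin Top S" for S
    proof -
      let ?F = "(\<lambda>a. \<bar>h b a\<bar> + \<bar>h b' a\<bar>) ` snd ` S"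
      have fin: "finite ?F" using compactin_finite_snd[OF S] by simp
      have "\<bar>h b (snd s)\<bar> \<le> Max ?F \<and> \<bar>h b' (snd s)\<bar> \<le> Max ?F" if "s \<in> S" for s
      proof -
        have "\<bar>h b (snd s)\<bar> + \<bar>h b' (snd s)\<bar> \<le> Max ?F" using that by (intro Max_ge[OF fin]) blast
        then show ?thesis by linarith
      qed
      then show ?thesis by blast
    qed
    show "\<iota> b \<in> carrier G" "\<iota> b' \<in> carrier G" using bc by (simp_all add: \<iota>_closed)
    show "\<iota> b \<otimes>\<^bsub>G\<^esub> \<iota> b' = \<iota> b' \<otimes>\<^bsub>G\<^esub> \<iota> b"
      using \<iota>_mult[OF bc] \<iota>_mult[OF bc(2,1)] A.m_comm[OF bc] by simp
    show "h b (snd (\<iota> b)) * h b' (snd (\<iota> b')) - h b' (snd (\<iota> b)) * h b (snd (\<iota> b')) \<noteq> 0"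
      using h' b n by auto
  qed
qed

end

theorem theorem3p1:
  fixes A :: "'a monoid" and d m :: nat and k :: "nat \<Rightarrow> nat"
    and F :: "nat \<Rightarrow> nat \<Rightarrow> 'k ring" and N :: "nat \<Rightarrow> nat \<Rightarrow> 'k \<Rightarrow> real"
    and \<rho> :: "nat \<Rightarrow> nat \<Rightarrow> 'a \<Rightarrow> 'k"
  assumes "comm_group A" and "finitely_generated A" and "abelian_rank A = d"
    and "\<And>i j. \<lbrakk>i \<in> {1..m}; j \<in> {1..k i}\<rbrakk> \<Longrightarrow> local_field (F i j) (N i j)"
    and "\<And>i j. \<lbrakk>i \<in> {1..m}; j \<in> {1..k i}\<rbrakk> \<Longrightarrow> \<rho> i j \<in> hom A (Multiplicative_Group.mult_of (F i j))"
    and "\<And>i i'. \<lbrakk>i \<in> {1..m}; i' \<in> {1..m}\<rbrakk> \<Longrightarrow>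
           \<exists>a \<in> carrier A. (\<forall>j \<in> {1..k i}. N i j (\<rho> i j a) < 1) \<and>
                            (\<forall>j \<in> {1..k i'}. N i' j (\<rho> i' j a) < 1)"
  shows "compactly_presented (scalar_semidirect m k F \<rho> A) (scalar_semidirect_topology m k F N A) \<and>
    (d \<ge> 2 \<longrightarrow>
       quadratic_dehn_function (scalar_semidirect m k F \<rho> A) (scalar_semidirect_topology m k F N A)) \<and>
    (d = 1 \<longrightarrow>
       linear_dehn_function (scalar_semidirect m k F \<rho> A) (scalar_semidirect_topology m k F N A))"
proof -
  interpret scalar_semidirect_setup A m k F N \<rho>
    by (intro scalar_semidirect_setup.intro scalar_semidirect_setup_axioms.intro assms)
  obtain S where S: "compact_symmetric_generating G Top S" "G.polynomially_filled 2 S"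
    using quadratically_filled_generating_set by blast
  have "compactly_presented G Top"
    using compactly_presented_if_filled[OF locally_compact_group_G S] by simp
  moreover have "quadratic_dehn_function G Top" if "d \<ge> 2"
    using that assms(3) quadratic_dehn_function_G by simp
  moreover have "linear_dehn_function G Top" if "d = 1"
    using that assms(3) linearly_filled_generating_set linear_dehn_function_if_filled[OF locally_compact_group_G] by blast
  ultimately show ?thesis by blast
qed

end
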